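(* Let $K$ be a field. Any connected unital infinitesimal bialgebra $\mathcal H$ over $K$ is isomorphic, as a unital infinitesimal bialgebra, to $T^{fc}(\mathrm{Prim}\,\mathcal H)$, i.e. to the tensor module $T(\mathrm{Prim}\,\mathcal H)=\bigoplus_{n\ge0}(\mathrm{Prim}\,\mathcal H)^{\otimes n}$ equipped with the concatenation product and the deconcatenation coproduct.
   Context: A unital infinitesimal bialgebra $(\mathcal H,\cdot,\Delta)$ over $K$ is a $K$-vector space with a unital associative product $\cdot$ and a counital coassociative coproduct $\Delta$ such that $\Delta(x\cdot y)=(x\otimes1)\cdot\Delta(y)+\Delta(x)\cdot(1\otimes y)-x\otimes y$ for all $x,y$, where $(a\otimes b)\cdot(a'\otimes b')=a\cdot a'\otimes b\cdot b'$. (It follows that $\Delta(1)=1\otimes1$.) Put $\overline\Delta(x)=\Delta(x)-x\otimes1-1\otimes x$. $\mathrm{Prim}\,\mathcal H=\{x:\overline\Delta(x)=0\}$. $\mathcal H$ is connected if $\mathcal H=\bigcup_{r\ge0}F_r\mathcal H$, where $F_0\mathcal H=K1$ and $F_r\mathcal H=\{x:\overline\Delta(x)\in F_{r-1}\mathcal H\otimes F_{r-1}\mathcal H\}$. Concatenation: $(v_1\cdots v_p)\cdot(v_{p+1}\cdots v_n)=v_1\cdots v_n$. Deconcatenation: $\Delta(v_1\cdots v_n)=\sum_{i=0}^nv_1\cdots v_i\otimes v_{i+1}\cdots v_n$.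
   Formalization: The bialgebra H is assumed nonzero (1 ≠ 0): the zero bialgebra literally satisfies the definitions and is connected with Prim H = 0, but T(0) = K is not zero, so the statement fails there. *)

theory Defs
  imports "HOL-Algebra.Module" "HOL-Algebra.QuotRing"
begin

section \<open>Modules given by generators and relations\<close>

text \<open>The fields \<open>mult\<close> and \<open>one\<close> of the record type \<open>module\<close> play no role for modules that are
  not algebras; they are left \<^const>\<open>undefined\<close>.\<close>

definition free_module :: "('k, 'r) ring_scheme \<Rightarrow> 'x set \<Rightarrow> ('k, 'x \<Rightarrow> 'k) module" where
  "free_module K X =
    \<lparr>carrier = {f. (\<forall>x. f x \<in> carrier K) \<and> {x. f x \<noteq> \<zero>\<^bsub>K\<^esub>} \<subseteq> X \<and> finite {x. f x \<noteq> \<zero>\<^bsub>K\<^esub>}},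
     mult = undefined, one = undefined,
     zero = (\<lambda>x. \<zero>\<^bsub>K\<^esub>), add = (\<lambda>f g x. f x \<oplus>\<^bsub>K\<^esub> g x),
     smult = (\<lambda>c f x. c \<otimes>\<^bsub>K\<^esub> f x)\<rparr>"

definition free_gen :: "('k, 'r) ring_scheme \<Rightarrow> 'x \<Rightarrow> 'x \<Rightarrow> 'k" where
  "free_gen K x = (\<lambda>y. if y = x then \<one>\<^bsub>K\<^esub> else \<zero>\<^bsub>K\<^esub>)"

definition module_span ::
    "('k, 'r) ring_scheme \<Rightarrow> ('k, 'a, 'm) module_scheme \<Rightarrow> 'a set \<Rightarrow> 'a set" where
  "module_span K M S = \<Inter>{N. submodule N K M \<and> S \<subseteq> N}"

definition quot_module ::
    "('k, 'a, 'm) module_scheme \<Rightarrow> 'a set \<Rightarrow> ('k, 'a set) module" where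
  "quot_module M N =
    \<lparr>carrier = a_rcosets\<^bsub>M\<^esub> N, mult = undefined, one = undefined,
     zero = N, add = set_add M,
     smult = (\<lambda>c A. \<Union>a\<in>A. N +>\<^bsub>M\<^esub> (c \<odot>\<^bsub>M\<^esub> a))\<rparr>"

definition presented_module ::
    "('k, 'r) ring_scheme \<Rightarrow> 'x set \<Rightarrow> ('x \<Rightarrow> 'k) set \<Rightarrow> ('k, ('x \<Rightarrow> 'k) set) module" where
  "presented_module K X R =
    quot_module (free_module K X) (module_span K (free_module K X) R)"

definition presented_gen ::
    "('k, 'r) ring_scheme \<Rightarrow> 'x set \<Rightarrow> ('x \<Rightarrow> 'k) set \<Rightarrow> 'x \<Rightarrow> ('x \<Rightarrow> 'k) set" where
  "presented_gen K X R x =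
    module_span K (free_module K X) R +>\<^bsub>free_module K X\<^esub> free_gen K x"

text \<open>The linear map from a presented module to \<open>P\<close> that sends the class of each generator \<open>x\<close>
  to \<open>g x\<close>. It is meaningful when \<open>g\<close> respects the relations: then the image of a coset under
  the linear extension of \<open>g\<close> to the free module is a singleton.\<close>

definition lin_ext :: "('k, 'r) ring_scheme \<Rightarrow> ('k, 'p, 'm) module_scheme
    \<Rightarrow> ('x \<Rightarrow> 'p) \<Rightarrow> ('x \<Rightarrow> 'k) set \<Rightarrow> 'p" where
  "lin_ext K P g A =
    the_elem ((\<lambda>f. \<Oplus>\<^bsub>P\<^esub>x\<in>{x. f x \<noteq> \<zero>\<^bsub>K\<^esub>}. f x \<odot>\<^bsub>P\<^esub> g x) ` A)"

definition module_hom :: "('k, 'r) ring_scheme \<Rightarrow> ('k, 'a, 'm) module_scheme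
    \<Rightarrow> ('k, 'b, 'n) module_scheme \<Rightarrow> ('a \<Rightarrow> 'b) set" where
  "module_hom K M N = {f \<in> carrier M \<rightarrow> carrier N.
     (\<forall>x\<in>carrier M. \<forall>y\<in>carrier M. f (x \<oplus>\<^bsub>M\<^esub> y) = f x \<oplus>\<^bsub>N\<^esub> f y) \<and>
     (\<forall>c\<in>carrier K. \<forall>x\<in>carrier M. f (c \<odot>\<^bsub>M\<^esub> x) = c \<odot>\<^bsub>N\<^esub> f x)}"


section \<open>Tensor products\<close>

definition tensor_rels :: "('k, 'r) ring_scheme \<Rightarrow> ('k, 'a, 'm) module_scheme
    \<Rightarrow> ('k, 'b, 'n) module_scheme \<Rightarrow> ('a \<times> 'b \<Rightarrow> 'k) set" where
  "tensor_rels K M N =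
    (let F = free_module K (carrier M \<times> carrier N); d = free_gen K in
      {d (a \<oplus>\<^bsub>M\<^esub> a', b) \<ominus>\<^bsub>F\<^esub> (d (a, b) \<oplus>\<^bsub>F\<^esub> d (a', b)) | a a' b.
         a \<in> carrier M \<and> a' \<in> carrier M \<and> b \<in> carrier N} \<union>
      {d (a, b \<oplus>\<^bsub>N\<^esub> b') \<ominus>\<^bsub>F\<^esub> (d (a, b) \<oplus>\<^bsub>F\<^esub> d (a, b')) | a b b'.
         a \<in> carrier M \<and> b \<in> carrier N \<and> b' \<in> carrier N} \<union>
      {d (c \<odot>\<^bsub>M\<^esub> a, b) \<ominus>\<^bsub>F\<^esub> c \<odot>\<^bsub>F\<^esub> d (a, b) | c a b.
         c \<in> carrier K \<and> a \<in> carrier M \<and> b \<in> carrier N} \<union>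
      {d (a, c \<odot>\<^bsub>N\<^esub> b) \<ominus>\<^bsub>F\<^esub> c \<odot>\<^bsub>F\<^esub> d (a, b) | c a b.
         c \<in> carrier K \<and> a \<in> carrier M \<and> b \<in> carrier N})"

definition tensor :: "('k, 'r) ring_scheme \<Rightarrow> ('k, 'a, 'm) module_scheme
    \<Rightarrow> ('k, 'b, 'n) module_scheme \<Rightarrow> ('k, ('a \<times> 'b \<Rightarrow> 'k) set) module" where
  "tensor K M N = presented_module K (carrier M \<times> carrier N) (tensor_rels K M N)"

definition pure_tensor :: "('k, 'r) ring_scheme \<Rightarrow> ('k, 'a, 'm) module_scheme
    \<Rightarrow> ('k, 'b, 'n) module_scheme \<Rightarrow> 'a \<Rightarrow> 'b \<Rightarrow> ('a \<times> 'b \<Rightarrow> 'k) set" where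
  "pure_tensor K M N a b =
    presented_gen K (carrier M \<times> carrier N) (tensor_rels K M N) (a, b)"

definition tensor_lift :: "('k, 'r) ring_scheme \<Rightarrow> ('k, 'p, 'm) module_scheme
    \<Rightarrow> ('a \<Rightarrow> 'b \<Rightarrow> 'p) \<Rightarrow> ('a \<times> 'b \<Rightarrow> 'k) set \<Rightarrow> 'p" where
  "tensor_lift K P \<beta> = lin_ext K P (\<lambda>(a, b). \<beta> a b)"

text \<open>In \<open>tensor_map\<close>, \<open>M\<close> and \<open>N\<close> are the codomains of \<open>f\<close> and \<open>g\<close>.\<close>

definition tensor_map :: "('k, 'r) ring_scheme \<Rightarrow> ('k, 'c, 'm) module_scheme
    \<Rightarrow> ('k, 'd, 'n) module_scheme \<Rightarrow> ('a \<Rightarrow> 'c) \<Rightarrow> ('b \<Rightarrow> 'd)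
    \<Rightarrow> ('a \<times> 'b \<Rightarrow> 'k) set \<Rightarrow> ('c \<times> 'd \<Rightarrow> 'k) set" where
  "tensor_map K M N f g =
    tensor_lift K (tensor K M N) (\<lambda>a b. pure_tensor K M N (f a) (g b))"

definition tensor_assoc :: "('k, 'r) ring_scheme \<Rightarrow> ('k, 'a, 'm) module_scheme
    \<Rightarrow> ('k, 'b, 'n) module_scheme \<Rightarrow> ('k, 'c, 'p) module_scheme
    \<Rightarrow> (('a \<times> 'b \<Rightarrow> 'k) set \<times> 'c \<Rightarrow> 'k) set \<Rightarrow> ('a \<times> ('b \<times> 'c \<Rightarrow> 'k) set \<Rightarrow> 'k) set" where
  "tensor_assoc K M N P =
    tensor_lift K (tensor K M (tensor K N P)) (\<lambda>t c.
      tensor_lift K (tensor K M (tensor K N P)) (\<lambda>a b.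
        pure_tensor K M (tensor K N P) a (pure_tensor K N P b c)) t)"

definition tensor_mult :: "('k, 'r) ring_scheme \<Rightarrow> ('k, 'a, 'm) module_scheme
    \<Rightarrow> ('a \<times> 'a \<Rightarrow> 'k) set \<Rightarrow> ('a \<times> 'a \<Rightarrow> 'k) set \<Rightarrow> ('a \<times> 'a \<Rightarrow> 'k) set" where
  "tensor_mult K H s t =
    tensor_lift K (tensor K H H) (\<lambda>a b.
      tensor_lift K (tensor K H H) (\<lambda>a' b'.
        pure_tensor K H H (a \<otimes>\<^bsub>H\<^esub> a') (b \<otimes>\<^bsub>H\<^esub> b')) t) s"


section \<open>Unital infinitesimal bialgebras\<close>

record ('k, 'a) bialg = "('k, 'a) module" +
  coprod :: "'a \<Rightarrow> ('a \<times> 'a \<Rightarrow> 'k) set"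
  counit :: "'a \<Rightarrow> 'k"

text \<open>The axioms are also satisfied by the zero module (where \<open>\<one> = \<zero>\<close> and the counit is \<open>\<zero>\<close>);
  \<open>\<one> \<noteq> \<zero>\<close> has to be assumed where the unit is meant to span a line.\<close>

locale unital_infinitesimal_bialgebra = module K H + H: ring H
  for K :: "('k, 'r) ring_scheme" and H :: "('k, 'a, 'm) bialg_scheme" +
  assumes smult_mult_left:
      "\<lbrakk>c \<in> carrier K; x \<in> carrier H; y \<in> carrier H\<rbrakk>
        \<Longrightarrow> (c \<odot>\<^bsub>H\<^esub> x) \<otimes>\<^bsub>H\<^esub> y = c \<odot>\<^bsub>H\<^esub> (x \<otimes>\<^bsub>H\<^esub> y)"
    and smult_mult_right:
      "\<lbrakk>c \<in> carrier K; x \<in> carrier H; y \<in> carrier H\<rbrakk>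
        \<Longrightarrow> x \<otimes>\<^bsub>H\<^esub> (c \<odot>\<^bsub>H\<^esub> y) = c \<odot>\<^bsub>H\<^esub> (x \<otimes>\<^bsub>H\<^esub> y)"
    and coprod_hom: "coprod H \<in> module_hom K H (tensor K H H)"
    and coassoc: "x \<in> carrier H \<Longrightarrow>
      tensor_assoc K H H H (tensor_map K (tensor K H H) H (coprod H) id (coprod H x)) =
      tensor_map K H (tensor K H H) id (coprod H) (coprod H x)"
    and counit_closed: "counit H \<in> carrier H \<rightarrow> carrier K"
    and counit_add: "\<lbrakk>x \<in> carrier H; y \<in> carrier H\<rbrakk>
      \<Longrightarrow> counit H (x \<oplus>\<^bsub>H\<^esub> y) = counit H x \<oplus>\<^bsub>K\<^esub> counit H y"
    and counit_smult: "\<lbrakk>c \<in> carrier K; x \<in> carrier H\<rbrakk>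
      \<Longrightarrow> counit H (c \<odot>\<^bsub>H\<^esub> x) = c \<otimes>\<^bsub>K\<^esub> counit H x"
    and counit_left: "x \<in> carrier H \<Longrightarrow>
      tensor_lift K H (\<lambda>a b. counit H a \<odot>\<^bsub>H\<^esub> b) (coprod H x) = x"
    and counit_right: "x \<in> carrier H \<Longrightarrow>
      tensor_lift K H (\<lambda>a b. counit H b \<odot>\<^bsub>H\<^esub> a) (coprod H x) = x"
    and coprod_mult: "\<lbrakk>x \<in> carrier H; y \<in> carrier H\<rbrakk> \<Longrightarrow>
      coprod H (x \<otimes>\<^bsub>H\<^esub> y) =
        tensor_mult K H (pure_tensor K H H x \<one>\<^bsub>H\<^esub>) (coprod H y)
        \<oplus>\<^bsub>tensor K H H\<^esub> tensor_mult K H (coprod H x) (pure_tensor K H H \<one>\<^bsub>H\<^esub> y)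
        \<ominus>\<^bsub>tensor K H H\<^esub> pure_tensor K H H x y"

definition bialg_iso :: "('k, 'r) ring_scheme \<Rightarrow> ('k, 'a, 'm) bialg_scheme
    \<Rightarrow> ('k, 'b, 'n) bialg_scheme \<Rightarrow> ('a \<Rightarrow> 'b) set" where
  "bialg_iso K H H' = {f \<in> ring_iso H H' \<inter> module_hom K H H'.
     (\<forall>x\<in>carrier H. coprod H' (f x) = tensor_map K H' H' f f (coprod H x)) \<and>
     (\<forall>x\<in>carrier H. counit H' (f x) = counit H x)}"

definition reduced_coprod :: "('k, 'r) ring_scheme \<Rightarrow> ('k, 'a, 'm) bialg_scheme
    \<Rightarrow> 'a \<Rightarrow> ('a \<times> 'a \<Rightarrow> 'k) set" where
  "reduced_coprod K H x =
    coprod H x \<ominus>\<^bsub>tensor K H H\<^esub> pure_tensor K H H x \<one>\<^bsub>H\<^esub>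
      \<ominus>\<^bsub>tensor K H H\<^esub> pure_tensor K H H \<one>\<^bsub>H\<^esub> x"

definition primitives :: "('k, 'r) ring_scheme \<Rightarrow> ('k, 'a, 'm) bialg_scheme \<Rightarrow> 'a set" where
  "primitives K H = {x \<in> carrier H. reduced_coprod K H x = \<zero>\<^bsub>tensor K H H\<^esub>}"

abbreviation primitive_module ::
    "('k, 'r) ring_scheme \<Rightarrow> ('k, 'a, 'm) bialg_scheme \<Rightarrow> ('k, 'a, 'm) bialg_scheme" where
  "primitive_module K H \<equiv> H\<lparr>carrier := primitives K H\<rparr>"

text \<open>For a submodule \<open>F\<close> of \<open>H\<close>, the product \<open>F \<otimes> F\<close> is read as the image of
  the canonical map to \<open>H \<otimes> H\<close> (which is injective over a field).\<close>

primrec conn_filtration ::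
    "('k, 'r) ring_scheme \<Rightarrow> ('k, 'a, 'm) bialg_scheme \<Rightarrow> nat \<Rightarrow> 'a set" where
  "conn_filtration K H 0 = {c \<odot>\<^bsub>H\<^esub> \<one>\<^bsub>H\<^esub> | c. c \<in> carrier K}"
| "conn_filtration K H (Suc r) = {x \<in> carrier H. reduced_coprod K H x \<in>
     module_span K (tensor K H H)
       {pure_tensor K H H a b | a b. a \<in> conn_filtration K H r \<and> b \<in> conn_filtration K H r}}"

definition connected_bialg :: "('k, 'r) ring_scheme \<Rightarrow> ('k, 'a, 'm) bialg_scheme \<Rightarrow> bool" where
  "connected_bialg K H \<longleftrightarrow> carrier H = (\<Union>r. conn_filtration K H r)"


section \<open>The tensor module with concatenation and deconcatenation\<close>

text \<open>The module \<open>T(V) = \<Oplus>\<^sub>n V\<^sup>\<otimes>\<^sup>n\<close> is presented by all words over \<open>V\<close> (a word of length \<open>n\<close> being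
  a pure tensor in \<open>V\<^sup>\<otimes>\<^sup>n\<close>) subject to linearity in each letter. Every relation only involves
  words of one length, so this quotient is the direct sum over \<open>n\<close> of the free
  module on \<open>V\<^sup>n\<close> modulo the multilinearity relations; the empty word spans \<open>V\<^sup>\<otimes>\<^sup>0 = K\<close>.\<close>

definition word_rels ::
    "('k, 'r) ring_scheme \<Rightarrow> ('k, 'v, 'm) module_scheme \<Rightarrow> ('v list \<Rightarrow> 'k) set" where
  "word_rels K V =
    (let F = free_module K (lists (carrier V)); d = free_gen K in
      {d (u @ [a \<oplus>\<^bsub>V\<^esub> b] @ w) \<ominus>\<^bsub>F\<^esub> (d (u @ [a] @ w) \<oplus>\<^bsub>F\<^esub> d (u @ [b] @ w)) | u a b w.
         u \<in> lists (carrier V) \<and> w \<in> lists (carrier V) \<and> a \<in> carrier V \<and> b \<in> carrier V} \<union>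
      {d (u @ [c \<odot>\<^bsub>V\<^esub> a] @ w) \<ominus>\<^bsub>F\<^esub> c \<odot>\<^bsub>F\<^esub> d (u @ [a] @ w) | u c a w.
         u \<in> lists (carrier V) \<and> w \<in> lists (carrier V) \<and> c \<in> carrier K \<and> a \<in> carrier V})"

definition tensor_module ::
    "('k, 'r) ring_scheme \<Rightarrow> ('k, 'v, 'm) module_scheme \<Rightarrow> ('k, ('v list \<Rightarrow> 'k) set) module" where
  "tensor_module K V = presented_module K (lists (carrier V)) (word_rels K V)"

definition word :: "('k, 'r) ring_scheme \<Rightarrow> ('k, 'v, 'm) module_scheme
    \<Rightarrow> 'v list \<Rightarrow> ('v list \<Rightarrow> 'k) set" where
  "word K V = presented_gen K (lists (carrier V)) (word_rels K V)"

text \<open>The counit is the projection onto \<open>V\<^sup>\<otimes>\<^sup>0 = K\<close>: the coefficient of the empty word, which is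
  the same for all members of a coset.\<close>

definition Tfc :: "('k, 'r) ring_scheme \<Rightarrow> ('k, 'v, 'm) module_scheme
    \<Rightarrow> ('k, ('v list \<Rightarrow> 'k) set) bialg" where
  "Tfc K V = (let T = tensor_module K V in
    \<lparr>carrier = carrier T,
     mult = (\<lambda>s t. lin_ext K T (\<lambda>u. lin_ext K T (\<lambda>w. word K V (u @ w)) t) s),
     one = word K V [],
     zero = zero T, add = add T, smult = smult T,
     coprod = lin_ext K (tensor K T T) (\<lambda>w. \<Oplus>\<^bsub>tensor K T T\<^esub>i\<in>{0..length w}.
       pure_tensor K T T (word K V (take i w)) (word K V (drop i w))),
     counit = (\<lambda>t. the_elem ((\<lambda>f. f []) ` t))\<rparr>)"

end

theory Submission
  imports Defs
begin

text \<open>The isomorphism is the inverse of the algebra map \<open>\<phi> : T(Prim H) \<rightarrow> H\<close> that multiplies out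
  words. Let \<open>J = id - \<epsilon>\<close> and let \<open>e\<close> be the solution of \<open>id \<star> e = J\<close> for the convolution
  \<open>f \<star> g = mult \<circ> (f \<otimes> g) \<circ> \<Delta>\<close>; it exists because the iterates \<open>e\<^sub>k\<^sub>+\<^sub>1 = J - J \<star> e\<^sub>k\<close>,
  \<open>e\<^sub>0 = 0\<close>, are stationary on each \<open>F\<^sub>k\<close>. The infinitesimal compatibility gives
  \<open>\<Delta>(x p) = x p \<otimes> 1 + \<Delta>(x) (1 \<otimes> p)\<close> for primitive \<open>p\<close>, and with coassociativity this shows by
  induction along the filtration that \<open>e\<close> has primitive values. Hence \<open>x = \<epsilon>(x) + \<Sum> x\<^sub>1 e(x\<^sub>2)\<close>
  expresses \<open>x\<close> through products of primitive elements, so \<open>\<phi>\<close> is surjective. The same formula for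
  \<open>\<Delta>(x p)\<close> yields \<open>e(x p) = \<epsilon>(x) p\<close>, so \<open>e\<close> reads off the last letter of a word, and
  \<open>\<psi>(x) = \<epsilon>(x) 1 + \<Sum> \<psi>(x\<^sub>1) e(x\<^sub>2)\<close> recovers the whole word from its product, so \<open>\<phi>\<close> is
  injective. No basis of \<open>Prim H\<close> is chosen, and no injectivity on \<open>H \<otimes> H\<close> is needed.\<close>

section \<open>Module homomorphisms and quotients\<close>

text \<open>For x in F_{k+1}, \<Delta>(x) is x \<otimes> 1 + 1 \<otimes> x plus a combination of
  tensors from F_k \<otimes> F_k. The recursion runs on J rather than on id because J and all its
  iterates kill 1: both outer terms then contribute nothing to a convolution of J with an iterate,
  so level k+1 only consults level k.

  Primitivity of e is a cancellation. For primitive p the reduced coproduct of y p is (\<Delta>(y) -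
  1 \<otimes> y)(1 \<otimes> p). Coassociativity therefore turns the reduced coproduct of \<Sum>
  J(x1) e(x2) into \<Sum> J(x1) \<otimes> x2 e(x3), which is \<Sum> J(x1) \<otimes> J(x2) by the
  equation for e. That is also the reduced coproduct of J(x), so the difference e(x) has reduced
  coproduct 0.

  An element of H \<otimes> H is a coset in a free module and carries no preferred expression by
  pure tensors. Sweedler sums are therefore replaced throughout by equalities of two linear maps on
  H \<otimes> H, tested on generators and then evaluated at \<Delta>(x).\<close>

lemma module_homI:
  assumes "\<And>x. x \<in> carrier M \<Longrightarrow> f x \<in> carrier N"
    and "\<And>x y. \<lbrakk>x \<in> carrier M; y \<in> carrier M\<rbrakk> \<Longrightarrow> f (x \<oplus>\<^bsub>M\<^esub> y) = f x \<oplus>\<^bsub>N\<^esub> f y"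
    and "\<And>c x. \<lbrakk>c \<in> carrier K; x \<in> carrier M\<rbrakk> \<Longrightarrow> f (c \<odot>\<^bsub>M\<^esub> x) = c \<odot>\<^bsub>N\<^esub> f x"
  shows "f \<in> module_hom K M N"
  using assms by (auto simp: module_hom_def)

lemma module_hom_closed: "\<lbrakk>f \<in> module_hom K M N; x \<in> carrier M\<rbrakk> \<Longrightarrow> f x \<in> carrier N"
  by (auto simp: module_hom_def)

lemma module_hom_add:
  "\<lbrakk>f \<in> module_hom K M N; x \<in> carrier M; y \<in> carrier M\<rbrakk> \<Longrightarrow> f (x \<oplus>\<^bsub>M\<^esub> y) = f x \<oplus>\<^bsub>N\<^esub> f y"
  by (auto simp: module_hom_def)

lemma module_hom_smult:
  "\<lbrakk>f \<in> module_hom K M N; c \<in> carrier K; x \<in> carrier M\<rbrakk> \<Longrightarrow> f (c \<odot>\<^bsub>M\<^esub> x) = c \<odot>\<^bsub>N\<^esub> f x"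
  by (auto simp: module_hom_def)

lemma module_hom_zero:
  assumes "f \<in> module_hom K M N" "module K M" "module K N"
  shows "f \<zero>\<^bsub>M\<^esub> = \<zero>\<^bsub>N\<^esub>"
proof -
  interpret M: module K M by fact
  interpret N: module K N by fact
  have "f (\<zero>\<^bsub>K\<^esub> \<odot>\<^bsub>M\<^esub> \<zero>\<^bsub>M\<^esub>) = \<zero>\<^bsub>K\<^esub> \<odot>\<^bsub>N\<^esub> f \<zero>\<^bsub>M\<^esub>"
    using assms(1) by (intro module_hom_smult) auto
  then show ?thesis using module_hom_closed[OF assms(1) M.zero_closed] by simp
qed

lemma module_minus_smult:
  assumes "module K M" "x \<in> carrier M"
  shows "\<ominus>\<^bsub>M\<^esub> x = (\<ominus>\<^bsub>K\<^esub> \<one>\<^bsub>K\<^esub>) \<odot>\<^bsub>M\<^esub> x"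
proof -
  interpret M: module K M by fact
  show ?thesis using assms(2) by (simp add: M.smult_l_minus)
qed

lemma module_hom_a_inv:
  assumes "f \<in> module_hom K M N" "module K M" "module K N" "x \<in> carrier M"
  shows "f (\<ominus>\<^bsub>M\<^esub> x) = \<ominus>\<^bsub>N\<^esub> f x"
proof -
  interpret M: module K M by fact
  show ?thesis
    using module_hom_smult[OF assms(1)] module_hom_closed[OF assms(1)] assms(4)
    by (simp add: module_minus_smult[OF assms(2)] module_minus_smult[OF assms(3)])
qed

lemma module_hom_minus:
  assumes "f \<in> module_hom K M N" "module K M" "module K N" "x \<in> carrier M" "y \<in> carrier M"
  shows "f (x \<ominus>\<^bsub>M\<^esub> y) = f x \<ominus>\<^bsub>N\<^esub> f y"
proof -
  interpret M: module K M by fact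
  show ?thesis using assms
    by (simp add: a_minus_def module_hom_add[OF assms(1)] module_hom_a_inv)
qed

lemma module_hom_finsum:
  assumes "f \<in> module_hom K M N" "module K M" "module K N" "finite A" "g \<in> A \<rightarrow> carrier M"
  shows "f (\<Oplus>\<^bsub>M\<^esub>x\<in>A. g x) = (\<Oplus>\<^bsub>N\<^esub>x\<in>A. f (g x))"
proof -
  interpret M: module K M by fact
  interpret N: module K N by fact
  show ?thesis using assms(4,5)
  proof (induction A rule: finite_induct)
    case empty
    show ?case using module_hom_zero[OF assms(1-3)] by simp
  next
    case (insert x F)
    then have "g x \<in> carrier M" "g \<in> F \<rightarrow> carrier M" by auto
    moreover from this have "f (g x) \<in> carrier N" "(\<lambda>x. f (g x)) \<in> F \<rightarrow> carrier N"
      using module_hom_closed[OF assms(1)] by auto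
    ultimately show ?case
      using insert by (simp add: module_hom_add[OF assms(1)])
  qed
qed

lemma module_hom_id: "(\<lambda>x. x) \<in> module_hom K M M"
  by (rule module_homI) auto

lemma module_hom_id': "id \<in> module_hom K M M"
  by (rule module_homI) auto

lemma module_hom_comp:
  assumes "f \<in> module_hom K M N" "g \<in> module_hom K L M"
  shows "(\<lambda>x. f (g x)) \<in> module_hom K L N"
  using assms by (auto simp: module_hom_def Pi_iff)

lemma module_hom_const_zero:
  assumes "module K N"
  shows "(\<lambda>x. \<zero>\<^bsub>N\<^esub>) \<in> module_hom K M N"
proof -
  interpret N: module K N by fact
  show ?thesis by (rule module_homI) auto
qed

lemma module_hom_pw_add:
  assumes "module K N" "f \<in> module_hom K M N" "g \<in> module_hom K M N"
  shows "(\<lambda>x. f x \<oplus>\<^bsub>N\<^esub> g x) \<in> module_hom K M N"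
proof -
  interpret N: module K N by fact
  note f = module_hom_closed[OF assms(2)] module_hom_add[OF assms(2)] module_hom_smult[OF assms(2)]
  note g = module_hom_closed[OF assms(3)] module_hom_add[OF assms(3)] module_hom_smult[OF assms(3)]
  show ?thesis
    by (intro module_homI)
      (auto simp: f g N.a_ac N.smult_r_distr)
qed

lemma module_hom_pw_minus:
  assumes "module K N" "f \<in> module_hom K M N" "g \<in> module_hom K M N"
  shows "(\<lambda>x. f x \<ominus>\<^bsub>N\<^esub> g x) \<in> module_hom K M N"
proof -
  interpret N: module K N by fact
  note f = module_hom_closed[OF assms(2)] module_hom_add[OF assms(2)] module_hom_smult[OF assms(2)]
  note g = module_hom_closed[OF assms(3)] module_hom_add[OF assms(3)] module_hom_smult[OF assms(3)]
  show ?thesis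
    by (intro module_homI)
      (auto simp: f g N.a_ac N.smult_r_distr
         N.minus_eq N.minus_add N.smult_r_minus)
qed

text \<open>Stated for equalizers because every identity of linear maps below is proved by showing
  that this submodule contains a set of generators; kernels are the case of the constant map
  \<open>\<zero>\<close>.\<close>

lemma module_hom_kernel_eq:
  assumes "module K M" "module K N" "f \<in> module_hom K M N" "g \<in> module_hom K M N"
  shows "submodule {x \<in> carrier M. f x = g x} K M"
proof -
  interpret M: module K M by fact
  note f = module_hom_add[OF assms(3)] module_hom_smult[OF assms(3)]
    module_hom_zero[OF assms(3,1,2)] module_hom_a_inv[OF assms(3,1,2)]
  note g = module_hom_add[OF assms(4)] module_hom_smult[OF assms(4)]
    module_hom_zero[OF assms(4,1,2)] module_hom_a_inv[OF assms(4,1,2)]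
  show ?thesis
    by (intro M.submoduleI)
      (auto simp: f g)
qed

lemma module_hom_preimage:
  assumes "module K M" "module K N" "f \<in> module_hom K M N" "submodule S K N"
  shows "submodule {x \<in> carrier M. f x \<in> S} K M"
proof -
  interpret M: module K M by fact
  interpret N: module K N by fact
  interpret S: submodule S K N by fact
  note f = module_hom_add[OF assms(3)] module_hom_smult[OF assms(3)]
    module_hom_zero[OF assms(3,1,2)] module_hom_a_inv[OF assms(3,1,2)]
  show ?thesis
    using N.submoduleE[OF assms(4)] S.one_closed
    by (intro M.submoduleI)
      (auto simp: f)
qed

lemma module_hom_image:
  assumes "module K M" "module K N" "f \<in> module_hom K M N"
  shows "submodule (f ` carrier M) K N"
proof -
  interpret M: module K M by fact
  interpret N: module K N by fact
  note h = module_hom_add[OF assms(3), symmetric] module_hom_smult[OF assms(3), symmetric]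
    module_hom_zero[OF assms(3,1,2), symmetric] module_hom_a_inv[OF assms(3,1,2), symmetric]
  show ?thesis
    by (rule N.submoduleI; safe?)
      (auto simp: h simp del: image_eqI intro!: imageI module_hom_closed[OF assms(3)])
qed

text \<open>Here \<open>Q\<close> is merely a record with operations. The module axioms are
  equations and an existence statement, and both kinds pass along a surjection that respects the
  operations.\<close>

lemma module_surj_image:
  assumes M: "module K M"
    and surj: "carrier Q = q ` carrier M"
    and add: "\<And>x y. \<lbrakk>x \<in> carrier M; y \<in> carrier M\<rbrakk> \<Longrightarrow> q x \<oplus>\<^bsub>Q\<^esub> q y = q (x \<oplus>\<^bsub>M\<^esub> y)"
    and smult: "\<And>c x. \<lbrakk>c \<in> carrier K; x \<in> carrier M\<rbrakk> \<Longrightarrow> c \<odot>\<^bsub>Q\<^esub> q x = q (c \<odot>\<^bsub>M\<^esub> x)"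
    and zero: "\<zero>\<^bsub>Q\<^esub> = q \<zero>\<^bsub>M\<^esub>"
  shows "module K Q"
proof -
  interpret M: module K M by fact
  show ?thesis
  proof (rule moduleI)
    show "cring K" by (rule M.R.is_cring)
    show "abelian_group Q"
    proof (rule abelian_groupI)
      fix x assume "x \<in> carrier Q"
      then obtain a where "x = q a" "a \<in> carrier M" using surj by auto
      then show "\<exists>y\<in>carrier Q. y \<oplus>\<^bsub>Q\<^esub> x = \<zero>\<^bsub>Q\<^esub>"
        by (intro bexI[of _ "q (\<ominus>\<^bsub>M\<^esub> a)"]) (auto simp: surj add zero M.l_neg)
    qed (auto simp: surj add zero M.a_ac)
  qed (auto simp: surj add smult zero M.smult_l_distr M.smult_r_distr M.smult_assoc1)
qed

section \<open>Spans, cosets and quotient modules\<close>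

lemma module_span_submodule:
  assumes "module K M" "S \<subseteq> carrier M"
  shows "submodule (module_span K M S) K M"
proof -
  interpret M: module K M by fact
  \<comment> \<open>The family intersected in \<open>module_span\<close> is nonempty; otherwise the
    intersection would be the whole type.\<close>
  have c: "carrier M \<in> {N. submodule N K M \<and> S \<subseteq> N}"
    using M.carrier_is_submodule assms by auto
  show ?thesis
  proof (rule M.submoduleI)
    show "module_span K M S \<subseteq> carrier M"
      using c by (auto simp: module_span_def)
    show "\<zero>\<^bsub>M\<^esub> \<in> module_span K M S"
      using subgroup.one_closed[OF submodule.axioms(1)] by (fastforce simp: module_span_def)
  qed (auto simp: module_span_def M.submoduleE)
qed

lemma module_span_subset: "S \<subseteq> module_span K M S"
  by (auto simp: module_span_def)

lemma module_span_least: "\<lbrakk>submodule N K M; S \<subseteq> N\<rbrakk> \<Longrightarrow> module_span K M S \<subseteq> N"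
  by (auto simp: module_span_def)

lemma module_span_mono: "S \<subseteq> S' \<Longrightarrow> module_span K M S \<subseteq> module_span K M S'"
  by (auto simp: module_span_def)

context
  fixes K :: "('k, 'r) ring_scheme" and M :: "('k, 'a, 'm) module_scheme" and N :: "'a set"
  assumes M: "module K M" and N: "submodule N K M"
begin

interpretation M: module K M by (rule M)

lemma submodule_abelian_subgroup: "abelian_subgroup N M"
proof (rule abelian_subgroupI3)
  show "additive_subgroup N M"
    using submodule.axioms(1)[OF N] by (rule additive_subgroup.intro)
  show "abelian_group M" by unfold_locales
qed

interpretation S: abelian_subgroup N M by (rule submodule_abelian_subgroup)

lemma coset_eq_iff:
  assumes "x \<in> carrier M" "y \<in> carrier M"
  shows "N +>\<^bsub>M\<^esub> x = N +>\<^bsub>M\<^esub> y \<longleftrightarrow> x \<ominus>\<^bsub>M\<^esub> y \<in> N"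
proof -
  have "x \<ominus>\<^bsub>M\<^esub> y \<in> N \<longleftrightarrow> x \<in> N +>\<^bsub>M\<^esub> y"
    unfolding M.minus_eq by (rule S.a_rcos_module[OF assms(2,1), symmetric])
  then show ?thesis
    using S.a_rcos_self[OF assms(1)] M.a_repr_independence[OF _ assms(2) S.a_subgroup] by blast
qed

lemma quot_module_carrier: "carrier (quot_module M N) = (\<lambda>x. N +>\<^bsub>M\<^esub> x) ` carrier M"
  by (auto simp: quot_module_def A_RCOSETS_def')

lemma quot_module_add:
  assumes "x \<in> carrier M" "y \<in> carrier M"
  shows "(N +>\<^bsub>M\<^esub> x) \<oplus>\<^bsub>quot_module M N\<^esub> (N +>\<^bsub>M\<^esub> y) = N +>\<^bsub>M\<^esub> (x \<oplus>\<^bsub>M\<^esub> y)"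
  using S.a_rcos_sum[OF assms] by (simp add: quot_module_def)

text \<open>The record forms a union over all representatives \<open>y\<close> of the coset. Since c
  (y - x) lies in \<open>N\<close>, every representative yields the same coset, and the union over
  the nonempty coset collapses to it.\<close>

lemma quot_module_smult:
  assumes "c \<in> carrier K" "x \<in> carrier M"
  shows "c \<odot>\<^bsub>quot_module M N\<^esub> (N +>\<^bsub>M\<^esub> x) = N +>\<^bsub>M\<^esub> (c \<odot>\<^bsub>M\<^esub> x)"
proof -
  have "N +>\<^bsub>M\<^esub> (c \<odot>\<^bsub>M\<^esub> y) = N +>\<^bsub>M\<^esub> (c \<odot>\<^bsub>M\<^esub> x)" if y: "y \<in> N +>\<^bsub>M\<^esub> x" for y
  proof -
    have yc: "y \<in> carrier M" using y M.a_r_coset_subset_G[OF S.a_subset assms(2)] by blast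
    have "y \<ominus>\<^bsub>M\<^esub> x \<in> N"
      using S.a_rcos_module[OF assms(2) yc] y by (simp add: M.minus_eq)
    then have "c \<odot>\<^bsub>M\<^esub> (y \<ominus>\<^bsub>M\<^esub> x) \<in> N" using assms N by (auto simp: submodule.smult_closed)
    then show ?thesis
      using assms yc
      by (subst coset_eq_iff) (auto simp: M.minus_eq M.smult_r_distr M.smult_r_minus)
  qed
  then have "(\<Union>a\<in>N +>\<^bsub>M\<^esub> x. N +>\<^bsub>M\<^esub> (c \<odot>\<^bsub>M\<^esub> a)) = (\<Union>a\<in>N +>\<^bsub>M\<^esub> x. N +>\<^bsub>M\<^esub> (c \<odot>\<^bsub>M\<^esub> x))"
    by (rule SUP_cong[OF refl])
  moreover have "N +>\<^bsub>M\<^esub> x \<noteq> {}" using S.a_rcos_self[OF assms(2)] by blast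
  ultimately show ?thesis by (simp add: quot_module_def)
qed

lemma quot_module_zero: "\<zero>\<^bsub>quot_module M N\<^esub> = N +>\<^bsub>M\<^esub> \<zero>\<^bsub>M\<^esub>"
  using M.a_coset_add_zero[OF S.a_subset] by (simp add: quot_module_def)

lemma quot_module_module: "module K (quot_module M N)"
  by (rule module_surj_image[OF M quot_module_carrier])
    (auto simp: quot_module_add quot_module_smult quot_module_zero)

lemma quot_module_proj_hom: "(\<lambda>x. N +>\<^bsub>M\<^esub> x) \<in> module_hom K M (quot_module M N)"
  by (rule module_homI) (auto simp: quot_module_add quot_module_smult quot_module_carrier)

context
  fixes P :: "('k, 'p, 'n) module_scheme" and L
  assumes P: "module K P" and L: "L \<in> module_hom K M P"
    and ker: "\<And>x. x \<in> N \<Longrightarrow> L x = \<zero>\<^bsub>P\<^esub>"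
begin

text \<open>\<open>L\<close> is constant on a coset because it vanishes on \<open>N\<close>; the
  image of the coset is then a singleton, which gives \<open>the_elem\<close> its meaning.\<close>

lemma quot_module_factor:
  assumes x: "x \<in> carrier M"
  shows "the_elem (L ` (N +>\<^bsub>M\<^esub> x)) = L x"
proof -
  interpret P: module K P by (rule P)
  have "L y = L x" if y: "y \<in> N +>\<^bsub>M\<^esub> x" for y
  proof -
    obtain n where "n \<in> N" "y = n \<oplus>\<^bsub>M\<^esub> x" using y unfolding a_r_coset_def' by blast
    moreover have "L n = \<zero>\<^bsub>P\<^esub>" "n \<in> carrier M" using \<open>n \<in> N\<close> ker S.a_subset by auto
    ultimately show ?thesis
      using x module_hom_closed[OF L x] by (simp add: module_hom_add[OF L])
  qed
  moreover have "x \<in> N +>\<^bsub>M\<^esub> x" using S.a_rcos_self[OF x] .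
  ultimately have "L ` (N +>\<^bsub>M\<^esub> x) = {L x}" by blast
  then show ?thesis by simp
qed

lemma quot_module_factor_hom: "(\<lambda>A. the_elem (L ` A)) \<in> module_hom K (quot_module M N) P"
proof (rule module_homI)
  fix A assume "A \<in> carrier (quot_module M N)"
  then obtain a where a: "A = N +>\<^bsub>M\<^esub> a" "a \<in> carrier M" unfolding quot_module_carrier by blast
  show "the_elem (L ` A) \<in> carrier P"
    using a module_hom_closed[OF L] by (simp add: quot_module_factor)
  show "the_elem (L ` (c \<odot>\<^bsub>quot_module M N\<^esub> A)) = c \<odot>\<^bsub>P\<^esub> the_elem (L ` A)"
    if "c \<in> carrier K" for c
    using a that by (simp add: quot_module_factor quot_module_smult module_hom_smult[OF L])
  show "the_elem (L ` (A \<oplus>\<^bsub>quot_module M N\<^esub> B)) = the_elem (L ` A) \<oplus>\<^bsub>P\<^esub> the_elem (L ` B)"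
    if B: "B \<in> carrier (quot_module M N)" for B
  proof -
    obtain b where b: "B = N +>\<^bsub>M\<^esub> b" "b \<in> carrier M"
      using B unfolding quot_module_carrier by blast
    show ?thesis
      using a b by (simp add: quot_module_factor quot_module_add module_hom_add[OF L])
  qed
qed

end

end

lemma module_diff_zero_iff:
  assumes "module K M" "x \<in> carrier M" "y \<in> carrier M"
  shows "x \<ominus>\<^bsub>M\<^esub> y = \<zero>\<^bsub>M\<^esub> \<longleftrightarrow> x = y"
proof -
  interpret M: module K M by fact
  have "x = (x \<ominus>\<^bsub>M\<^esub> y) \<oplus>\<^bsub>M\<^esub> y"
    using assms by (simp add: M.minus_eq M.a_assoc M.l_neg)
  then show ?thesis
    using assms by (metis M.l_zero M.minus_eq M.r_neg)
qed

section \<open>Free and presented modules\<close>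

context
  fixes K :: "('k, 'r) ring_scheme" and X :: "'x set"
  assumes K: "cring K"
begin

interpretation K: cring K by (rule K)

lemma free_module_module: "module K (free_module K X)"
proof (rule moduleI)
  show "cring K" by (rule K)
  show "abelian_group (free_module K X)"
  proof (rule abelian_groupI)
    fix f g assume fg: "f \<in> carrier (free_module K X)" "g \<in> carrier (free_module K X)"
    have "{x. f x \<oplus>\<^bsub>K\<^esub> g x \<noteq> \<zero>\<^bsub>K\<^esub>} \<subseteq> {x. f x \<noteq> \<zero>\<^bsub>K\<^esub>} \<union> {x. g x \<noteq> \<zero>\<^bsub>K\<^esub>}"
      by auto
    then show "f \<oplus>\<^bsub>free_module K X\<^esub> g \<in> carrier (free_module K X)"
      using fg by (auto simp: free_module_def intro: finite_subset)
  next
    fix f assume f: "f \<in> carrier (free_module K X)"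
    then have "f x \<in> carrier K" for x by (auto simp: free_module_def)
    then have eq: "\<ominus>\<^bsub>K\<^esub> f x = \<zero>\<^bsub>K\<^esub> \<longleftrightarrow> f x = \<zero>\<^bsub>K\<^esub>" for x
      by (metis K.minus_minus K.minus_zero)
    show "\<exists>g\<in>carrier (free_module K X). g \<oplus>\<^bsub>free_module K X\<^esub> f = \<zero>\<^bsub>free_module K X\<^esub>"
      using f by (intro bexI[of _ "\<lambda>x. \<ominus>\<^bsub>K\<^esub> f x"]) (auto simp: free_module_def K.l_neg eq)
  qed (auto simp: free_module_def K.a_ac)
next
  fix c f assume cf: "c \<in> carrier K" "f \<in> carrier (free_module K X)"
  have "{x. c \<otimes>\<^bsub>K\<^esub> f x \<noteq> \<zero>\<^bsub>K\<^esub>} \<subseteq> {x. f x \<noteq> \<zero>\<^bsub>K\<^esub>}"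
    using cf(1) by auto
  then show "c \<odot>\<^bsub>free_module K X\<^esub> f \<in> carrier (free_module K X)"
    using cf by (auto simp: free_module_def intro: finite_subset)
qed (auto simp: free_module_def K.l_distr K.r_distr K.m_assoc)

interpretation F: module K "free_module K X" by (rule free_module_module)

lemma free_gen_closed: "x \<in> X \<Longrightarrow> free_gen K x \<in> carrier (free_module K X)"
proof -
  assume "x \<in> X"
  moreover have "finite {y. (if y = x then \<one>\<^bsub>K\<^esub> else \<zero>\<^bsub>K\<^esub>) \<noteq> \<zero>\<^bsub>K\<^esub>}"
    by (rule finite_subset[of _ "{x}"]) auto
  ultimately show ?thesis by (auto simp: free_module_def free_gen_def)
qed

text \<open>Induction over a finite set containing the support: splitting off one coordinate writes
  \<open>f\<close> as a multiple of a generator plus the function \<open>f(x := \<zero>)\<close>,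
  whose support fits into the smaller set.\<close>

lemma free_module_induct:
  assumes S: "submodule S K (free_module K X)" and gen: "\<And>x. x \<in> X \<Longrightarrow> free_gen K x \<in> S"
  shows "carrier (free_module K X) \<subseteq> S"
proof
  fix f assume f: "f \<in> carrier (free_module K X)"
  have "f \<in> S" if "finite A" "f \<in> carrier (free_module K X)" "{x. f x \<noteq> \<zero>\<^bsub>K\<^esub>} \<subseteq> A" for A
    using that
  proof (induction A arbitrary: f rule: finite_induct)
    case empty
    then have "f = \<zero>\<^bsub>free_module K X\<^esub>" by (auto simp: free_module_def)
    then show ?case using subgroup.one_closed[OF submodule.axioms(1)[OF S]] by simp
  next
    case (insert x A)
    define h where "h = f(x := \<zero>\<^bsub>K\<^esub>)"
    have fx: "f x \<in> carrier K" using insert.prems by (auto simp: free_module_def)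
    have "{y. h y \<noteq> \<zero>\<^bsub>K\<^esub>} \<subseteq> {y. f y \<noteq> \<zero>\<^bsub>K\<^esub>}" by (auto simp: h_def)
    then have hc: "h \<in> carrier (free_module K X)"
      using insert.prems by (auto simp: free_module_def h_def intro: finite_subset)
    have hS: "h \<in> S"
      by (rule insert.IH[OF hc]) (use insert.prems in \<open>auto simp: h_def\<close>)
    show ?case
    proof (cases "f x = \<zero>\<^bsub>K\<^esub>")
      case True
      then have "h = f" by (auto simp: h_def)
      then show ?thesis using hS by simp
    next
      case False
      then have xX: "x \<in> X" using insert.prems by (auto simp: free_module_def)
      have "f x \<odot>\<^bsub>free_module K X\<^esub> free_gen K x \<in> S"
        using submodule.smult_closed[OF S fx gen[OF xX]] .
      moreover have "f = (f x \<odot>\<^bsub>free_module K X\<^esub> free_gen K x) \<oplus>\<^bsub>free_module K X\<^esub> h"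
        using fx insert.prems(1) by (auto simp: free_module_def free_gen_def h_def fun_eq_iff)
      ultimately show ?thesis using hS F.submoduleE(5)[OF S] by metis
    qed
  qed
  from this[OF _ f subset_refl] f show "f \<in> S" by (simp add: free_module_def)
qed

context
  fixes P :: "('k, 'p, 'm) module_scheme" and g
  assumes P: "module K P" and g: "\<And>x. x \<in> X \<Longrightarrow> g x \<in> carrier P"
begin

interpretation P: module K P by (rule P)

text \<open>Supports change under addition and scaling; summing over a common finite superset makes
  the sums for different functions comparable term by term.\<close>

lemma free_ext_sum:
  assumes "finite A" "{x. f x \<noteq> \<zero>\<^bsub>K\<^esub>} \<subseteq> A" "A \<subseteq> X" "f \<in> carrier (free_module K X)"
  shows "(\<Oplus>\<^bsub>P\<^esub>x\<in>{x. f x \<noteq> \<zero>\<^bsub>K\<^esub>}. f x \<odot>\<^bsub>P\<^esub> g x) = (\<Oplus>\<^bsub>P\<^esub>x\<in>A. f x \<odot>\<^bsub>P\<^esub> g x)"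
  using assms by (intro P.add.finprod_mono_neutral_cong_left) (auto simp: free_module_def g subset_iff)

lemma free_ext_hom:
  "(\<lambda>f. \<Oplus>\<^bsub>P\<^esub>x\<in>{x. f x \<noteq> \<zero>\<^bsub>K\<^esub>}. f x \<odot>\<^bsub>P\<^esub> g x) \<in> module_hom K (free_module K X) P"
  (is "?L \<in> _")
proof (rule module_homI)
  fix f assume f: "f \<in> carrier (free_module K X)"
  then have fK: "f x \<in> carrier K" for x by (auto simp: free_module_def)
  have fX: "{x. f x \<noteq> \<zero>\<^bsub>K\<^esub>} \<subseteq> X" "finite {x. f x \<noteq> \<zero>\<^bsub>K\<^esub>}"
    using f by (auto simp: free_module_def)
  show "?L f \<in> carrier P"
    using fX fK g by (intro P.finsum_closed) auto
  show "?L (c \<odot>\<^bsub>free_module K X\<^esub> f) = c \<odot>\<^bsub>P\<^esub> ?L f" if c: "c \<in> carrier K" for c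
  proof -
    have "?L (c \<odot>\<^bsub>free_module K X\<^esub> f)
        = (\<Oplus>\<^bsub>P\<^esub>x\<in>{x. f x \<noteq> \<zero>\<^bsub>K\<^esub>}. (c \<odot>\<^bsub>free_module K X\<^esub> f) x \<odot>\<^bsub>P\<^esub> g x)"
      using fX c f by (intro free_ext_sum) (auto simp: free_module_def intro: finite_subset[OF _ fX(2)])
    also have "\<dots> = (\<Oplus>\<^bsub>P\<^esub>x\<in>{x. f x \<noteq> \<zero>\<^bsub>K\<^esub>}. c \<odot>\<^bsub>P\<^esub> (f x \<odot>\<^bsub>P\<^esub> g x))"
      using fX fK g c by (intro P.finsum_cong') (auto simp: free_module_def subset_iff P.smult_assoc1)
    also have "\<dots> = c \<odot>\<^bsub>P\<^esub> ?L f"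
      using fX fK g c by (intro P.finsum_smult_ldistr[symmetric]) auto
    finally show ?thesis .
  qed
  show "?L (f \<oplus>\<^bsub>free_module K X\<^esub> h) = ?L f \<oplus>\<^bsub>P\<^esub> ?L h" if h: "h \<in> carrier (free_module K X)" for h
  proof -
    define A where "A = {x. f x \<noteq> \<zero>\<^bsub>K\<^esub>} \<union> {x. h x \<noteq> \<zero>\<^bsub>K\<^esub>}"
    have hK: "h x \<in> carrier K" for x using h by (auto simp: free_module_def)
    have A: "finite A" "A \<subseteq> X" using f h by (auto simp: free_module_def A_def)
    have "?L (f \<oplus>\<^bsub>free_module K X\<^esub> h) = (\<Oplus>\<^bsub>P\<^esub>x\<in>A. (f \<oplus>\<^bsub>free_module K X\<^esub> h) x \<odot>\<^bsub>P\<^esub> g x)"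
      using A F.a_closed[OF f h] by (intro free_ext_sum) (auto simp: A_def free_module_def)
    also have "\<dots> = (\<Oplus>\<^bsub>P\<^esub>x\<in>A. (f x \<odot>\<^bsub>P\<^esub> g x) \<oplus>\<^bsub>P\<^esub> (h x \<odot>\<^bsub>P\<^esub> g x))"
      using A fK hK g by (intro P.finsum_cong') (auto simp: free_module_def subset_iff P.smult_l_distr)
    also have "\<dots> = (\<Oplus>\<^bsub>P\<^esub>x\<in>A. f x \<odot>\<^bsub>P\<^esub> g x) \<oplus>\<^bsub>P\<^esub> (\<Oplus>\<^bsub>P\<^esub>x\<in>A. h x \<odot>\<^bsub>P\<^esub> g x)"
      using A fK hK g by (intro P.finsum_addf) auto
    also have "(\<Oplus>\<^bsub>P\<^esub>x\<in>A. f x \<odot>\<^bsub>P\<^esub> g x) = ?L f"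
      using A f by (intro free_ext_sum[symmetric]) (auto simp: A_def)
    also have "(\<Oplus>\<^bsub>P\<^esub>x\<in>A. h x \<odot>\<^bsub>P\<^esub> g x) = ?L h"
      using A h by (intro free_ext_sum[symmetric]) (auto simp: A_def)
    finally show ?thesis .
  qed
qed

lemma free_ext_gen:
  assumes x: "x \<in> X"
  shows "(\<Oplus>\<^bsub>P\<^esub>y\<in>{y. free_gen K x y \<noteq> \<zero>\<^bsub>K\<^esub>}. free_gen K x y \<odot>\<^bsub>P\<^esub> g y) = g x"
proof -
  \<comment> \<open>Passing to the index set \<open>{x}\<close> also covers the trivial ring, over
    which the support of \<open>free_gen K x\<close> is empty.\<close>
  have "(\<Oplus>\<^bsub>P\<^esub>y\<in>{y. free_gen K x y \<noteq> \<zero>\<^bsub>K\<^esub>}. free_gen K x y \<odot>\<^bsub>P\<^esub> g y)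
      = (\<Oplus>\<^bsub>P\<^esub>y\<in>{x}. free_gen K x y \<odot>\<^bsub>P\<^esub> g y)"
    using x free_gen_closed[OF x] by (intro free_ext_sum) (auto simp: free_gen_def)
  also have "\<dots> = free_gen K x x \<odot>\<^bsub>P\<^esub> g x"
    using x g by (subst P.finsum_insert) (auto simp: free_gen_def)
  finally show ?thesis using x g by (simp add: free_gen_def)
qed

end

context
  fixes R :: "('x \<Rightarrow> 'k) set"
  assumes R: "R \<subseteq> carrier (free_module K X)"
begin

lemmas presented_span_submodule = module_span_submodule[OF free_module_module R]

lemma presented_module_module: "module K (presented_module K X R)"
  unfolding presented_module_def
  by (rule quot_module_module[OF free_module_module presented_span_submodule])

lemma presented_proj_hom:
  "(\<lambda>f. module_span K (free_module K X) R +>\<^bsub>free_module K X\<^esub> f)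
     \<in> module_hom K (free_module K X) (presented_module K X R)"
  unfolding presented_module_def
  by (rule quot_module_proj_hom[OF free_module_module presented_span_submodule])

lemma presented_proj_rel:
  assumes "r \<in> R"
  shows "module_span K (free_module K X) R +>\<^bsub>free_module K X\<^esub> r = \<zero>\<^bsub>presented_module K X R\<^esub>"
proof -
  have r: "r \<in> module_span K (free_module K X) R"
    using module_span_subset assms by (rule subsetD)
  have "module_span K (free_module K X) R +>\<^bsub>free_module K X\<^esub> r
     = module_span K (free_module K X) R"
    by (rule F.a_coset_join2[OF _ submodule.axioms(1)[OF presented_span_submodule] r])
      (use assms R in blast)
  then show ?thesis by (simp add: presented_module_def quot_module_def)
qed

lemma presented_module_induct:
  assumes S: "submodule S K (presented_module K X R)"
    and gen: "\<And>x. x \<in> X \<Longrightarrow> presented_gen K X R x \<in> S"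
  shows "carrier (presented_module K X R) \<subseteq> S"
proof -
  let ?q = "\<lambda>f. module_span K (free_module K X) R +>\<^bsub>free_module K X\<^esub> f"
  have "carrier (free_module K X) \<subseteq> {f \<in> carrier (free_module K X). ?q f \<in> S}"
    by (rule free_module_induct[OF module_hom_preimage[OF free_module_module presented_module_module
            presented_proj_hom S]])
      (use gen free_gen_closed in \<open>auto simp: presented_gen_def\<close>)
  moreover have "carrier (presented_module K X R) = ?q ` carrier (free_module K X)"
    unfolding presented_module_def
    by (rule quot_module_carrier[OF free_module_module presented_span_submodule])
  ultimately show ?thesis by (simp only: image_subset_iff) (auto simp: subset_iff)
qed

context
  fixes P :: "('k, 'p, 'm) module_scheme" and L
  assumes P: "module K P" and L: "L \<in> module_hom K (free_module K X) P"
    and rel: "\<And>r. r \<in> R \<Longrightarrow> L r = \<zero>\<^bsub>P\<^esub>"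
begin

lemma presented_span_kernel:
  assumes "r \<in> module_span K (free_module K X) R"
  shows "L r = \<zero>\<^bsub>P\<^esub>"
proof -
  have "submodule {f \<in> carrier (free_module K X). L f = \<zero>\<^bsub>P\<^esub>} K (free_module K X)"
    by (rule module_hom_kernel_eq[OF free_module_module P L module_hom_const_zero[OF P]])
  then have "module_span K (free_module K X) R \<subseteq> {f \<in> carrier (free_module K X). L f = \<zero>\<^bsub>P\<^esub>}"
    by (rule module_span_least) (use R rel in auto)
  then show ?thesis using assms by blast
qed

lemma presented_factor_hom: "(\<lambda>A. the_elem (L ` A)) \<in> module_hom K (presented_module K X R) P"
  unfolding presented_module_def
  by (rule quot_module_factor_hom[OF free_module_module presented_span_submodule P L])
    (rule presented_span_kernel)

lemma presented_factor_gen: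
  "x \<in> X \<Longrightarrow> the_elem (L ` presented_gen K X R x) = L (free_gen K x)"
  unfolding presented_gen_def
  by (rule quot_module_factor[OF free_module_module presented_span_submodule P L])
    (auto intro: presented_span_kernel free_gen_closed)

end

text \<open>The hypothesis \<open>rel\<close> ranges over all linear \<open>L\<close> with the
  prescribed values on generators, so that an application checks the relations by linearity alone
  and never meets the finite sums inside \<open>lin_ext\<close>.\<close>

lemma
  fixes P :: "('k, 'p, 'm) module_scheme"
  assumes P: "module K P" and g: "\<And>x. x \<in> X \<Longrightarrow> g x \<in> carrier P"
    and rel: "\<And>L r. \<lbrakk>L \<in> module_hom K (free_module K X) P;
       \<And>x. x \<in> X \<Longrightarrow> L (free_gen K x) = g x; r \<in> R\<rbrakk> \<Longrightarrow> L r = \<zero>\<^bsub>P\<^esub>"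
  shows lin_ext_hom: "lin_ext K P g \<in> module_hom K (presented_module K X R) P"
    and lin_ext_gen: "x \<in> X \<Longrightarrow> lin_ext K P g (presented_gen K X R x) = g x"
proof -
  let ?L = "\<lambda>f. \<Oplus>\<^bsub>P\<^esub>x\<in>{x. f x \<noteq> \<zero>\<^bsub>K\<^esub>}. f x \<odot>\<^bsub>P\<^esub> g x"
  have L: "?L \<in> module_hom K (free_module K X) P" by (rule free_ext_hom[OF P g])
  have Lg: "?L (free_gen K x) = g x" if "x \<in> X" for x by (rule free_ext_gen[OF P g that])
  have Lr: "?L r = \<zero>\<^bsub>P\<^esub>" if "r \<in> R" for r by (rule rel[OF L Lg that])
  show "lin_ext K P g \<in> module_hom K (presented_module K X R) P"
    unfolding lin_ext_def by (rule presented_factor_hom[OF P L Lr])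
  show "lin_ext K P g (presented_gen K X R x) = g x" if "x \<in> X"
    unfolding lin_ext_def using presented_factor_gen[OF P L Lr that] Lg[OF that] by simp
qed

end

end

section \<open>Bilinear maps and tensor products\<close>

definition bilinear where
  "bilinear K M N P \<beta> \<longleftrightarrow> (\<forall>a\<in>carrier M. \<beta> a \<in> module_hom K N P) \<and>
     (\<forall>b\<in>carrier N. (\<lambda>a. \<beta> a b) \<in> module_hom K M P)"

lemma bilinearI:
  assumes "\<And>a. a \<in> carrier M \<Longrightarrow> \<beta> a \<in> module_hom K N P"
    and "\<And>b. b \<in> carrier N \<Longrightarrow> (\<lambda>a. \<beta> a b) \<in> module_hom K M P"
  shows "bilinear K M N P \<beta>"
  using assms by (auto simp: bilinear_def)

lemma bilinear_right: "\<lbrakk>bilinear K M N P \<beta>; a \<in> carrier M\<rbrakk> \<Longrightarrow> \<beta> a \<in> module_hom K N P"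
  by (auto simp: bilinear_def)

lemma bilinear_left: "\<lbrakk>bilinear K M N P \<beta>; b \<in> carrier N\<rbrakk> \<Longrightarrow> (\<lambda>a. \<beta> a b) \<in> module_hom K M P"
  by (auto simp: bilinear_def)

lemma bilinear_closed:
  "\<lbrakk>bilinear K M N P \<beta>; a \<in> carrier M; b \<in> carrier N\<rbrakk> \<Longrightarrow> \<beta> a b \<in> carrier P"
  using bilinear_right module_hom_closed by metis

lemma bilinear_comp:
  assumes "bilinear K M N P \<beta>" "f \<in> module_hom K M' M" "g \<in> module_hom K N' N"
  shows "bilinear K M' N' P (\<lambda>a b. \<beta> (f a) (g b))"
  by (rule bilinearI)
    (auto intro: module_hom_comp[OF bilinear_right[OF assms(1)] assms(3)]
      module_hom_comp[OF bilinear_left[OF assms(1)] assms(2)]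
      module_hom_closed[OF assms(2)] module_hom_closed[OF assms(3)])

lemma bilinear_swap: "bilinear K M N P \<beta> \<Longrightarrow> bilinear K N M P (\<lambda>a b. \<beta> b a)"
  by (auto simp: bilinear_def)

context
  fixes K :: "('k, 'r) ring_scheme" and M :: "('k, 'a, 'm) module_scheme"
    and N :: "('k, 'b, 'n) module_scheme"
  assumes M: "module K M" and N: "module K N"
begin

interpretation M: module K M by (rule M)
interpretation N: module K N by (rule N)

private abbreviation (input) "TF \<equiv> free_module K (carrier M \<times> carrier N)"

interpretation F: module K TF by (rule free_module_module[OF M.R.is_cring])

lemma tensor_gen_closed:
  "a \<in> carrier M \<Longrightarrow> b \<in> carrier N \<Longrightarrow> free_gen K (a, b) \<in> carrier TF"
  by (rule free_gen_closed[OF M.R.is_cring]) auto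

lemma tensor_rels_closed: "tensor_rels K M N \<subseteq> carrier TF"
  unfolding tensor_rels_def Let_def
  by (intro Un_least subsetI; elim CollectE exE conjE; simp add: tensor_gen_closed)

text \<open>Both directions are used: from left to right, for the projection onto the quotient, it
  makes \<open>pure_tensor\<close> bilinear; from right to left it lets a bilinear map descend to
  the tensor product.\<close>

lemma tensor_rels_iff_bilinear:
  assumes P: "module K P" and h: "h \<in> module_hom K TF P"
  shows "(\<forall>r\<in>tensor_rels K M N. h r = \<zero>\<^bsub>P\<^esub>) \<longleftrightarrow> bilinear K M N P (\<lambda>a b. h (free_gen K (a, b)))"
proof -
  interpret P: module K P by (rule P)
  let ?\<beta> = "\<lambda>a b. h (free_gen K (a, b))"
  note h_simps = module_hom_minus[OF h F.module_axioms P] module_hom_add[OF h]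
    module_hom_smult[OF h] module_hom_closed[OF h] tensor_gen_closed module_diff_zero_iff[OF P]
  have "(\<forall>r\<in>tensor_rels K M N. h r = \<zero>\<^bsub>P\<^esub>) \<longleftrightarrow>
      (\<forall>a\<in>carrier M. \<forall>a'\<in>carrier M. \<forall>b\<in>carrier N. ?\<beta> (a \<oplus>\<^bsub>M\<^esub> a') b = ?\<beta> a b \<oplus>\<^bsub>P\<^esub> ?\<beta> a' b) \<and>
      (\<forall>a\<in>carrier M. \<forall>b\<in>carrier N. \<forall>b'\<in>carrier N. ?\<beta> a (b \<oplus>\<^bsub>N\<^esub> b') = ?\<beta> a b \<oplus>\<^bsub>P\<^esub> ?\<beta> a b') \<and>
      (\<forall>c\<in>carrier K. \<forall>a\<in>carrier M. \<forall>b\<in>carrier N. ?\<beta> (c \<odot>\<^bsub>M\<^esub> a) b = c \<odot>\<^bsub>P\<^esub> ?\<beta> a b) \<and>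
      (\<forall>c\<in>carrier K. \<forall>a\<in>carrier M. \<forall>b\<in>carrier N. ?\<beta> a (c \<odot>\<^bsub>N\<^esub> b) = c \<odot>\<^bsub>P\<^esub> ?\<beta> a b)"
    (is "_ \<longleftrightarrow> ?A \<and> ?B \<and> ?C \<and> ?D")
  proof (intro iffI conjI ballI)
    assume r: "\<forall>r\<in>tensor_rels K M N. h r = \<zero>\<^bsub>P\<^esub>"
    fix a b assume ab: "a \<in> carrier M" "b \<in> carrier N"
    {
      fix a' assume a': "a' \<in> carrier M"
      have "h (free_gen K (a \<oplus>\<^bsub>M\<^esub> a', b) \<ominus>\<^bsub>TF\<^esub> (free_gen K (a, b) \<oplus>\<^bsub>TF\<^esub> free_gen K (a', b))) = \<zero>\<^bsub>P\<^esub>"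
        by (rule bspec[OF r]) (use ab a' in \<open>unfold tensor_rels_def Let_def, blast\<close>)
      then show "?\<beta> (a \<oplus>\<^bsub>M\<^esub> a') b = ?\<beta> a b \<oplus>\<^bsub>P\<^esub> ?\<beta> a' b"
        using ab a' by (simp add: h_simps)
    next
      fix b' assume b': "b' \<in> carrier N"
      have "h (free_gen K (a, b \<oplus>\<^bsub>N\<^esub> b') \<ominus>\<^bsub>TF\<^esub> (free_gen K (a, b) \<oplus>\<^bsub>TF\<^esub> free_gen K (a, b'))) = \<zero>\<^bsub>P\<^esub>"
        by (rule bspec[OF r]) (use ab b' in \<open>unfold tensor_rels_def Let_def, blast\<close>)
      then show "?\<beta> a (b \<oplus>\<^bsub>N\<^esub> b') = ?\<beta> a b \<oplus>\<^bsub>P\<^esub> ?\<beta> a b'"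
        using ab b' by (simp add: h_simps)
    next
      fix c assume c: "c \<in> carrier K"
      have "h (free_gen K (c \<odot>\<^bsub>M\<^esub> a, b) \<ominus>\<^bsub>TF\<^esub> c \<odot>\<^bsub>TF\<^esub> free_gen K (a, b)) = \<zero>\<^bsub>P\<^esub>"
        by (rule bspec[OF r]) (use ab c in \<open>unfold tensor_rels_def Let_def, blast\<close>)
      then show "?\<beta> (c \<odot>\<^bsub>M\<^esub> a) b = c \<odot>\<^bsub>P\<^esub> ?\<beta> a b"
        using ab c by (simp add: h_simps)
      have "h (free_gen K (a, c \<odot>\<^bsub>N\<^esub> b) \<ominus>\<^bsub>TF\<^esub> c \<odot>\<^bsub>TF\<^esub> free_gen K (a, b)) = \<zero>\<^bsub>P\<^esub>"
        by (rule bspec[OF r]) (use ab c in \<open>unfold tensor_rels_def Let_def, blast\<close>)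
      then show "?\<beta> a (c \<odot>\<^bsub>N\<^esub> b) = c \<odot>\<^bsub>P\<^esub> ?\<beta> a b"
        using ab c by (simp add: h_simps)
    }
  next
    fix r assume "?A \<and> ?B \<and> ?C \<and> ?D" "r \<in> tensor_rels K M N"
    then show "h r = \<zero>\<^bsub>P\<^esub>"
      unfolding tensor_rels_def Let_def
      by (elim UnE CollectE exE conjE; hypsubst) (simp_all add: h_simps)
  qed
  also have "\<dots> \<longleftrightarrow> bilinear K M N P ?\<beta>"
    unfolding bilinear_def module_hom_def
    using module_hom_closed[OF h tensor_gen_closed] by auto
  finally show ?thesis .
qed

lemma tensor_module_module: "module K (tensor K M N)"
  unfolding tensor_def
  by (rule presented_module_module[OF M.R.is_cring tensor_rels_closed])

lemma pure_tensor_bilinear: "bilinear K M N (tensor K M N) (pure_tensor K M N)"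
proof -
  let ?q = "\<lambda>f. module_span K TF (tensor_rels K M N) +>\<^bsub>TF\<^esub> f"
  have "bilinear K M N (tensor K M N) (\<lambda>a b. ?q (free_gen K (a, b)))"
    unfolding tensor_rels_iff_bilinear[OF tensor_module_module
        presented_proj_hom[OF M.R.is_cring tensor_rels_closed, folded tensor_def], symmetric]
    unfolding tensor_def
    using presented_proj_rel[OF M.R.is_cring tensor_rels_closed] by blast
  then show ?thesis by (simp add: pure_tensor_def[abs_def] presented_gen_def)
qed

lemma tensor_induct:
  assumes "submodule S K (tensor K M N)"
    and "\<And>a b. \<lbrakk>a \<in> carrier M; b \<in> carrier N\<rbrakk> \<Longrightarrow> pure_tensor K M N a b \<in> S"
  shows "carrier (tensor K M N) \<subseteq> S"
  unfolding tensor_def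
  by (rule presented_module_induct[OF M.R.is_cring tensor_rels_closed])
    (use assms in \<open>auto simp: tensor_def pure_tensor_def\<close>)

text \<open>The substitute for Sweedler notation: two expressions linear in \<open>t\<close> are
  compared on pure tensors, and \<open>t\<close> is afterwards specialised to a coproduct.\<close>

lemma tensor_hom_eqI:
  assumes "module K P" "f \<in> module_hom K (tensor K M N) P" "g \<in> module_hom K (tensor K M N) P"
    and "\<And>a b. \<lbrakk>a \<in> carrier M; b \<in> carrier N\<rbrakk> \<Longrightarrow>
      f (pure_tensor K M N a b) = g (pure_tensor K M N a b)"
    and "t \<in> carrier (tensor K M N)"
  shows "f t = g t"
proof -
  have "carrier (tensor K M N) \<subseteq> {t \<in> carrier (tensor K M N). f t = g t}"
    by (rule tensor_induct[OF module_hom_kernel_eq[OF tensor_module_module assms(1-3)]])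
      (auto intro: assms(4) bilinear_closed[OF pure_tensor_bilinear])
  then show ?thesis using assms(5) by blast
qed

context
  fixes P :: "('k, 'p, 'q) module_scheme" and \<beta>
  assumes P: "module K P" and \<beta>: "bilinear K M N P \<beta>"
begin

lemma tensor_lift_rel:
  assumes L: "L \<in> module_hom K TF P"
    and gen: "\<And>x. x \<in> carrier M \<times> carrier N \<Longrightarrow> L (free_gen K x) = (case x of (a, b) \<Rightarrow> \<beta> a b)"
    and r: "r \<in> tensor_rels K M N"
  shows "L r = \<zero>\<^bsub>P\<^esub>"
proof -
  have "bilinear K M N P (\<lambda>a b. L (free_gen K (a, b)))"
  proof (rule bilinearI)
    fix a assume "a \<in> carrier M"
    then show "(\<lambda>b. L (free_gen K (a, b))) \<in> module_hom K N P"
      using bilinear_right[OF \<beta>, of a] gen by (simp add: module_hom_def Pi_iff)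
  next
    fix b assume "b \<in> carrier N"
    then show "(\<lambda>a. L (free_gen K (a, b))) \<in> module_hom K M P"
      using bilinear_left[OF \<beta>, of b] gen by (simp add: module_hom_def Pi_iff)
  qed
  then show ?thesis using tensor_rels_iff_bilinear[OF P L] r by blast
qed

lemma tensor_lift_hom: "tensor_lift K P \<beta> \<in> module_hom K (tensor K M N) P"
  unfolding tensor_lift_def tensor_def
  by (rule lin_ext_hom[OF M.R.is_cring tensor_rels_closed P])
    (auto intro: bilinear_closed[OF \<beta>] tensor_lift_rel)

lemma tensor_lift_pure:
  assumes "a \<in> carrier M" "b \<in> carrier N"
  shows "tensor_lift K P \<beta> (pure_tensor K M N a b) = \<beta> a b"
proof -
  have "lin_ext K P (\<lambda>(a, b). \<beta> a b)
      (presented_gen K (carrier M \<times> carrier N) (tensor_rels K M N) (a, b)) = (case (a, b) of (a, b) \<Rightarrow> \<beta> a b)"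
    by (rule lin_ext_gen[OF M.R.is_cring tensor_rels_closed P])
      (use assms in \<open>auto intro: bilinear_closed[OF \<beta>] tensor_lift_rel\<close>)
  then show ?thesis by (simp add: tensor_lift_def pure_tensor_def)
qed

end

end

section \<open>The tensor module\<close>

definition multilinear where
  "multilinear K V P g \<longleftrightarrow> (\<forall>w\<in>lists (carrier V). g w \<in> carrier P) \<and>
     (\<forall>u\<in>lists (carrier V). \<forall>w\<in>lists (carrier V). (\<lambda>a. g (u @ [a] @ w)) \<in> module_hom K V P)"

lemma multilinearI:
  assumes "\<And>w. w \<in> lists (carrier V) \<Longrightarrow> g w \<in> carrier P"
    and "\<And>u w. \<lbrakk>u \<in> lists (carrier V); w \<in> lists (carrier V)\<rbrakk> \<Longrightarrow>
      (\<lambda>a. g (u @ [a] @ w)) \<in> module_hom K V P"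
  shows "multilinear K V P g"
  using assms unfolding multilinear_def by blast

lemma multilinear_closed: "\<lbrakk>multilinear K V P g; w \<in> lists (carrier V)\<rbrakk> \<Longrightarrow> g w \<in> carrier P"
  unfolding multilinear_def by blast

lemma multilinear_slot:
  "\<lbrakk>multilinear K V P g; u \<in> lists (carrier V); w \<in> lists (carrier V)\<rbrakk> \<Longrightarrow>
    (\<lambda>a. g (u @ [a] @ w)) \<in> module_hom K V P"
  unfolding multilinear_def by blast

text \<open>Membership in \<open>module_hom\<close> only constrains values on the carrier. This
  allows a lift to be exchanged for its explicit value wherever that value is known only for carrier
  elements.\<close>

lemma module_hom_cong:
  assumes "module K M" "g \<in> module_hom K M N" "\<And>x. x \<in> carrier M \<Longrightarrow> f x = g x"
  shows "f \<in> module_hom K M N"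
proof -
  interpret M: module K M by fact
  show ?thesis using assms(2,3) by (simp add: module_hom_def Pi_iff)
qed

lemma module_hom_pw_finsum:
  assumes N: "module K N" and "finite A" "\<And>i. i \<in> A \<Longrightarrow> f i \<in> module_hom K M N"
    and M: "module K M"
  shows "(\<lambda>x. \<Oplus>\<^bsub>N\<^esub>i\<in>A. f i x) \<in> module_hom K M N"
  using assms(2,3)
proof (induction A rule: finite_induct)
  case empty
  interpret N: module K N by (rule N)
  show ?case using module_hom_const_zero[OF N] by simp
next
  case (insert j A)
  interpret N: module K N by (rule N)
  have "(\<lambda>x. f j x \<oplus>\<^bsub>N\<^esub> (\<Oplus>\<^bsub>N\<^esub>i\<in>A. f i x)) \<in> module_hom K M N"
    using insert by (intro module_hom_pw_add[OF N]) auto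
  moreover have "(\<Oplus>\<^bsub>N\<^esub>i\<in>insert j A. f i x) = f j x \<oplus>\<^bsub>N\<^esub> (\<Oplus>\<^bsub>N\<^esub>i\<in>A. f i x)"
    if "x \<in> carrier M" for x
    using insert.hyps module_hom_closed[OF insert.prems that] by (intro N.finsum_insert) auto
  ultimately show ?case
    by (rule module_hom_cong[OF M])
qed

text \<open>Linearity of \<open>\<beta> a\<close> in the second argument is preserved under linear
  combinations of \<open>a\<close>, because \<open>\<beta>\<close> is already linear in
  \<open>a\<close> pointwise. This serves maps that are lifts in the first argument: how they depend
  on the second is visible only at generators.\<close>

lemma bilinear_from_generators:
  assumes M: "module K M" and P: "module K P"
    and ind: "\<And>S. \<lbrakk>submodule S K M; G \<subseteq> S\<rbrakk> \<Longrightarrow> carrier M \<subseteq> S" and G: "G \<subseteq> carrier M"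
    and l: "\<And>b. b \<in> carrier N \<Longrightarrow> (\<lambda>a. \<beta> a b) \<in> module_hom K M P"
    and r: "\<And>a. a \<in> G \<Longrightarrow> \<beta> a \<in> module_hom K N P"
    and N: "module K N"
  shows "bilinear K M N P \<beta>"
proof (rule bilinearI)
  interpret M: module K M by (rule M)
  interpret P: module K P by (rule P)
  interpret N: module K N by (rule N)
  let ?S = "{a \<in> carrier M. \<beta> a \<in> module_hom K N P}"
  have "submodule ?S K M"
  proof (rule M.submoduleI)
    have "\<beta> \<zero>\<^bsub>M\<^esub> b = \<zero>\<^bsub>P\<^esub>" if "b \<in> carrier N" for b
      using module_hom_zero[OF l[OF that] M P] .
    then have "\<beta> \<zero>\<^bsub>M\<^esub> \<in> module_hom K N P"
      by (rule module_hom_cong[OF N module_hom_const_zero[OF P]])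
    then show "\<zero>\<^bsub>M\<^esub> \<in> ?S" by simp
  next
    fix a a' assume a: "a \<in> ?S" "a' \<in> ?S"
    have "\<beta> (a \<oplus>\<^bsub>M\<^esub> a') b = \<beta> a b \<oplus>\<^bsub>P\<^esub> \<beta> a' b" if "b \<in> carrier N" for b
      using module_hom_add[OF l[OF that]] a by auto
    moreover have "(\<lambda>b. \<beta> a b \<oplus>\<^bsub>P\<^esub> \<beta> a' b) \<in> module_hom K N P"
      using a by (intro module_hom_pw_add[OF P]) auto
    ultimately have "\<beta> (a \<oplus>\<^bsub>M\<^esub> a') \<in> module_hom K N P"
      by (rule module_hom_cong[OF N, rotated])
    then show "a \<oplus>\<^bsub>M\<^esub> a' \<in> ?S" using a by simp
  next
    have sm: "c \<odot>\<^bsub>M\<^esub> a \<in> ?S" if c: "c \<in> carrier K" and a: "a \<in> ?S" for c a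
    proof -
      have "\<beta> (c \<odot>\<^bsub>M\<^esub> a) b = c \<odot>\<^bsub>P\<^esub> \<beta> a b" if "b \<in> carrier N" for b
        using module_hom_smult[OF l[OF that] c] a by auto
      moreover have "(\<lambda>b. c \<odot>\<^bsub>P\<^esub> \<beta> a b) \<in> module_hom K N P"
      proof -
        have h: "\<beta> a \<in> module_hom K N P" using a by blast
        show ?thesis
          using c module_hom_closed[OF h]
          by (intro module_homI)
            (auto simp: module_hom_add[OF h] module_hom_smult[OF h] P.smult_r_distr
              P.smult_assoc1[symmetric] M.R.m_comm)
      qed
      ultimately have "\<beta> (c \<odot>\<^bsub>M\<^esub> a) \<in> module_hom K N P"
        by (rule module_hom_cong[OF N, rotated])
      then show ?thesis using a c by simp
    qed
    then show "\<And>c a. \<lbrakk>c \<in> carrier K; a \<in> ?S\<rbrakk> \<Longrightarrow> c \<odot>\<^bsub>M\<^esub> a \<in> ?S" .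
    show "\<ominus>\<^bsub>M\<^esub> a \<in> ?S" if "a \<in> ?S" for a
    proof -
      have "\<ominus>\<^bsub>M\<^esub> a = (\<ominus>\<^bsub>K\<^esub> \<one>\<^bsub>K\<^esub>) \<odot>\<^bsub>M\<^esub> a" using that module_minus_smult[OF M] by blast
      then show ?thesis using sm[OF _ that, of "\<ominus>\<^bsub>K\<^esub> \<one>\<^bsub>K\<^esub>"] by simp
    qed
  qed blast
  then have "carrier M \<subseteq> ?S" by (rule ind) (use G r in blast)
  then show "\<beta> a \<in> module_hom K N P" if "a \<in> carrier M" for a using that by blast
qed (rule l)

text \<open>The ring as a module over itself, so that counits can be treated as elements of
  \<open>module_hom\<close> like all other linear maps.\<close>

definition scalar_module :: "('k, 'r) ring_scheme \<Rightarrow> ('k, 'k) module" where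
  "scalar_module K = \<lparr>carrier = carrier K, mult = mult K, one = one K, zero = zero K, add = add K,
     smult = mult K\<rparr>"

lemma scalar_module_sel [simp]:
  "carrier (scalar_module K) = carrier K" "\<zero>\<^bsub>scalar_module K\<^esub> = \<zero>\<^bsub>K\<^esub>"
  "x \<oplus>\<^bsub>scalar_module K\<^esub> y = x \<oplus>\<^bsub>K\<^esub> y" "x \<odot>\<^bsub>scalar_module K\<^esub> y = x \<otimes>\<^bsub>K\<^esub> y"
  by (simp_all add: scalar_module_def)

lemma scalar_module_module:
  assumes "cring K"
  shows "module K (scalar_module K)"
proof -
  interpret cring K by fact
  show ?thesis
  proof (rule moduleI[OF assms])
    show "abelian_group (scalar_module K)"
    proof (rule abelian_groupI)
      fix x assume "x \<in> carrier (scalar_module K)"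
      then show "\<exists>y\<in>carrier (scalar_module K). y \<oplus>\<^bsub>scalar_module K\<^esub> x = \<zero>\<^bsub>scalar_module K\<^esub>"
        by (intro bexI[of _ "\<ominus>\<^bsub>K\<^esub> x"]) (auto simp: l_neg)
    qed (auto simp: a_ac)
  qed (auto simp: l_distr r_distr m_assoc)
qed

lemma smult_bilinear:
  assumes "module K M"
  shows "bilinear K (scalar_module K) M M (smult M)"
proof -
  interpret module K M by fact
  have comm: "a \<odot>\<^bsub>M\<^esub> (c \<odot>\<^bsub>M\<^esub> x) = c \<odot>\<^bsub>M\<^esub> (a \<odot>\<^bsub>M\<^esub> x)"
    if "a \<in> carrier K" "c \<in> carrier K" "x \<in> carrier M" for a c x
    using that by (metis smult_assoc1 R.m_comm)
  show ?thesis
    by (rule bilinearI; rule module_homI)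
      (auto simp: smult_l_distr smult_r_distr smult_assoc1 comm)
qed

context
  fixes K :: "('k, 'r) ring_scheme" and V :: "('k, 'v, 'm) module_scheme"
  assumes V: "module K V"
begin

interpretation V: module K V by (rule V)

private abbreviation (input) "WF \<equiv> free_module K (lists (carrier V))"

interpretation F: module K WF by (rule free_module_module[OF V.R.is_cring])

lemma word_gen_closed: "w \<in> lists (carrier V) \<Longrightarrow> free_gen K w \<in> carrier WF"
  by (rule free_gen_closed[OF V.R.is_cring])

lemma word_rels_closed: "word_rels K V \<subseteq> carrier WF"
  unfolding word_rels_def Let_def
  by (intro Un_least subsetI; elim CollectE exE conjE; simp add: word_gen_closed)

text \<open>The analogue of \<open>tensor_rels_iff_bilinear\<close> for words, again used in both
  directions: for \<open>word_multilinear\<close> and for lifting multilinear maps.\<close>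

lemma word_rels_iff_multilinear:
  assumes P: "module K P" and h: "h \<in> module_hom K WF P"
  shows "(\<forall>r\<in>word_rels K V. h r = \<zero>\<^bsub>P\<^esub>) \<longleftrightarrow> multilinear K V P (\<lambda>w. h (free_gen K w))"
proof -
  interpret P: module K P by (rule P)
  let ?g = "\<lambda>w. h (free_gen K w)" and ?L = "lists (carrier V)"
  note h_simps = module_hom_minus[OF h F.module_axioms P] module_hom_add[OF h]
    module_hom_smult[OF h] module_hom_closed[OF h] word_gen_closed module_diff_zero_iff[OF P]
  have "(\<forall>r\<in>word_rels K V. h r = \<zero>\<^bsub>P\<^esub>) \<longleftrightarrow>
      (\<forall>u\<in>?L. \<forall>w\<in>?L. (\<forall>a\<in>carrier V. \<forall>b\<in>carrier V.
         ?g (u @ [a \<oplus>\<^bsub>V\<^esub> b] @ w) = ?g (u @ [a] @ w) \<oplus>\<^bsub>P\<^esub> ?g (u @ [b] @ w)) \<and>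
        (\<forall>c\<in>carrier K. \<forall>a\<in>carrier V. ?g (u @ [c \<odot>\<^bsub>V\<^esub> a] @ w) = c \<odot>\<^bsub>P\<^esub> ?g (u @ [a] @ w)))"
    (is "_ \<longleftrightarrow> ?A")
  proof (intro iffI conjI ballI)
    assume r: "\<forall>r\<in>word_rels K V. h r = \<zero>\<^bsub>P\<^esub>"
    fix u w a assume uwa: "u \<in> ?L" "w \<in> ?L" "a \<in> carrier V"
    {
      fix b assume b: "b \<in> carrier V"
      have "h (free_gen K (u @ [a \<oplus>\<^bsub>V\<^esub> b] @ w) \<ominus>\<^bsub>WF\<^esub>
          (free_gen K (u @ [a] @ w) \<oplus>\<^bsub>WF\<^esub> free_gen K (u @ [b] @ w))) = \<zero>\<^bsub>P\<^esub>"
        by (rule bspec[OF r]) (use uwa b in \<open>unfold word_rels_def Let_def, blast\<close>)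
      then show "?g (u @ [a \<oplus>\<^bsub>V\<^esub> b] @ w) = ?g (u @ [a] @ w) \<oplus>\<^bsub>P\<^esub> ?g (u @ [b] @ w)"
        using uwa b by (simp add: h_simps)
    next
      fix c assume c: "c \<in> carrier K"
      have "h (free_gen K (u @ [c \<odot>\<^bsub>V\<^esub> a] @ w) \<ominus>\<^bsub>WF\<^esub> c \<odot>\<^bsub>WF\<^esub> free_gen K (u @ [a] @ w)) = \<zero>\<^bsub>P\<^esub>"
        by (rule bspec[OF r]) (use uwa c in \<open>unfold word_rels_def Let_def, blast\<close>)
      then show "?g (u @ [c \<odot>\<^bsub>V\<^esub> a] @ w) = c \<odot>\<^bsub>P\<^esub> ?g (u @ [a] @ w)"
        using uwa c by (simp add: h_simps)
    }
  next
    fix r assume "?A" "r \<in> word_rels K V"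
    then show "h r = \<zero>\<^bsub>P\<^esub>"
      unfolding word_rels_def Let_def
      by (elim UnE CollectE exE conjE; hypsubst) (simp_all add: h_simps)
  qed
  also have "\<dots> \<longleftrightarrow> multilinear K V P ?g"
    unfolding multilinear_def module_hom_def
    using module_hom_closed[OF h word_gen_closed] by auto
  finally show ?thesis .
qed

lemma tensor_power_module: "module K (tensor_module K V)"
  unfolding tensor_module_def
  by (rule presented_module_module[OF V.R.is_cring word_rels_closed])

lemma word_multilinear: "multilinear K V (tensor_module K V) (word K V)"
proof -
  let ?q = "\<lambda>f. module_span K WF (word_rels K V) +>\<^bsub>WF\<^esub> f"
  have "multilinear K V (tensor_module K V) (\<lambda>w. ?q (free_gen K w))"
    unfolding word_rels_iff_multilinear[OF tensor_power_module
        presented_proj_hom[OF V.R.is_cring word_rels_closed, folded tensor_module_def], symmetric]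
    unfolding tensor_module_def
    using presented_proj_rel[OF V.R.is_cring word_rels_closed] by blast
  then show ?thesis by (simp add: word_def presented_gen_def[abs_def])
qed

lemma word_induct:
  assumes "submodule S K (tensor_module K V)"
    and "word K V ` lists (carrier V) \<subseteq> S"
  shows "carrier (tensor_module K V) \<subseteq> S"
  unfolding tensor_module_def
  by (rule presented_module_induct[OF V.R.is_cring word_rels_closed])
    (use assms in \<open>auto simp: tensor_module_def word_def\<close>)

lemma word_hom_eqI:
  assumes "module K P" "f \<in> module_hom K (tensor_module K V) P" "g \<in> module_hom K (tensor_module K V) P"
    and "\<And>w. w \<in> lists (carrier V) \<Longrightarrow> f (word K V w) = g (word K V w)"
    and "t \<in> carrier (tensor_module K V)"
  shows "f t = g t"
proof -
  have "carrier (tensor_module K V) \<subseteq> {t \<in> carrier (tensor_module K V). f t = g t}"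
    by (rule word_induct[OF module_hom_kernel_eq[OF tensor_power_module assms(1-3)]])
      (auto intro: assms(4) multilinear_closed[OF word_multilinear])
  then show ?thesis using assms(5) by blast
qed

context
  fixes P :: "('k, 'p, 'q) module_scheme" and g
  assumes P: "module K P" and g: "multilinear K V P g"
begin

lemma word_lift_rel:
  assumes L: "L \<in> module_hom K WF P"
    and gen: "\<And>w. w \<in> lists (carrier V) \<Longrightarrow> L (free_gen K w) = g w"
    and r: "r \<in> word_rels K V"
  shows "L r = \<zero>\<^bsub>P\<^esub>"
proof -
  have "multilinear K V P (\<lambda>w. L (free_gen K w))"
  proof (rule multilinearI)
    fix u w assume uw: "u \<in> lists (carrier V)" "w \<in> lists (carrier V)"
    have "L (free_gen K (u @ [a] @ w)) = g (u @ [a] @ w)" if "a \<in> carrier V" for a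
      using uw that by (intro gen) auto
    then show "(\<lambda>a. L (free_gen K (u @ [a] @ w))) \<in> module_hom K V P"
      by (rule module_hom_cong[OF V multilinear_slot[OF g uw]])
  qed (auto simp: gen multilinear_closed[OF g])
  then show ?thesis using word_rels_iff_multilinear[OF P L] r by blast
qed

lemma word_lift_hom: "lin_ext K P g \<in> module_hom K (tensor_module K V) P"
  unfolding tensor_module_def
  by (rule lin_ext_hom[OF V.R.is_cring word_rels_closed P])
    (rule multilinear_closed[OF g], assumption, rule word_lift_rel)

lemma word_lift_word: "w \<in> lists (carrier V) \<Longrightarrow> lin_ext K P g (word K V w) = g w"
  unfolding word_def
  by (rule lin_ext_gen[OF V.R.is_cring word_rels_closed P])
    (rule multilinear_closed[OF g], assumption, rule word_lift_rel)

end

section \<open>Concatenation, deconcatenation and the counit of the tensor module\<close>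

private abbreviation (input) "T \<equiv> tensor_module K V"

interpretation T: module K T by (rule tensor_power_module)

lemma Tfc_sel [simp]:
  "carrier (Tfc K V) = carrier T" "add (Tfc K V) = add T" "smult (Tfc K V) = smult T"
  "\<zero>\<^bsub>Tfc K V\<^esub> = \<zero>\<^bsub>T\<^esub>" "\<one>\<^bsub>Tfc K V\<^esub> = word K V []"
  by (simp_all add: Tfc_def Let_def)

text \<open>The tensor construction only looks at carrier, addition and scalar multiplication, and
  these \<open>Tfc\<close> shares with \<open>tensor_module\<close>.\<close>

lemma tensor_Tfc: "tensor K (Tfc K V) (Tfc K V) = tensor K T T"
  "pure_tensor K (Tfc K V) (Tfc K V) = pure_tensor K T T"
  by (simp_all add: tensor_def pure_tensor_def[abs_def] tensor_rels_def)

lemma module_hom_Tfc: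
  "module_hom K M (Tfc K V) = module_hom K M T" "module_hom K (Tfc K V) M = module_hom K T M"
  by (simp_all add: module_hom_def)

lemma word_closed: "w \<in> lists (carrier V) \<Longrightarrow> word K V w \<in> carrier T"
  by (rule multilinear_closed[OF word_multilinear])

lemma multilinear_append_left:
  assumes "u \<in> lists (carrier V)"
  shows "multilinear K V T (\<lambda>w. word K V (u @ w))"
proof (rule multilinearI)
  fix w w' assume "w \<in> lists (carrier V)" "w' \<in> lists (carrier V)"
  then show "(\<lambda>a. word K V (u @ w @ [a] @ w')) \<in> module_hom K V T"
    using multilinear_slot[OF word_multilinear, of "u @ w" w'] assms by simp
qed (use assms in \<open>auto intro!: word_closed\<close>)

text \<open>Concatenation is a lift inside a lift. The outer one exists because for \<open>t\<close>
  a word the inner value is again a word, linear in each letter of \<open>u\<close>; the case of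
  general \<open>t\<close> follows by \<open>bilinear_from_generators\<close>.\<close>

lemma Tfc_mult_multilinear:
  assumes t: "t \<in> carrier T"
  shows "multilinear K V T (\<lambda>u. lin_ext K T (\<lambda>w. word K V (u @ w)) t)"
proof (rule multilinearI)
  fix u assume "u \<in> lists (carrier V)"
  then show "lin_ext K T (\<lambda>w. word K V (u @ w)) t \<in> carrier T"
    by (intro module_hom_closed[OF word_lift_hom] multilinear_append_left tensor_power_module t)
next
  fix u u' assume u: "u \<in> lists (carrier V)" "u' \<in> lists (carrier V)"
  have "bilinear K T V T (\<lambda>t a. lin_ext K T (\<lambda>w. word K V ((u @ [a] @ u') @ w)) t)"
  proof (rule bilinear_from_generators[OF tensor_power_module tensor_power_module word_induct])
    fix a assume "a \<in> carrier V"
    then show "lin_ext K T (\<lambda>w. word K V ((u @ [a] @ u') @ w)) \<in> module_hom K T T"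
      using u by (intro word_lift_hom multilinear_append_left tensor_power_module) auto
  next
    fix t assume "t \<in> word K V ` lists (carrier V)"
    then obtain w where w: "t = word K V w" "w \<in> lists (carrier V)" by blast
    have "lin_ext K T (\<lambda>w. word K V ((u @ [a] @ u') @ w)) t = word K V (u @ [a] @ (u' @ w))"
      if "a \<in> carrier V" for a
      using w u that
        word_lift_word[OF tensor_power_module multilinear_append_left, of "u @ [a] @ u'" w]
      by simp
    moreover have "(\<lambda>a. word K V (u @ [a] @ (u' @ w))) \<in> module_hom K V T"
      using u w by (intro multilinear_slot[OF word_multilinear]) auto
    ultimately show "(\<lambda>a. lin_ext K T (\<lambda>w. word K V ((u @ [a] @ u') @ w)) t) \<in> module_hom K V T"
      by (rule module_hom_cong[OF V, rotated])
  qed (auto intro: word_closed V)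
  then show "(\<lambda>a. lin_ext K T (\<lambda>w. word K V ((u @ [a] @ u') @ w)) t) \<in> module_hom K V T"
    using t by (rule bilinear_right)
qed

lemma Tfc_mult_left_hom:
  assumes "t \<in> carrier T"
  shows "(\<lambda>s. s \<otimes>\<^bsub>Tfc K V\<^esub> t) \<in> module_hom K T T"
  using word_lift_hom[OF tensor_power_module Tfc_mult_multilinear[OF assms]]
  by (simp add: Tfc_def Let_def)

lemma Tfc_mult_word_left:
  assumes "t \<in> carrier T" "u \<in> lists (carrier V)"
  shows "word K V u \<otimes>\<^bsub>Tfc K V\<^esub> t = lin_ext K T (\<lambda>w. word K V (u @ w)) t"
  using word_lift_word[OF tensor_power_module Tfc_mult_multilinear[OF assms(1)] assms(2)]
  by (simp add: Tfc_def Let_def)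

text \<open>The range of cuts depends on the length of the word alone, not on its letters. At each
  cut the varying letter sits in exactly one of the two factors, so each summand is linear in
  it.\<close>

lemma deconcatenation_multilinear:
  "multilinear K V (tensor K T T) (\<lambda>w. \<Oplus>\<^bsub>tensor K T T\<^esub>i\<in>{0..length w}.
     pure_tensor K T T (word K V (take i w)) (word K V (drop i w)))"
proof (rule multilinearI)
  note TT = tensor_module_module[OF tensor_power_module tensor_power_module]
  note pure = pure_tensor_bilinear[OF tensor_power_module tensor_power_module]
  interpret TT: module K "tensor K T T" by (rule TT)
  have in_set: "take i w \<in> lists (carrier V)" "drop i w \<in> lists (carrier V)"
    if "w \<in> lists (carrier V)" for i w
    using that by (auto dest: in_set_takeD in_set_dropD)
  show "(\<Oplus>\<^bsub>tensor K T T\<^esub>i\<in>{0..length w}. pure_tensor K T T (word K V (take i w)) (word K V (drop i w)))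
      \<in> carrier (tensor K T T)" if "w \<in> lists (carrier V)" for w
    by (intro TT.finsum_closed Pi_I bilinear_closed[OF pure] word_closed in_set that)
  fix u w assume uw: "u \<in> lists (carrier V)" "w \<in> lists (carrier V)"
  have "(\<lambda>a. \<Oplus>\<^bsub>tensor K T T\<^esub>i\<in>{0..length u + Suc (length w)}. pure_tensor K T T
      (word K V (take i (u @ [a] @ w))) (word K V (drop i (u @ [a] @ w)))) \<in> module_hom K V (tensor K T T)"
  proof (rule module_hom_pw_finsum[OF TT _ _ V])
    fix i
    show "(\<lambda>a. pure_tensor K T T (word K V (take i (u @ [a] @ w))) (word K V (drop i (u @ [a] @ w))))
        \<in> module_hom K V (tensor K T T)"
    proof (cases "i \<le> length u")
      case True
      have "(\<lambda>a. word K V (drop i u @ [a] @ w)) \<in> module_hom K V T"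
        by (intro multilinear_slot[OF word_multilinear] in_set uw)
      then have "(\<lambda>a. pure_tensor K T T (word K V (take i u)) (word K V (drop i u @ [a] @ w)))
          \<in> module_hom K V (tensor K T T)"
        by (rule module_hom_comp[OF bilinear_right[OF pure], rotated]) (intro word_closed in_set uw)
      then show ?thesis using True by simp
    next
      case False
      then obtain j where j: "i = length u + Suc j" by (metis add_Suc_right less_imp_Suc_add not_le)
      have "(\<lambda>a. word K V (u @ [a] @ take j w)) \<in> module_hom K V T"
        by (intro multilinear_slot[OF word_multilinear] in_set uw)
      then have "(\<lambda>a. pure_tensor K T T (word K V (u @ [a] @ take j w)) (word K V (drop j w)))
          \<in> module_hom K V (tensor K T T)"
        by (rule module_hom_comp[OF bilinear_left[OF pure], rotated]) (intro word_closed in_set uw)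
      then show ?thesis using j by simp
    qed
  qed simp
  then show "(\<lambda>a. \<Oplus>\<^bsub>tensor K T T\<^esub>i\<in>{0..length (u @ [a] @ w)}. pure_tensor K T T
      (word K V (take i (u @ [a] @ w))) (word K V (drop i (u @ [a] @ w)))) \<in> module_hom K V (tensor K T T)"
    by simp
qed

lemma Tfc_coprod_hom: "coprod (Tfc K V) \<in> module_hom K T (tensor K T T)"
  using word_lift_hom[OF tensor_module_module[OF tensor_power_module tensor_power_module]
      deconcatenation_multilinear]
  by (simp add: Tfc_def Let_def)

lemma Tfc_coprod_word:
  assumes "w \<in> lists (carrier V)"
  shows "coprod (Tfc K V) (word K V w) = (\<Oplus>\<^bsub>tensor K T T\<^esub>i\<in>{0..length w}.
     pure_tensor K T T (word K V (take i w)) (word K V (drop i w)))"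
  using word_lift_word[OF tensor_module_module[OF tensor_power_module tensor_power_module]
      deconcatenation_multilinear assms]
  by (simp add: Tfc_def Let_def)

text \<open>All words occurring in a relation contain a letter, so the coefficient of the empty word
  vanishes on each of their generators; the constant map 0 is linear in every slot.\<close>

lemma Tfc_counit_rel:
  shows "(\<lambda>f. f []) \<in> module_hom K WF (scalar_module K)"
    and "r \<in> word_rels K V \<Longrightarrow> r [] = \<zero>\<^bsub>scalar_module K\<^esub>"
proof -
  note S = scalar_module_module[OF V.R.is_cring]
  show h: "(\<lambda>f. f []) \<in> module_hom K WF (scalar_module K)"
    by (rule module_homI) (auto simp: free_module_def)
  have "multilinear K V (scalar_module K) (\<lambda>w. free_gen K w [])"
    by (rule multilinearI) (use module_hom_const_zero[OF S] in \<open>auto simp: free_gen_def\<close>)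
  then show "r \<in> word_rels K V \<Longrightarrow> r [] = \<zero>\<^bsub>scalar_module K\<^esub>"
    using word_rels_iff_multilinear[OF S h] by blast
qed

lemma Tfc_counit_hom: "counit (Tfc K V) \<in> module_hom K T (scalar_module K)"
proof -
  have "(\<lambda>t. the_elem ((\<lambda>f. f []) ` t)) \<in> module_hom K T (scalar_module K)"
    unfolding tensor_module_def
    by (rule presented_factor_hom[OF V.R.is_cring word_rels_closed
          scalar_module_module[OF V.R.is_cring] Tfc_counit_rel(1)]) (rule Tfc_counit_rel(2))
  then show ?thesis by (simp add: Tfc_def Let_def)
qed

lemma Tfc_counit_word:
  assumes "w \<in> lists (carrier V)"
  shows "counit (Tfc K V) (word K V w) = (if w = [] then \<one>\<^bsub>K\<^esub> else \<zero>\<^bsub>K\<^esub>)"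
proof -
  have "the_elem ((\<lambda>f. f []) ` word K V w) = free_gen K w []"
    unfolding word_def
    by (rule presented_factor_gen[OF V.R.is_cring word_rels_closed
          scalar_module_module[OF V.R.is_cring] Tfc_counit_rel(1) _ assms]) (rule Tfc_counit_rel(2))
  then show ?thesis by (simp add: Tfc_def Let_def free_gen_def)
qed

end

section \<open>The projection onto the primitive elements\<close>

lemma (in abelian_group) add_diff_cancel_left:
  "\<lbrakk>x \<in> carrier G; y \<in> carrier G\<rbrakk> \<Longrightarrow> x \<oplus> y \<ominus> x = y"
  by (simp add: minus_eq a_comm[of x y] a_assoc r_neg)

lemma (in abelian_group) diff_add_cancel:
  "\<lbrakk>x \<in> carrier G; y \<in> carrier G\<rbrakk> \<Longrightarrow> x \<ominus> y \<oplus> y = x"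
  by (simp add: minus_eq a_assoc l_neg)

text \<open>Collects the generators in a set, which is the shape of the induction hypothesis of
  \<open>bilinear_from_generators\<close>.\<close>

lemma pure_generators_induct:
  assumes "module K M" "module K N" "submodule S K (tensor K M N)"
    "{pure_tensor K M N a b | a b. a \<in> carrier M \<and> b \<in> carrier N} \<subseteq> S"
  shows "carrier (tensor K M N) \<subseteq> S"
  by (rule tensor_induct[OF assms(1-3)]) (use assms(4) in blast)

lemma tensor_bilinear_from_generators:
  assumes M: "module K M" and N: "module K N" and P: "module K P" and Q: "module K Q"
    and l: "\<And>b. b \<in> carrier Q \<Longrightarrow> (\<lambda>t. \<beta> t b) \<in> module_hom K (tensor K M N) P"
    and r: "\<And>a b. \<lbrakk>a \<in> carrier M; b \<in> carrier N\<rbrakk> \<Longrightarrow> \<beta> (pure_tensor K M N a b) \<in> module_hom K Q P"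
  shows "bilinear K (tensor K M N) Q P \<beta>"
  by (rule bilinear_from_generators[OF tensor_module_module[OF M N] P pure_generators_induct[OF M N]])
    (use l r Q in \<open>auto intro: bilinear_closed[OF pure_tensor_bilinear[OF M N]]\<close>)

text \<open>The two extra assumptions make c 1 = 0 imply c = 0 (\<open>smult_one_eq_zero\<close>).
  Through this the counit takes the value 1 at the unit and 0 at every product with a primitive
  right factor.\<close>

locale nontrivial_uib = unital_infinitesimal_bialgebra K H
  for K :: "('k, 'r) ring_scheme" and H :: "('k, 'a, 'm) bialg_scheme" +
  assumes K_field: "field K" and one_neq_zero: "\<one>\<^bsub>H\<^esub> \<noteq> \<zero>\<^bsub>H\<^esub>"
begin

abbreviation "HH \<equiv> tensor K H H"
abbreviation "pt \<equiv> pure_tensor K H H"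
abbreviation "Delta \<equiv> coprod H"
abbreviation "eps \<equiv> counit H"
abbreviation "Prim \<equiv> primitives K H"
abbreviation "Filt \<equiv> conn_filtration K H"
abbreviation "W \<equiv> reduced_coprod K H"
abbreviation "tm \<equiv> tensor_mult K H"

lemma K_cring: "cring K"
  by unfold_locales

lemma H_module: "module K H"
  by unfold_locales

lemma HH_module: "module K HH"
  by (rule tensor_module_module[OF H_module H_module])

sublocale HH: module K HH
  by (rule HH_module)

lemma pt_bilinear: "bilinear K H H HH pt"
  by (rule pure_tensor_bilinear[OF H_module H_module])

lemma pt_closed [simp]: "\<lbrakk>a \<in> carrier H; b \<in> carrier H\<rbrakk> \<Longrightarrow> pt a b \<in> carrier HH"
  by (rule bilinear_closed[OF pt_bilinear])

lemma pt_hom_right: "a \<in> carrier H \<Longrightarrow> pt a \<in> module_hom K H HH"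
  by (rule bilinear_right[OF pt_bilinear])

lemma pt_hom_left: "b \<in> carrier H \<Longrightarrow> (\<lambda>a. pt a b) \<in> module_hom K H HH"
  by (rule bilinear_left[OF pt_bilinear])

lemma pt_minus_right:
  "\<lbrakk>a \<in> carrier H; x \<in> carrier H; y \<in> carrier H\<rbrakk> \<Longrightarrow> pt a (x \<ominus>\<^bsub>H\<^esub> y) = pt a x \<ominus>\<^bsub>HH\<^esub> pt a y"
  using module_hom_minus[OF pt_hom_right H_module HH_module] .

lemma pt_minus_left:
  "\<lbrakk>b \<in> carrier H; x \<in> carrier H; y \<in> carrier H\<rbrakk> \<Longrightarrow> pt (x \<ominus>\<^bsub>H\<^esub> y) b = pt x b \<ominus>\<^bsub>HH\<^esub> pt y b"
  using module_hom_minus[OF pt_hom_left H_module HH_module] .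

lemma pt_smult:
  assumes "c \<in> carrier K" "a \<in> carrier H" "b \<in> carrier H"
  shows "pt (c \<odot>\<^bsub>H\<^esub> a) b = c \<odot>\<^bsub>HH\<^esub> pt a b" "pt a (c \<odot>\<^bsub>H\<^esub> b) = c \<odot>\<^bsub>HH\<^esub> pt a b"
  using module_hom_smult[OF pt_hom_left] module_hom_smult[OF pt_hom_right] assms by auto

lemma pt_zero [simp]:
  assumes "a \<in> carrier H"
  shows "pt a \<zero>\<^bsub>H\<^esub> = \<zero>\<^bsub>HH\<^esub>" "pt \<zero>\<^bsub>H\<^esub> a = \<zero>\<^bsub>HH\<^esub>"
  using module_hom_zero[OF pt_hom_right H_module HH_module]
    module_hom_zero[OF pt_hom_left H_module HH_module] assms by auto

lemma HH_hom_eqI: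
  assumes "module K P" "f \<in> module_hom K HH P" "g \<in> module_hom K HH P"
    and "\<And>a b. \<lbrakk>a \<in> carrier H; b \<in> carrier H\<rbrakk> \<Longrightarrow> f (pt a b) = g (pt a b)"
    and "t \<in> carrier HH"
  shows "f t = g t"
  by (rule tensor_hom_eqI[OF H_module H_module assms])

lemmas lift_hom = tensor_lift_hom[OF H_module H_module]
lemmas lift_pt = tensor_lift_pure[OF H_module H_module]

lemma Delta_closed [simp]: "x \<in> carrier H \<Longrightarrow> Delta x \<in> carrier HH"
  by (rule module_hom_closed[OF coprod_hom])

lemma eps_hom: "eps \<in> module_hom K H (scalar_module K)"
  by (rule module_homI) (use counit_closed counit_add counit_smult in auto)

lemma eps_closed [simp]: "x \<in> carrier H \<Longrightarrow> eps x \<in> carrier K"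
  using counit_closed by auto

lemma mult_bilinear: "bilinear K H H H (mult H)"
  by (rule bilinearI; rule module_homI)
    (auto simp: smult_mult_left smult_mult_right H.l_distr H.r_distr)

lemma eps_smult_bilinear: "bilinear K H H H (\<lambda>a b. eps a \<odot>\<^bsub>H\<^esub> b)"
  by (rule bilinear_comp[OF smult_bilinear[OF H_module] eps_hom module_hom_id])

lemma eps_unit_hom: "(\<lambda>x. eps x \<odot>\<^bsub>H\<^esub> \<one>\<^bsub>H\<^esub>) \<in> module_hom K H H"
  by (rule bilinear_left[OF eps_smult_bilinear H.one_closed])

section \<open>The factorwise product on H \<otimes> H\<close>

lemma tm_inner_bilinear:
  assumes "a \<in> carrier H" "b \<in> carrier H"
  shows "bilinear K H H HH (\<lambda>a' b'. pt (a \<otimes>\<^bsub>H\<^esub> a') (b \<otimes>\<^bsub>H\<^esub> b'))"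
  by (rule bilinear_comp[OF pt_bilinear bilinear_right[OF mult_bilinear assms(1)]
        bilinear_right[OF mult_bilinear assms(2)]])

text \<open>With one of \<open>a\<close>, \<open>b\<close> held fixed, linearity in the other is
  clear when \<open>t\<close> is a pure tensor and extends to all \<open>t\<close> because the lift
  is linear in \<open>t\<close>.\<close>

lemma tm_outer_bilinear:
  assumes t: "t \<in> carrier HH"
  shows "bilinear K H H HH
    (\<lambda>a b. tensor_lift K HH (\<lambda>a' b'. pt (a \<otimes>\<^bsub>H\<^esub> a') (b \<otimes>\<^bsub>H\<^esub> b')) t)"
proof (rule bilinearI)
  fix a assume a: "a \<in> carrier H"
  have "bilinear K HH H HH
      (\<lambda>t b. tensor_lift K HH (\<lambda>a' b'. pt (a \<otimes>\<^bsub>H\<^esub> a') (b \<otimes>\<^bsub>H\<^esub> b')) t)"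
  proof (rule tensor_bilinear_from_generators[OF H_module H_module HH_module H_module])
    fix a' b' assume "a' \<in> carrier H" "b' \<in> carrier H"
    then have "(\<lambda>b. pt (a \<otimes>\<^bsub>H\<^esub> a') (b \<otimes>\<^bsub>H\<^esub> b')) \<in> module_hom K H HH"
      using a by (intro module_hom_comp[OF pt_hom_right bilinear_left[OF mult_bilinear]]) auto
    moreover have "tensor_lift K HH (\<lambda>a' b'. pt (a \<otimes>\<^bsub>H\<^esub> a') (b \<otimes>\<^bsub>H\<^esub> b')) (pt a' b')
        = pt (a \<otimes>\<^bsub>H\<^esub> a') (b \<otimes>\<^bsub>H\<^esub> b')" if "b \<in> carrier H" for b
      by (rule lift_pt[OF HH_module tm_inner_bilinear]) fact+
    ultimately show "(\<lambda>b. tensor_lift K HH (\<lambda>a' b'. pt (a \<otimes>\<^bsub>H\<^esub> a') (b \<otimes>\<^bsub>H\<^esub> b')) (pt a' b'))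
        \<in> module_hom K H HH"
      by (rule module_hom_cong[OF H_module])
  qed (intro lift_hom[OF HH_module] tm_inner_bilinear a)
  then show "(\<lambda>b. tensor_lift K HH (\<lambda>a' b'. pt (a \<otimes>\<^bsub>H\<^esub> a') (b \<otimes>\<^bsub>H\<^esub> b')) t) \<in> module_hom K H HH"
    using t by (rule bilinear_right)
next
  fix b assume b: "b \<in> carrier H"
  have "bilinear K HH H HH
      (\<lambda>t a. tensor_lift K HH (\<lambda>a' b'. pt (a \<otimes>\<^bsub>H\<^esub> a') (b \<otimes>\<^bsub>H\<^esub> b')) t)"
  proof (rule tensor_bilinear_from_generators[OF H_module H_module HH_module H_module])
    fix a' b' assume "a' \<in> carrier H" "b' \<in> carrier H"
    then have "(\<lambda>a. pt (a \<otimes>\<^bsub>H\<^esub> a') (b \<otimes>\<^bsub>H\<^esub> b')) \<in> module_hom K H HH"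
      using b by (intro module_hom_comp[OF pt_hom_left bilinear_left[OF mult_bilinear]]) auto
    moreover have "tensor_lift K HH (\<lambda>a' b'. pt (a \<otimes>\<^bsub>H\<^esub> a') (b \<otimes>\<^bsub>H\<^esub> b')) (pt a' b')
        = pt (a \<otimes>\<^bsub>H\<^esub> a') (b \<otimes>\<^bsub>H\<^esub> b')" if "a \<in> carrier H" for a
      by (rule lift_pt[OF HH_module tm_inner_bilinear]) fact+
    ultimately show "(\<lambda>a. tensor_lift K HH (\<lambda>a' b'. pt (a \<otimes>\<^bsub>H\<^esub> a') (b \<otimes>\<^bsub>H\<^esub> b')) (pt a' b'))
        \<in> module_hom K H HH"
      by (rule module_hom_cong[OF H_module])
  qed (intro lift_hom[OF HH_module] tm_inner_bilinear b)
  then show "(\<lambda>a. tensor_lift K HH (\<lambda>a' b'. pt (a \<otimes>\<^bsub>H\<^esub> a') (b \<otimes>\<^bsub>H\<^esub> b')) t) \<in> module_hom K H HH"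
    using t by (rule bilinear_right)
qed

lemma tm_pt_left:
  assumes "a \<in> carrier H" "b \<in> carrier H" "t \<in> carrier HH"
  shows "tm (pt a b) t = tensor_lift K HH (\<lambda>a' b'. pt (a \<otimes>\<^bsub>H\<^esub> a') (b \<otimes>\<^bsub>H\<^esub> b')) t"
  unfolding tensor_mult_def using lift_pt[OF HH_module tm_outer_bilinear[OF assms(3)] assms(1,2)] .

lemma tm_pt:
  assumes "a \<in> carrier H" "b \<in> carrier H" "a' \<in> carrier H" "b' \<in> carrier H"
  shows "tm (pt a b) (pt a' b') = pt (a \<otimes>\<^bsub>H\<^esub> a') (b \<otimes>\<^bsub>H\<^esub> b')"
  using tm_pt_left[OF assms(1,2)] lift_pt[OF HH_module tm_inner_bilinear[OF assms(1,2)] assms(3,4)] assms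
  by simp

lemma tm_bilinear: "bilinear K HH HH HH tm"
proof (rule tensor_bilinear_from_generators[OF H_module H_module HH_module HH_module])
  show "(\<lambda>s. tm s t) \<in> module_hom K HH HH" if "t \<in> carrier HH" for t
    unfolding tensor_mult_def by (rule lift_hom[OF HH_module tm_outer_bilinear[OF that]])
  show "tm (pt a b) \<in> module_hom K HH HH" if "a \<in> carrier H" "b \<in> carrier H" for a b
    by (rule module_hom_cong[OF HH_module lift_hom[OF HH_module tm_inner_bilinear[OF that]]])
      (rule tm_pt_left[OF that])
qed

lemmas tm_closed [simp] = bilinear_closed[OF tm_bilinear]
lemmas tm_hom_left = bilinear_left[OF tm_bilinear]
lemmas tm_hom_right = bilinear_right[OF tm_bilinear]

text \<open>The element 1 \<otimes> 1 is neutral on both sides for \<open>tm\<close>, so the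
  compatibility axiom at x = y = 1 reads d = d + d - 1 \<otimes> 1.\<close>

lemma Delta_one: "Delta \<one>\<^bsub>H\<^esub> = pt \<one>\<^bsub>H\<^esub> \<one>\<^bsub>H\<^esub>"
proof -
  let ?u = "pt \<one>\<^bsub>H\<^esub> \<one>\<^bsub>H\<^esub>" and ?d = "Delta \<one>\<^bsub>H\<^esub>"
  have "tm ?u ?d = ?d"
    by (rule HH_hom_eqI[OF HH_module tm_hom_right module_hom_id]) (auto simp: tm_pt)
  moreover have "tm ?d ?u = ?d"
    by (rule HH_hom_eqI[OF HH_module tm_hom_left module_hom_id]) (auto simp: tm_pt)
  ultimately have "?d = ?d \<oplus>\<^bsub>HH\<^esub> ?d \<ominus>\<^bsub>HH\<^esub> ?u"
    using coprod_mult[of "\<one>\<^bsub>H\<^esub>" "\<one>\<^bsub>H\<^esub>"] by simp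
  then have "?d \<oplus>\<^bsub>HH\<^esub> (?d \<ominus>\<^bsub>HH\<^esub> ?u) = ?d"
    by (simp add: HH.minus_eq HH.a_assoc)
  then have "?d \<ominus>\<^bsub>HH\<^esub> ?u = \<zero>\<^bsub>HH\<^esub>"
    by (subst (asm) HH.add.l_cancel_one) auto
  then show ?thesis by (simp add: module_diff_zero_iff[OF HH_module])
qed

lemma smult_one_eq_zero:
  assumes c: "c \<in> carrier K" and z: "c \<odot>\<^bsub>H\<^esub> \<one>\<^bsub>H\<^esub> = \<zero>\<^bsub>H\<^esub>"
  shows "c = \<zero>\<^bsub>K\<^esub>"
proof (rule ccontr)
  interpret Kf: field K by (rule K_field)
  assume "c \<noteq> \<zero>\<^bsub>K\<^esub>"
  then have "c \<in> Units K" using c Kf.field_Units by blast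
  then have "inv\<^bsub>K\<^esub> c \<odot>\<^bsub>H\<^esub> (c \<odot>\<^bsub>H\<^esub> \<one>\<^bsub>H\<^esub>) = \<one>\<^bsub>H\<^esub>"
    using c by (simp add: smult_assoc1[symmetric])
  then show False using z one_neq_zero \<open>c \<in> Units K\<close> by simp
qed

text \<open>The counit axiom at 1, where \<Delta>(1) = 1 \<otimes> 1, only says \<epsilon>(1) 1 = 1
  inside H; cancelling the unit needs \<open>smult_one_eq_zero\<close>.\<close>

lemma eps_one: "eps \<one>\<^bsub>H\<^esub> = \<one>\<^bsub>K\<^esub>"
proof -
  have "eps \<one>\<^bsub>H\<^esub> \<odot>\<^bsub>H\<^esub> \<one>\<^bsub>H\<^esub> = \<one>\<^bsub>H\<^esub>"
    using counit_left[of "\<one>\<^bsub>H\<^esub>"] lift_pt[OF H_module eps_smult_bilinear] by (simp add: Delta_one)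
  then have "(eps \<one>\<^bsub>H\<^esub> \<ominus>\<^bsub>K\<^esub> \<one>\<^bsub>K\<^esub>) \<odot>\<^bsub>H\<^esub> \<one>\<^bsub>H\<^esub> = \<zero>\<^bsub>H\<^esub>"
    by (simp add: R.minus_eq smult_l_distr smult_l_minus M.r_neg)
  then have "eps \<one>\<^bsub>H\<^esub> \<ominus>\<^bsub>K\<^esub> \<one>\<^bsub>K\<^esub> = \<zero>\<^bsub>K\<^esub>" by (intro smult_one_eq_zero) auto
  then show ?thesis using R.diff_add_cancel[of "eps \<one>\<^bsub>H\<^esub>" "\<one>\<^bsub>K\<^esub>"] by simp
qed

section \<open>Primitive elements and the reduced coproduct\<close>

lemma W_hom: "W \<in> module_hom K H HH"
  unfolding reduced_coprod_def
  by (intro module_hom_pw_minus[OF HH_module] coprod_hom pt_hom_left pt_hom_right) auto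

lemma Prim_submodule: "submodule Prim K H"
  unfolding primitives_def
  by (rule module_hom_kernel_eq[OF H_module HH_module W_hom module_hom_const_zero[OF HH_module]])

lemma Prim_closed: "p \<in> Prim \<Longrightarrow> p \<in> carrier H"
  by (simp add: primitives_def)

lemma Delta_prim:
  assumes "p \<in> Prim"
  shows "Delta p = pt p \<one>\<^bsub>H\<^esub> \<oplus>\<^bsub>HH\<^esub> pt \<one>\<^bsub>H\<^esub> p"
proof -
  have p: "p \<in> carrier H" using Prim_closed[OF assms] .
  then have "Delta p \<ominus>\<^bsub>HH\<^esub> pt p \<one>\<^bsub>H\<^esub> = pt \<one>\<^bsub>H\<^esub> p"
    using assms by (simp add: primitives_def reduced_coprod_def module_diff_zero_iff[OF HH_module])
  then have "Delta p = pt \<one>\<^bsub>H\<^esub> p \<oplus>\<^bsub>HH\<^esub> pt p \<one>\<^bsub>H\<^esub>"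
    using p by (metis Delta_closed H.one_closed HH.add.inv_solve_right HH.minus_eq pt_closed
        HH.a_inv_closed HH.minus_closed HH.a_assoc HH.l_neg HH.r_zero)
  then show ?thesis using p by (simp add: HH.a_comm)
qed

text \<open>Multiplying the term 1 \<otimes> p of \<Delta>(p) by x \<otimes> 1 gives x \<otimes> p,
  which is exactly the correction term subtracted by the compatibility axiom.\<close>

lemma Delta_mult_prim:
  assumes x: "x \<in> carrier H" and p: "p \<in> Prim"
  shows "Delta (x \<otimes>\<^bsub>H\<^esub> p) = pt (x \<otimes>\<^bsub>H\<^esub> p) \<one>\<^bsub>H\<^esub> \<oplus>\<^bsub>HH\<^esub> tm (Delta x) (pt \<one>\<^bsub>H\<^esub> p)"
proof -
  have pc: "p \<in> carrier H" using Prim_closed[OF p] .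
  have "tm (pt x \<one>\<^bsub>H\<^esub>) (Delta p) = pt (x \<otimes>\<^bsub>H\<^esub> p) \<one>\<^bsub>H\<^esub> \<oplus>\<^bsub>HH\<^esub> pt x p"
    using x pc by (simp add: Delta_prim[OF p] module_hom_add[OF tm_hom_right] tm_pt)
  then have "Delta (x \<otimes>\<^bsub>H\<^esub> p) =
      pt (x \<otimes>\<^bsub>H\<^esub> p) \<one>\<^bsub>H\<^esub> \<oplus>\<^bsub>HH\<^esub> pt x p \<oplus>\<^bsub>HH\<^esub> tm (Delta x) (pt \<one>\<^bsub>H\<^esub> p) \<ominus>\<^bsub>HH\<^esub> pt x p"
    using coprod_mult[OF x pc] by simp
  also have "\<dots> = pt (x \<otimes>\<^bsub>H\<^esub> p) \<one>\<^bsub>H\<^esub> \<oplus>\<^bsub>HH\<^esub> (pt x p \<oplus>\<^bsub>HH\<^esub> (\<ominus>\<^bsub>HH\<^esub> pt x p \<oplus>\<^bsub>HH\<^esub> tm (Delta x) (pt \<one>\<^bsub>H\<^esub> p)))"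
    using x pc by (simp add: HH.minus_eq HH.a_assoc HH.a_comm[of "\<ominus>\<^bsub>HH\<^esub> pt x p"])
  finally show ?thesis using x pc by (simp add: HH.r_neg2)
qed

text \<open>The term x p \<otimes> 1 cancels, and 1 \<otimes> x p is itself a product with 1
  \<otimes> p. What is left has 1 \<otimes> p as a right factor, the form in which
  \<open>coassoc_conv\<close> can be applied.\<close>

lemma W_mult_prim:
  assumes x: "x \<in> carrier H" and p: "p \<in> Prim"
  shows "W (x \<otimes>\<^bsub>H\<^esub> p) = tm (Delta x \<ominus>\<^bsub>HH\<^esub> pt \<one>\<^bsub>H\<^esub> x) (pt \<one>\<^bsub>H\<^esub> p)"
proof -
  have pc: "p \<in> carrier H" using Prim_closed[OF p] .
  have "tm (Delta x \<ominus>\<^bsub>HH\<^esub> pt \<one>\<^bsub>H\<^esub> x) (pt \<one>\<^bsub>H\<^esub> p)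
      = tm (Delta x) (pt \<one>\<^bsub>H\<^esub> p) \<ominus>\<^bsub>HH\<^esub> pt \<one>\<^bsub>H\<^esub> (x \<otimes>\<^bsub>H\<^esub> p)"
    using x pc by (simp add: module_hom_minus[OF tm_hom_left HH_module HH_module] tm_pt)
  moreover have "Delta (x \<otimes>\<^bsub>H\<^esub> p) \<ominus>\<^bsub>HH\<^esub> pt (x \<otimes>\<^bsub>H\<^esub> p) \<one>\<^bsub>H\<^esub> = tm (Delta x) (pt \<one>\<^bsub>H\<^esub> p)"
    using x pc by (simp add: Delta_mult_prim[OF x p] HH.add_diff_cancel_left)
  ultimately show ?thesis by (simp add: reduced_coprod_def)
qed

text \<open>Applying \<epsilon> \<otimes> id to \<open>Delta_mult_prim\<close> gives x p =
  \<epsilon>(x p) 1 + x p.\<close>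

lemma eps_mult_prim:
  assumes x: "x \<in> carrier H" and p: "p \<in> Prim"
  shows "eps (x \<otimes>\<^bsub>H\<^esub> p) = \<zero>\<^bsub>K\<^esub>"
proof -
  have pc: "p \<in> carrier H" using Prim_closed[OF p] .
  let ?E = "tensor_lift K H (\<lambda>a b. eps a \<odot>\<^bsub>H\<^esub> b)"
  note E = lift_hom[OF H_module eps_smult_bilinear]
  have "?E (tm (Delta x) (pt \<one>\<^bsub>H\<^esub> p)) = ?E (Delta x) \<otimes>\<^bsub>H\<^esub> p"
    by (rule HH_hom_eqI[OF H_module module_hom_comp[OF E tm_hom_left]
          module_hom_comp[OF bilinear_left[OF mult_bilinear pc] E]])
      (use x pc in \<open>auto simp: tm_pt lift_pt[OF H_module eps_smult_bilinear] smult_mult_left\<close>)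
  then have "x \<otimes>\<^bsub>H\<^esub> p = eps (x \<otimes>\<^bsub>H\<^esub> p) \<odot>\<^bsub>H\<^esub> \<one>\<^bsub>H\<^esub> \<oplus>\<^bsub>H\<^esub> x \<otimes>\<^bsub>H\<^esub> p"
    using counit_left[of "x \<otimes>\<^bsub>H\<^esub> p"] x pc
    by (simp add: Delta_mult_prim[OF x p] module_hom_add[OF E] counit_left
        lift_pt[OF H_module eps_smult_bilinear])
  then have "eps (x \<otimes>\<^bsub>H\<^esub> p) \<odot>\<^bsub>H\<^esub> \<one>\<^bsub>H\<^esub> = \<zero>\<^bsub>H\<^esub>"
    using x pc by (metis M.add.l_cancel_one' H.m_closed H.one_closed eps_closed smult_closed
        M.add.r_cancel_one)
  then show ?thesis using x pc by (intro smult_one_eq_zero) auto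
qed

end

context nontrivial_uib
begin

section \<open>Convolution with the projection along the unit\<close>

definition J where "J x = x \<ominus>\<^bsub>H\<^esub> eps x \<odot>\<^bsub>H\<^esub> \<one>\<^bsub>H\<^esub>"

lemma J_hom: "J \<in> module_hom K H H"
  unfolding J_def by (rule module_hom_pw_minus[OF H_module module_hom_id eps_unit_hom])

lemma J_closed [simp]: "x \<in> carrier H \<Longrightarrow> J x \<in> carrier H"
  by (rule module_hom_closed[OF J_hom])

lemma J_one [simp]: "J \<one>\<^bsub>H\<^esub> = \<zero>\<^bsub>H\<^esub>"
  by (simp add: J_def eps_one module_diff_zero_iff[OF H_module])

lemma pt_J:
  assumes "a \<in> carrier H" "b \<in> carrier H"
  shows pt_J_left: "pt (J a) b = pt a b \<ominus>\<^bsub>HH\<^esub> eps a \<odot>\<^bsub>HH\<^esub> pt \<one>\<^bsub>H\<^esub> b"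
    and pt_J_right: "pt a (J b) = pt a b \<ominus>\<^bsub>HH\<^esub> eps b \<odot>\<^bsub>HH\<^esub> pt a \<one>\<^bsub>H\<^esub>"
  using assms by (simp_all add: J_def pt_minus_left pt_minus_right pt_smult)

text \<open>Kept apart from \<open>conv\<close> so that identities can be proved for an arbitrary
  tensor, hence on pure tensors, before a coproduct is inserted.\<close>

definition mult_lift where
  "mult_lift f g = tensor_lift K H (\<lambda>a b. f a \<otimes>\<^bsub>H\<^esub> g b)"

lemma mult_lift_bilinear:
  "\<lbrakk>f \<in> module_hom K H H; g \<in> module_hom K H H\<rbrakk> \<Longrightarrow> bilinear K H H H (\<lambda>a b. f a \<otimes>\<^bsub>H\<^esub> g b)"
  by (rule bilinear_comp[OF mult_bilinear])

lemma mult_lift_hom: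
  "\<lbrakk>f \<in> module_hom K H H; g \<in> module_hom K H H\<rbrakk> \<Longrightarrow> mult_lift f g \<in> module_hom K HH H"
  unfolding mult_lift_def by (rule lift_hom[OF H_module mult_lift_bilinear])

lemma mult_lift_pt:
  "\<lbrakk>f \<in> module_hom K H H; g \<in> module_hom K H H; a \<in> carrier H; b \<in> carrier H\<rbrakk>
    \<Longrightarrow> mult_lift f g (pt a b) = f a \<otimes>\<^bsub>H\<^esub> g b"
  unfolding mult_lift_def by (rule lift_pt[OF H_module mult_lift_bilinear])

definition conv where "conv f g x = mult_lift f g (Delta x)"

lemma conv_hom:
  "\<lbrakk>f \<in> module_hom K H H; g \<in> module_hom K H H\<rbrakk> \<Longrightarrow> conv f g \<in> module_hom K H H"
  unfolding conv_def[abs_def] by (rule module_hom_comp[OF mult_lift_hom coprod_hom])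

lemma conv_one:
  "\<lbrakk>f \<in> module_hom K H H; g \<in> module_hom K H H\<rbrakk> \<Longrightarrow> conv f g \<one>\<^bsub>H\<^esub> = f \<one>\<^bsub>H\<^esub> \<otimes>\<^bsub>H\<^esub> g \<one>\<^bsub>H\<^esub>"
  by (simp add: conv_def Delta_one mult_lift_pt)

text \<open>The map x \<mapsto> \<epsilon>(x) 1, by which J differs from id, is neutral for
  convolution. This is what turns the equation id \<star> e = J into the recursion for
  \<open>proj\<close>.\<close>

lemma conv_J:
  assumes g: "g \<in> module_hom K H H" and x: "x \<in> carrier H"
  shows "conv J g x = conv (\<lambda>x. x) g x \<ominus>\<^bsub>H\<^esub> g x"
proof -
  let ?E = "tensor_lift K H (\<lambda>a b. eps a \<odot>\<^bsub>H\<^esub> b)"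
  note E = lift_hom[OF H_module eps_smult_bilinear]
  have "mult_lift J g (Delta x) = mult_lift (\<lambda>x. x) g (Delta x) \<ominus>\<^bsub>H\<^esub> g (?E (Delta x))"
  proof (rule HH_hom_eqI[OF H_module mult_lift_hom[OF J_hom g]
        module_hom_pw_minus[OF H_module mult_lift_hom[OF module_hom_id g] module_hom_comp[OF g E]]])
    fix a b assume ab: "a \<in> carrier H" "b \<in> carrier H"
    then have gb: "g b \<in> carrier H" using module_hom_closed[OF g] by blast
    have "(a \<ominus>\<^bsub>H\<^esub> eps a \<odot>\<^bsub>H\<^esub> \<one>\<^bsub>H\<^esub>) \<otimes>\<^bsub>H\<^esub> g b = a \<otimes>\<^bsub>H\<^esub> g b \<ominus>\<^bsub>H\<^esub> eps a \<odot>\<^bsub>H\<^esub> g b"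
      using ab gb module_hom_minus[OF bilinear_left[OF mult_bilinear gb] H_module H_module]
      by (simp add: smult_mult_left)
    then show "mult_lift J g (pt a b) = mult_lift (\<lambda>x. x) g (pt a b) \<ominus>\<^bsub>H\<^esub> g (?E (pt a b))"
      using ab by (simp add: mult_lift_pt g J_hom module_hom_id lift_pt[OF H_module eps_smult_bilinear]
          J_def module_hom_smult[OF g])
  qed (simp add: x)
  then show ?thesis using x by (simp add: conv_def counit_left)
qed

lemma conv_id:
  assumes g: "g \<in> module_hom K H H" and x: "x \<in> carrier H"
  shows "conv (\<lambda>x. x) g x = conv J g x \<oplus>\<^bsub>H\<^esub> g x"
  using module_hom_closed[OF conv_hom[OF module_hom_id g] x] module_hom_closed[OF g x]
  by (simp add: conv_J[OF g x] M.diff_add_cancel)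

text \<open>Both terms change by the same multiple of 1 \<otimes> 1. Thus \<open>W_mult_prim\<close>
  for J(a) p can be rewritten with \<open>a\<close> itself, as \<open>coassoc_conv\<close>
  requires.\<close>

lemma Delta_diff_J:
  assumes x: "x \<in> carrier H"
  shows "Delta (J x) \<ominus>\<^bsub>HH\<^esub> pt \<one>\<^bsub>H\<^esub> (J x) = Delta x \<ominus>\<^bsub>HH\<^esub> pt \<one>\<^bsub>H\<^esub> x"
proof -
  let ?u = "eps x \<odot>\<^bsub>HH\<^esub> pt \<one>\<^bsub>H\<^esub> \<one>\<^bsub>H\<^esub>"
  have "Delta (J x) = Delta x \<ominus>\<^bsub>HH\<^esub> ?u"
    using x by (simp add: J_def module_hom_minus[OF coprod_hom H_module HH_module]
        module_hom_smult[OF coprod_hom] Delta_one)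
  moreover have "pt \<one>\<^bsub>H\<^esub> (J x) = pt \<one>\<^bsub>H\<^esub> x \<ominus>\<^bsub>HH\<^esub> ?u"
    using x by (simp add: J_def pt_minus_right pt_smult)
  ultimately show ?thesis
    using x by (simp add: HH.minus_eq HH.minus_add HH.a_ac HH.r_neg HH.r_neg1 HH.r_neg2)
qed

text \<open>Coassociativity enters only here: both sides are \<open>\<Sum> J x\<^sub>1 \<otimes> x\<^sub>2 g(x\<^sub>3)\<close>.\<close>

lemma coassoc_conv:
  assumes g: "g \<in> module_hom K H H" and x: "x \<in> carrier H"
  shows "tensor_lift K HH (\<lambda>a b. tm (Delta a \<ominus>\<^bsub>HH\<^esub> pt \<one>\<^bsub>H\<^esub> a) (pt \<one>\<^bsub>H\<^esub> (g b))) (Delta x)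
    = tensor_lift K HH (\<lambda>a b. pt (J a) (conv (\<lambda>x. x) g b)) (Delta x)"
proof -
  let ?c = "conv (\<lambda>x. x) g" and ?L = "mult_lift (\<lambda>x. x) g"
  let ?E = "tensor_lift K H (\<lambda>a b. eps a \<odot>\<^bsub>H\<^esub> b)"
  note gc = module_hom_closed[OF g]
  note c = conv_hom[OF module_hom_id g]
  note L = mult_lift_hom[OF module_hom_id g]
  note L_pt = mult_lift_pt[OF module_hom_id g]
  note E = lift_hom[OF H_module eps_smult_bilinear]
  note E_pt = lift_pt[OF H_module eps_smult_bilinear]
  note pg = module_hom_comp[OF pt_hom_right[OF H.one_closed] g]
  have U1: "bilinear K H H HH (\<lambda>a b. tm (Delta a) (pt \<one>\<^bsub>H\<^esub> (g b)))"
    by (rule bilinear_comp[OF tm_bilinear coprod_hom pg])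
  have d_hom: "(\<lambda>a. Delta a \<ominus>\<^bsub>HH\<^esub> pt \<one>\<^bsub>H\<^esub> a) \<in> module_hom K H HH"
    by (rule module_hom_pw_minus[OF HH_module coprod_hom pt_hom_right]) simp
  have U: "bilinear K H H HH (\<lambda>a b. tm (Delta a \<ominus>\<^bsub>HH\<^esub> pt \<one>\<^bsub>H\<^esub> a) (pt \<one>\<^bsub>H\<^esub> (g b)))"
    by (rule bilinear_comp[OF tm_bilinear d_hom pg])
  have V1: "bilinear K H H HH (\<lambda>a b. pt a (?c b))"
    by (rule bilinear_comp[OF pt_bilinear module_hom_id c])
  have V: "bilinear K H H HH (\<lambda>a b. pt (J a) (?c b))"
    by (rule bilinear_comp[OF pt_bilinear J_hom c])
  have p1: "pt \<one>\<^bsub>H\<^esub> \<in> module_hom K H HH" by (rule pt_hom_right) simp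
  \<comment> \<open>\<open>Ueq\<close> and \<open>Veq\<close> isolate what the subtracted parts
    contribute. On both sides this is 1 \<otimes> (id \<star> g)(x), so only the main parts remain
    to be compared.\<close>
  have Ueq: "tensor_lift K HH (\<lambda>a b. tm (Delta a \<ominus>\<^bsub>HH\<^esub> pt \<one>\<^bsub>H\<^esub> a) (pt \<one>\<^bsub>H\<^esub> (g b))) (Delta x)
      = tensor_lift K HH (\<lambda>a b. tm (Delta a) (pt \<one>\<^bsub>H\<^esub> (g b))) (Delta x) \<ominus>\<^bsub>HH\<^esub> pt \<one>\<^bsub>H\<^esub> (?L (Delta x))"
    by (rule HH_hom_eqI[OF HH_module lift_hom[OF HH_module U]
        module_hom_pw_minus[OF HH_module lift_hom[OF HH_module U1] module_hom_comp[OF p1 L]]])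
      (auto simp: x lift_pt[OF HH_module U] lift_pt[OF HH_module U1] L_pt gc tm_pt
        module_hom_minus[OF tm_hom_left HH_module HH_module])
  have Veq: "tensor_lift K HH (\<lambda>a b. pt (J a) (?c b)) (Delta x)
      = tensor_lift K HH (\<lambda>a b. pt a (?c b)) (Delta x) \<ominus>\<^bsub>HH\<^esub> pt \<one>\<^bsub>H\<^esub> (?c (?E (Delta x)))"
    by (rule HH_hom_eqI[OF HH_module lift_hom[OF HH_module V]
        module_hom_pw_minus[OF HH_module lift_hom[OF HH_module V1]
          module_hom_comp[OF p1 module_hom_comp[OF c E]]]])
      (auto simp: x lift_pt[OF HH_module V] lift_pt[OF HH_module V1] E_pt module_hom_closed[OF c]
        module_hom_smult[OF c] pt_J_left pt_smult)
  let ?A = "tensor_assoc K H H H" and ?T = "tensor K H HH"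
  let ?f = "tensor_map K HH H Delta id" and ?h = "tensor_map K H HH id Delta"
  \<comment> \<open>\<open>Z\<close> is id \<otimes> (mult \<circ> (id \<otimes> g)) on H \<otimes>
    (H \<otimes> H). It sends the two sides of coassociativity to the two main parts, both equal to
    \<Sum> x1 \<otimes> x2 g(x3).\<close>
  define Z where "Z = tensor_lift K HH (\<lambda>a s. pt a (?L s))"
  have T: "module K ?T" by (rule tensor_module_module[OF H_module HH_module])
  have T': "module K (tensor K HH H)" by (rule tensor_module_module[OF HH_module H_module])
  note T_bil = pure_tensor_bilinear[OF H_module HH_module]
  note T'_bil = pure_tensor_bilinear[OF HH_module H_module]
  have Zb: "bilinear K H HH HH (\<lambda>a s. pt a (?L s))"
    by (rule bilinear_comp[OF pt_bilinear module_hom_id L])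
  have Z: "Z \<in> module_hom K ?T HH"
    unfolding Z_def by (rule tensor_lift_hom[OF H_module HH_module HH_module Zb])
  have Z_pure: "Z (pure_tensor K H HH a s) = pt a (?L s)" if "a \<in> carrier H" "s \<in> carrier HH" for a s
    unfolding Z_def by (rule tensor_lift_pure[OF H_module HH_module HH_module Zb that])
  have fb: "bilinear K H H (tensor K HH H) (\<lambda>a b. pure_tensor K HH H (Delta a) (id b))"
    by (rule bilinear_comp[OF T'_bil coprod_hom module_hom_id'])
  have hb: "bilinear K H H ?T (\<lambda>a b. pure_tensor K H HH (id a) (Delta b))"
    by (rule bilinear_comp[OF T_bil module_hom_id' coprod_hom])
  have f: "?f \<in> module_hom K HH (tensor K HH H)"
    unfolding tensor_map_def by (rule lift_hom[OF T' fb])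
  have h: "?h \<in> module_hom K HH ?T"
    unfolding tensor_map_def by (rule lift_hom[OF T hb])
  have f_pt: "?f (pt a b) = pure_tensor K HH H (Delta a) b" if "a \<in> carrier H" "b \<in> carrier H" for a b
    unfolding tensor_map_def lift_pt[OF T' fb that] by simp
  have h_pt: "?h (pt a b) = pure_tensor K H HH a (Delta b)" if "a \<in> carrier H" "b \<in> carrier H" for a b
    unfolding tensor_map_def lift_pt[OF T hb that] by simp
  have Ab': "bilinear K H H ?T (\<lambda>a b. pure_tensor K H HH a (pt b c))" if "c \<in> carrier H" for c
    by (rule bilinear_comp[OF T_bil module_hom_id pt_hom_left[OF that]])
  have Ab: "bilinear K HH H ?T
      (\<lambda>t c. tensor_lift K ?T (\<lambda>a b. pure_tensor K H HH a (pt b c)) t)"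
  proof (rule tensor_bilinear_from_generators[OF H_module H_module T H_module])
    fix a b assume ab: "a \<in> carrier H" "b \<in> carrier H"
    have "(\<lambda>c. pure_tensor K H HH a (pt b c)) \<in> module_hom K H ?T"
      by (rule module_hom_comp[OF bilinear_right[OF T_bil ab(1)] pt_hom_right[OF ab(2)]])
    then show "(\<lambda>c. tensor_lift K ?T (\<lambda>a b. pure_tensor K H HH a (pt b c)) (pt a b)) \<in> module_hom K H ?T"
      by (rule module_hom_cong[OF H_module]) (rule lift_pt[OF T Ab' ab])
  qed (rule lift_hom[OF T Ab'])
  have A: "?A \<in> module_hom K (tensor K HH H) ?T"
    unfolding tensor_assoc_def by (rule tensor_lift_hom[OF HH_module H_module T Ab])
  have A_pure: "?A (pure_tensor K HH H t c) = tensor_lift K ?T (\<lambda>a b. pure_tensor K H HH a (pt b c)) t"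
    if "t \<in> carrier HH" "c \<in> carrier H" for t c
    unfolding tensor_assoc_def by (rule tensor_lift_pure[OF HH_module H_module T Ab that])
  have ZA: "Z (?A (pure_tensor K HH H t b)) = tm t (pt \<one>\<^bsub>H\<^esub> (g b))"
    if t: "t \<in> carrier HH" and b: "b \<in> carrier H" for t b
  proof -
    have "Z (tensor_lift K ?T (\<lambda>c d. pure_tensor K H HH c (pt d b)) t) = tm t (pt \<one>\<^bsub>H\<^esub> (g b))"
      by (rule HH_hom_eqI[OF HH_module module_hom_comp[OF Z lift_hom[OF T Ab'[OF b]]] tm_hom_left _ t])
        (auto simp: gc b lift_pt[OF T Ab'[OF b]] Z_pure L_pt tm_pt)
    then show ?thesis using A_pure[OF t b] by simp
  qed
  have "tensor_lift K HH (\<lambda>a b. tm (Delta a) (pt \<one>\<^bsub>H\<^esub> (g b))) (Delta x) = Z (?A (?f (Delta x)))"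
    by (rule HH_hom_eqI[OF HH_module lift_hom[OF HH_module U1]
        module_hom_comp[OF Z module_hom_comp[OF A f]]])
      (auto simp: x lift_pt[OF HH_module U1] f_pt ZA)
  also have "\<dots> = Z (?h (Delta x))" by (simp add: coassoc[OF x])
  also have "\<dots> = tensor_lift K HH (\<lambda>a b. pt a (?c b)) (Delta x)"
    by (rule HH_hom_eqI[OF HH_module module_hom_comp[OF Z h] lift_hom[OF HH_module V1]])
      (auto simp: x lift_pt[OF HH_module V1] h_pt Z_pure conv_def[symmetric])
  finally show ?thesis
    using x by (simp add: Ueq Veq conv_def[symmetric] counit_left)
qed

text \<open>By the counit axioms, J on the left factor subtracts 1 \<otimes> x, and J on the right
  factor then subtracts J(x) \<otimes> 1. Since \<open>Delta_diff_J\<close> allows x to be replaced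
  by J(x) in the first difference, the result is a reduced coproduct.\<close>

lemma J_J_Delta:
  assumes x: "x \<in> carrier H"
  shows "tensor_lift K HH (\<lambda>a b. pt (J a) (J b)) (Delta x) = W (J x)"
proof -
  let ?E = "tensor_lift K H (\<lambda>a b. eps a \<odot>\<^bsub>H\<^esub> b)"
  let ?E' = "tensor_lift K H (\<lambda>a b. eps b \<odot>\<^bsub>H\<^esub> a)"
  note E = lift_hom[OF H_module eps_smult_bilinear]
  note E_pt = lift_pt[OF H_module eps_smult_bilinear]
  note E' = lift_hom[OF H_module bilinear_swap[OF eps_smult_bilinear]]
  note E'_pt = lift_pt[OF H_module bilinear_swap[OF eps_smult_bilinear]]
  have B: "bilinear K H H HH (\<lambda>a b. pt (J a) (J b))" "bilinear K H H HH (\<lambda>a b. pt (J a) b)"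
    using bilinear_comp[OF pt_bilinear J_hom J_hom] bilinear_comp[OF pt_bilinear J_hom module_hom_id]
    by auto
  have p1: "pt \<one>\<^bsub>H\<^esub> \<in> module_hom K H HH" by (rule pt_hom_right) simp
  have p2: "(\<lambda>a. pt (J a) \<one>\<^bsub>H\<^esub>) \<in> module_hom K H HH"
    by (rule module_hom_comp[OF pt_hom_left J_hom]) simp
  have 1: "tensor_lift K HH (\<lambda>a b. pt (J a) b) (Delta x) = Delta x \<ominus>\<^bsub>HH\<^esub> pt \<one>\<^bsub>H\<^esub> (?E (Delta x))"
    by (rule HH_hom_eqI[OF HH_module lift_hom[OF HH_module B(2)]
        module_hom_pw_minus[OF HH_module module_hom_id module_hom_comp[OF p1 E]]])
      (auto simp: x lift_pt[OF HH_module B(2)] E_pt pt_J_left pt_smult)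
  have 2: "tensor_lift K HH (\<lambda>a b. pt (J a) (J b)) (Delta x)
      = tensor_lift K HH (\<lambda>a b. pt (J a) b) (Delta x) \<ominus>\<^bsub>HH\<^esub> pt (J (?E' (Delta x))) \<one>\<^bsub>H\<^esub>"
    by (rule HH_hom_eqI[OF HH_module lift_hom[OF HH_module B(1)]
        module_hom_pw_minus[OF HH_module lift_hom[OF HH_module B(2)] module_hom_comp[OF p2 E']]])
      (auto simp: x lift_pt[OF HH_module B(1)] lift_pt[OF HH_module B(2)] E'_pt
        module_hom_smult[OF J_hom] pt_J_right pt_smult)
  have "W (J x) = Delta (J x) \<ominus>\<^bsub>HH\<^esub> pt \<one>\<^bsub>H\<^esub> (J x) \<ominus>\<^bsub>HH\<^esub> pt (J x) \<one>\<^bsub>H\<^esub>"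
    using x by (simp add: reduced_coprod_def HH.minus_eq HH.a_ac)
  moreover have "Delta (J x) \<ominus>\<^bsub>HH\<^esub> pt \<one>\<^bsub>H\<^esub> (J x) = Delta x \<ominus>\<^bsub>HH\<^esub> pt \<one>\<^bsub>H\<^esub> x"
    using Delta_diff_J[OF x] .
  ultimately show ?thesis
    using x by (simp add: 1 2 counit_left counit_right)
qed

text \<open>Successive approximations to the solution \<open>e\<close> of the convolution equation \<open>id \<star> e = J\<close>,
  rewritten as the fixed-point equation \<open>e = J - J \<star> e\<close>.\<close>

primrec proj :: "nat \<Rightarrow> 'a \<Rightarrow> 'a" where
  "proj 0 = (\<lambda>x. \<zero>\<^bsub>H\<^esub>)"
| "proj (Suc k) = (\<lambda>x. J x \<ominus>\<^bsub>H\<^esub> conv J (proj k) x)"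

lemma proj_hom: "proj k \<in> module_hom K H H"
proof (induction k)
  case 0
  show ?case using module_hom_const_zero[OF H_module] by simp
next
  case (Suc k)
  show ?case
    using module_hom_pw_minus[OF H_module J_hom conv_hom[OF J_hom Suc]] by simp
qed

lemma proj_closed [simp]: "x \<in> carrier H \<Longrightarrow> proj k x \<in> carrier H"
  by (rule module_hom_closed[OF proj_hom])

lemma proj_one [simp]: "proj k \<one>\<^bsub>H\<^esub> = \<zero>\<^bsub>H\<^esub>"
  by (cases k) (simp_all add: conv_one J_hom proj_hom module_diff_zero_iff[OF H_module])

section \<open>The iterates along the filtration\<close>

lemma Filt_closed: "x \<in> Filt k \<Longrightarrow> x \<in> carrier H"
  by (cases k) auto

text \<open>The induction principle for the filtration: \<open>W x\<close> lies in the span of the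
  tensors from level k, so membership of those tensors and of the two outer terms suffices, without
  choosing a decomposition of \<open>W x\<close>.\<close>

lemma Delta_in:
  assumes N: "submodule N K HH" and x: "x \<in> Filt (Suc k)"
    and "pt x \<one>\<^bsub>H\<^esub> \<in> N" "pt \<one>\<^bsub>H\<^esub> x \<in> N"
    and F: "\<And>a b. \<lbrakk>a \<in> Filt k; b \<in> Filt k\<rbrakk> \<Longrightarrow> pt a b \<in> N"
  shows "Delta x \<in> N"
proof -
  have xc: "x \<in> carrier H" using Filt_closed[OF x] .
  have "W x \<in> module_span K HH {pt a b | a b. a \<in> Filt k \<and> b \<in> Filt k}"
    using x by simp
  also have "\<dots> \<subseteq> N" by (rule module_span_least[OF N]) (use F in blast)
  finally have "W x \<oplus>\<^bsub>HH\<^esub> pt \<one>\<^bsub>H\<^esub> x \<oplus>\<^bsub>HH\<^esub> pt x \<one>\<^bsub>H\<^esub> \<in> N"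
    using assms(3,4) HH.submoduleE(5)[OF N] by blast
  moreover have "W x \<oplus>\<^bsub>HH\<^esub> pt \<one>\<^bsub>H\<^esub> x \<oplus>\<^bsub>HH\<^esub> pt x \<one>\<^bsub>H\<^esub> = Delta x"
    using xc by (simp add: reduced_coprod_def HH.diff_add_cancel)
  ultimately show ?thesis by simp
qed

lemma Delta_hom_eq:
  assumes P: "module K P" and f: "f \<in> module_hom K HH P" and g: "g \<in> module_hom K HH P"
    and x: "x \<in> Filt (Suc k)"
    and "f (pt x \<one>\<^bsub>H\<^esub>) = g (pt x \<one>\<^bsub>H\<^esub>)" "f (pt \<one>\<^bsub>H\<^esub> x) = g (pt \<one>\<^bsub>H\<^esub> x)"
    and "\<And>a b. \<lbrakk>a \<in> Filt k; b \<in> Filt k\<rbrakk> \<Longrightarrow> f (pt a b) = g (pt a b)"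
  shows "f (Delta x) = g (Delta x)"
proof -
  have "Delta x \<in> {t \<in> carrier HH. f t = g t}"
    by (rule Delta_in[OF module_hom_kernel_eq[OF HH_module P f g] x])
      (use assms(5-7) Filt_closed[OF x] Filt_closed[of _ k] in auto)
  then show ?thesis by blast
qed

lemma zero_Prim [simp]: "\<zero>\<^bsub>H\<^esub> \<in> Prim"
  using subgroup.one_closed[OF submodule.axioms(1)[OF Prim_submodule]] by simp

text \<open>On level k+1 the two convolutions agree term by term: J kills the 1 in 1 \<otimes> x,
  the iterates kill the 1 in x \<otimes> 1, and for tensors from level k the second factor is
  covered by the induction hypothesis.\<close>

lemma proj_stationary: "x \<in> Filt k \<Longrightarrow> proj (Suc k) x = proj k x"
proof (induction k arbitrary: x)
  case 0
  then obtain c where "x = c \<odot>\<^bsub>H\<^esub> \<one>\<^bsub>H\<^esub>" "c \<in> carrier K" by auto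
  then show ?case
    using module_hom_smult[OF proj_hom, of c "\<one>\<^bsub>H\<^esub>" "Suc 0"] by (simp del: proj.simps(2))
next
  case (Suc k)
  have xc: "x \<in> carrier H" using Filt_closed[OF Suc.prems] .
  have "mult_lift J (proj (Suc k)) (Delta x) = mult_lift J (proj k) (Delta x)"
    by (rule Delta_hom_eq[OF H_module mult_lift_hom[OF J_hom proj_hom] mult_lift_hom[OF J_hom proj_hom]
          Suc.prems])
      (use xc Filt_closed[of _ k] in
        \<open>simp_all add: mult_lift_pt J_hom proj_hom Suc.IH del: proj.simps(2)\<close>)
  then show ?case by (simp add: conv_def)
qed

text \<open>The limit e is not yet available, so the cancellation is done with \<open>proj k\<close>
  alone. At level k it already satisfies id \<star> \<open>proj k\<close> = J, and the arguments of
  \<open>proj k\<close> occurring inside \<Delta>(x) are at level k apart from the outer terms,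
  which vanish.\<close>

lemma proj_Prim: "x \<in> Filt k \<Longrightarrow> proj k x \<in> Prim"
proof (induction k arbitrary: x)
  case 0
  show ?case by simp
next
  case (Suc k)
  let ?g = "proj k" and ?c = "conv (\<lambda>x. x) (proj k)"
  have xc: "x \<in> carrier H" using Filt_closed[OF Suc.prems] .
  have d_hom: "(\<lambda>a. Delta a \<ominus>\<^bsub>HH\<^esub> pt \<one>\<^bsub>H\<^esub> a) \<in> module_hom K H HH"
    by (rule module_hom_pw_minus[OF HH_module coprod_hom pt_hom_right]) simp
  have U: "bilinear K H H HH (\<lambda>a b. tm (Delta a \<ominus>\<^bsub>HH\<^esub> pt \<one>\<^bsub>H\<^esub> a) (pt \<one>\<^bsub>H\<^esub> (?g b)))"
    by (rule bilinear_comp[OF tm_bilinear d_hom module_hom_comp[OF pt_hom_right[OF H.one_closed] proj_hom]])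
  note c = conv_hom[OF module_hom_id proj_hom]
  have V: "bilinear K H H HH (\<lambda>a b. pt (J a) (?c b))"
    by (rule bilinear_comp[OF pt_bilinear J_hom c])
  have JJ: "bilinear K H H HH (\<lambda>a b. pt (J a) (J b))"
    by (rule bilinear_comp[OF pt_bilinear J_hom J_hom])
  have tm_zero: "tm t \<zero>\<^bsub>HH\<^esub> = \<zero>\<^bsub>HH\<^esub>" "tm \<zero>\<^bsub>HH\<^esub> t = \<zero>\<^bsub>HH\<^esub>" if "t \<in> carrier HH" for t
    using module_hom_zero[OF tm_hom_right HH_module HH_module, OF that]
      module_hom_zero[OF tm_hom_left HH_module HH_module, OF that] by auto
  have W0: "W \<zero>\<^bsub>H\<^esub> = \<zero>\<^bsub>HH\<^esub>" by (rule module_hom_zero[OF W_hom H_module HH_module])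
  \<comment> \<open>For tensors a \<otimes> b from level k the induction hypothesis makes
    \<open>?g b\<close> primitive, which is what \<open>W_mult_prim\<close> needs. The outer terms
    vanish by J(1) = 0, \<open>?g\<close> 1 = 0 and \<Delta>(1) - 1 \<otimes> 1 = 0.\<close>
  have "W (conv J ?g x)
      = tensor_lift K HH (\<lambda>a b. tm (Delta a \<ominus>\<^bsub>HH\<^esub> pt \<one>\<^bsub>H\<^esub> a) (pt \<one>\<^bsub>H\<^esub> (?g b))) (Delta x)"
    unfolding conv_def
  proof (rule Delta_hom_eq[OF HH_module module_hom_comp[OF W_hom mult_lift_hom[OF J_hom proj_hom]]
        lift_hom[OF HH_module U] Suc.prems])
    fix a b assume "a \<in> Filt k" "b \<in> Filt k"
    then have ab: "a \<in> carrier H" "b \<in> carrier H" "?g b \<in> Prim"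
      using Filt_closed Suc.IH by auto
    then show "W (mult_lift J ?g (pt a b)) = tensor_lift K HH
        (\<lambda>a b. tm (Delta a \<ominus>\<^bsub>HH\<^esub> pt \<one>\<^bsub>H\<^esub> a) (pt \<one>\<^bsub>H\<^esub> (?g b))) (pt a b)"
      by (simp add: mult_lift_pt J_hom proj_hom lift_pt[OF HH_module U] W_mult_prim Delta_diff_J)
  qed (use xc in \<open>simp_all add: mult_lift_pt J_hom proj_hom lift_pt[OF HH_module U] tm_zero W0
      Delta_one module_diff_zero_iff[OF HH_module, THEN iffD2]\<close>)
  also have "\<dots> = tensor_lift K HH (\<lambda>a b. pt (J a) (?c b)) (Delta x)"
    by (rule coassoc_conv[OF proj_hom xc])
  also have "\<dots> = tensor_lift K HH (\<lambda>a b. pt (J a) (J b)) (Delta x)"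
  proof (rule Delta_hom_eq[OF HH_module lift_hom[OF HH_module V] lift_hom[OF HH_module JJ] Suc.prems])
    fix a b assume ab: "a \<in> Filt k" "b \<in> Filt k"
    then have bc: "b \<in> carrier H" "a \<in> carrier H" using Filt_closed by auto
    \<comment> \<open>Stationarity replaces \<open>proj k b\<close> by
      \<open>proj (Suc k) b\<close>, whose defining equation then cancels
      \<open>conv J ?g b\<close>.\<close>
    have "?c b = conv J ?g b \<oplus>\<^bsub>H\<^esub> proj (Suc k) b"
      using conv_id[OF proj_hom bc(1)] proj_stationary[OF ab(2)] by simp
    also have "\<dots> = J b"
      using bc module_hom_closed[OF conv_hom[OF J_hom proj_hom] bc(1)]
      by (simp add: M.minus_eq M.a_lcomm[of "conv J ?g b" "J b"] M.r_neg)
    finally show "tensor_lift K HH (\<lambda>a b. pt (J a) (?c b)) (pt a b)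
        = tensor_lift K HH (\<lambda>a b. pt (J a) (J b)) (pt a b)"
      using bc by (simp add: lift_pt[OF HH_module V] lift_pt[OF HH_module JJ])
  qed (use xc module_hom_closed[OF c xc] in \<open>simp_all add: lift_pt[OF HH_module V] lift_pt[OF HH_module JJ]
      conv_one module_hom_id proj_hom\<close>)
  also have "\<dots> = W (J x)" by (rule J_J_Delta[OF xc])
  finally have "W (proj (Suc k) x) = \<zero>\<^bsub>HH\<^esub>"
    using xc module_hom_closed[OF conv_hom[OF J_hom proj_hom] xc] module_hom_closed[OF W_hom]
    by (simp add: module_hom_minus[OF W_hom H_module HH_module] module_diff_zero_iff[OF HH_module])
  then show ?case using xc by (simp add: primitives_def del: proj.simps)
qed

end

section \<open>Surjectivity: the filtration lies in the image\<close>

context nontrivial_uib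
begin

abbreviation "V \<equiv> primitive_module K H"
abbreviation "TP \<equiv> tensor_module K V"
abbreviation "TC \<equiv> Tfc K V"

lemma V_module: "module K V"
  by (rule submodule.submodule_is_module[OF Prim_submodule H_module])

lemma T_module: "module K TP"
  by (rule tensor_power_module[OF V_module])

lemma module_hom_restrict_Prim: "f \<in> module_hom K H P \<Longrightarrow> f \<in> module_hom K V P"
  using Prim_closed by (auto simp: module_hom_def)

lemma lists_Prim: "lists (carrier V) = lists Prim"
  by simp

lemmas T_word_closed = word_closed[OF V_module, unfolded lists_Prim]
lemmas T_word_hom_eqI = word_hom_eqI[OF V_module, unfolded lists_Prim]
lemmas T_word_induct = word_induct[OF V_module, unfolded lists_Prim]

section \<open>The multiplication map from the tensor module\<close>

definition prodl :: "'a list \<Rightarrow> 'a" where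
  "prodl w = foldr (\<otimes>\<^bsub>H\<^esub>) w \<one>\<^bsub>H\<^esub>"

lemma prodl_Nil [simp]: "prodl [] = \<one>\<^bsub>H\<^esub>"
  by (simp add: prodl_def)

lemma prodl_Cons: "prodl (a # w) = a \<otimes>\<^bsub>H\<^esub> prodl w"
  by (simp add: prodl_def)

lemma prodl_closed: "w \<in> lists Prim \<Longrightarrow> prodl w \<in> carrier H"
  by (induction w) (auto simp: prodl_Cons Prim_closed)

lemma prodl_append:
  "\<lbrakk>u \<in> lists Prim; w \<in> lists Prim\<rbrakk> \<Longrightarrow> prodl (u @ w) = prodl u \<otimes>\<^bsub>H\<^esub> prodl w"
proof (induction u)
  case (Cons a u)
  then show ?case
    using prodl_closed[of u] prodl_closed[of w] by (simp add: prodl_Cons Prim_closed H.m_assoc)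
qed (simp add: prodl_closed)

lemma prodl_snoc: "\<lbrakk>u \<in> lists Prim; p \<in> Prim\<rbrakk> \<Longrightarrow> prodl (u @ [p]) = prodl u \<otimes>\<^bsub>H\<^esub> p"
  by (simp add: prodl_append prodl_Cons Prim_closed)

lemma prodl_multilinear: "multilinear K V H prodl"
proof (rule multilinearI)
  fix u w assume "u \<in> lists (carrier V)" "w \<in> lists (carrier V)"
  then have uw: "u \<in> lists Prim" "w \<in> lists Prim" by simp_all
  have "(\<lambda>a. prodl u \<otimes>\<^bsub>H\<^esub> (a \<otimes>\<^bsub>H\<^esub> prodl w)) \<in> module_hom K V H"
    by (intro module_hom_restrict_Prim
        module_hom_comp[OF bilinear_right[OF mult_bilinear] bilinear_left[OF mult_bilinear]]
        prodl_closed uw)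
  then show "(\<lambda>a. prodl (u @ [a] @ w)) \<in> module_hom K V H"
    by (rule module_hom_cong[OF V_module]) (use uw in \<open>simp add: prodl_append prodl_Cons\<close>)
qed (simp add: prodl_closed)

definition phi where "phi = lin_ext K H prodl"

lemma phi_hom: "phi \<in> module_hom K TP H"
  unfolding phi_def by (rule word_lift_hom[OF V_module H_module prodl_multilinear])

lemma phi_word: "w \<in> lists Prim \<Longrightarrow> phi (word K V w) = prodl w"
  unfolding phi_def by (rule word_lift_word[OF V_module H_module prodl_multilinear]) simp

lemma phi_closed [simp]: "t \<in> carrier TP \<Longrightarrow> phi t \<in> carrier H"
  by (rule module_hom_closed[OF phi_hom])

lemma TC_mult_closed: "\<lbrakk>s \<in> carrier TP; t \<in> carrier TP\<rbrakk> \<Longrightarrow> s \<otimes>\<^bsub>TC\<^esub> t \<in> carrier TP"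
  by (rule module_hom_closed[OF Tfc_mult_left_hom[OF V_module]])

text \<open>Both sides are linear in \<open>s\<close> and in \<open>t\<close>, so two reductions to
  words leave the associativity statement \<open>prodl_append\<close>.\<close>

lemma phi_mult:
  assumes s: "s \<in> carrier TP" and t: "t \<in> carrier TP"
  shows "phi (s \<otimes>\<^bsub>TC\<^esub> t) = phi s \<otimes>\<^bsub>H\<^esub> phi t"
proof (rule T_word_hom_eqI[OF H_module module_hom_comp[OF phi_hom Tfc_mult_left_hom[OF V_module t]]
      module_hom_comp[OF bilinear_left[OF mult_bilinear phi_closed[OF t]] phi_hom] _ s])
  fix u assume u: "u \<in> lists Prim"
  then have u': "u \<in> lists (carrier V)" by simp
  note m = multilinear_append_left[OF V_module u']
  have "phi (lin_ext K TP (\<lambda>w. word K V (u @ w)) t) = prodl u \<otimes>\<^bsub>H\<^esub> phi t"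
    by (rule T_word_hom_eqI[OF H_module module_hom_comp[OF phi_hom word_lift_hom[OF V_module T_module m]]
          module_hom_comp[OF bilinear_right[OF mult_bilinear prodl_closed[OF u]] phi_hom] _ t])
      (use u in \<open>simp add: word_lift_word[OF V_module T_module m] phi_word prodl_append\<close>)
  then show "phi (word K V u \<otimes>\<^bsub>TC\<^esub> t) = phi (word K V u) \<otimes>\<^bsub>H\<^esub> phi t"
    using Tfc_mult_word_left[OF V_module t u'] u by (simp add: phi_word)
qed

text \<open>The decomposition used is x = \<epsilon>(x) 1 + \<open>proj (Suc k) x\<close> + \<Sum>
  J(x1) \<open>proj k\<close> (x2). The version with J keeps the induction going: the outer terms of
  \<Delta>(x) drop out, so x1 and x2 can be taken from level k, where x1 is in the image and
  \<open>proj k\<close> has primitive values. The image contains 1 and is thus closed under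
  J.\<close>

lemma Filt_subset_image: "Filt k \<subseteq> phi ` carrier TP"
proof (induction k)
  let ?A = "phi ` carrier TP"
  have A: "submodule ?A K H" by (rule module_hom_image[OF T_module H_module phi_hom])
  note A_smult = submodule.smult_closed[OF A]
  have A_one: "\<one>\<^bsub>H\<^esub> \<in> ?A"
    using phi_word[of "[]"] T_word_closed[of "[]"] by force
  case 0
  show ?case using A_one A_smult by auto
next
  let ?A = "phi ` carrier TP"
  have A: "submodule ?A K H" by (rule module_hom_image[OF T_module H_module phi_hom])
  note A_add = submoduleE(5)[OF A] and A_smult = submodule.smult_closed[OF A]
    and A_neg = submoduleE(3)[OF A]
  have A_one: "\<one>\<^bsub>H\<^esub> \<in> ?A"
    using phi_word[of "[]"] T_word_closed[of "[]"] by force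
  have A_zero: "\<zero>\<^bsub>H\<^esub> \<in> ?A"
    using subgroup.one_closed[OF submodule.axioms(1)[OF A]] by simp
  have A_prim: "p \<in> ?A" if "p \<in> Prim" for p
    using phi_word[of "[p]"] T_word_closed[of "[p]"] that by (force simp: prodl_Cons Prim_closed)
  have A_mult: "a \<otimes>\<^bsub>H\<^esub> b \<in> ?A" if "a \<in> ?A" "b \<in> ?A" for a b
    using that TC_mult_closed by (auto simp: phi_mult[symmetric] simp del: phi_closed)
  have A_J: "J a \<in> ?A" if "a \<in> ?A" for a
  proof -
    have "eps a \<in> carrier K" using that by auto
    then show ?thesis
      unfolding J_def M.minus_eq by (intro A_add A_neg A_smult A_one that)
  qed
  case (Suc k)
  show ?case
  proof
    fix x assume x: "x \<in> Filt (Suc k)"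
    have xc: "x \<in> carrier H" using Filt_closed[OF x] .
    note L = mult_lift_hom[OF J_hom proj_hom[of k]]
    have "Delta x \<in> {t \<in> carrier HH. mult_lift J (proj k) t \<in> ?A}"
    proof (rule Delta_in[OF module_hom_preimage[OF HH_module H_module L A] x])
      fix a b assume ab: "a \<in> Filt k" "b \<in> Filt k"
      have "J a \<otimes>\<^bsub>H\<^esub> proj k b \<in> ?A"
        using A_mult[OF A_J[OF subsetD[OF Suc.IH ab(1)]] A_prim[OF proj_Prim[OF ab(2)]]] .
      then show "pt a b \<in> {t \<in> carrier HH. mult_lift J (proj k) t \<in> ?A}"
        using ab[THEN Filt_closed] by (simp add: mult_lift_pt J_hom proj_hom)
    qed (use xc A_zero in \<open>simp_all add: mult_lift_pt J_hom proj_hom\<close>)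
    then have c: "conv J (proj k) x \<in> ?A" by (simp add: conv_def)
    have "J x = proj (Suc k) x \<oplus>\<^bsub>H\<^esub> conv J (proj k) x"
      using xc module_hom_closed[OF conv_hom[OF J_hom proj_hom] xc] by (simp add: M.diff_add_cancel)
    then have "J x \<in> ?A" using A_add[OF A_prim[OF proj_Prim[OF x]] c] by simp
    then have "J x \<oplus>\<^bsub>H\<^esub> eps x \<odot>\<^bsub>H\<^esub> \<one>\<^bsub>H\<^esub> \<in> ?A"
      using xc by (intro A_add A_smult A_one) auto
    then show "x \<in> ?A" using xc by (simp add: J_def M.diff_add_cancel)
  qed
qed

section \<open>The filtration is an increasing chain of submodules\<close>

lemma Filt_submodule: "submodule (Filt k) K H"
proof (induction k)
  case 0
  have "Filt 0 = (\<lambda>c. c \<odot>\<^bsub>H\<^esub> \<one>\<^bsub>H\<^esub>) ` carrier (scalar_module K)" by auto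
  then show ?case
    using module_hom_image[OF scalar_module_module[OF K_cring] H_module
        bilinear_left[OF smult_bilinear[OF H_module] H.one_closed]] by simp
next
  case (Suc k)
  show ?case
    unfolding conn_filtration.simps
    by (rule module_hom_preimage[OF H_module HH_module W_hom module_span_submodule[OF HH_module]])
      (use Filt_closed in auto)
qed

lemma Filt_Suc: "Filt k \<subseteq> Filt (Suc k)"
proof (induction k)
  case 0
  show ?case
  proof
    fix x assume "x \<in> Filt 0"
    then obtain c where c: "x = c \<odot>\<^bsub>H\<^esub> \<one>\<^bsub>H\<^esub>" "c \<in> carrier K" by auto
    let ?G = "{pt a b | a b. a \<in> Filt 0 \<and> b \<in> Filt 0}" and ?u = "pt \<one>\<^bsub>H\<^esub> \<one>\<^bsub>H\<^esub>"
    have S: "submodule (module_span K HH ?G) K HH"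
      by (rule module_span_submodule[OF HH_module]) (use Filt_closed in auto)
    have one: "\<one>\<^bsub>H\<^esub> \<in> Filt 0"
      using smult_one[OF H.one_closed] R.one_closed by (auto intro!: exI[of _ "\<one>\<^bsub>K\<^esub>"])
    then have u: "?u \<in> module_span K HH ?G"
      using module_span_subset[of ?G K HH] by blast
    \<comment> \<open>This is -(1 \<otimes> 1), left as a sum because each summand visibly lies in
      the span.\<close>
    have "W \<one>\<^bsub>H\<^esub> = ?u \<oplus>\<^bsub>HH\<^esub> \<ominus>\<^bsub>HH\<^esub> ?u \<oplus>\<^bsub>HH\<^esub> \<ominus>\<^bsub>HH\<^esub> ?u"
      by (simp add: reduced_coprod_def Delta_one HH.minus_eq)
    then have "W x = c \<odot>\<^bsub>HH\<^esub> (?u \<oplus>\<^bsub>HH\<^esub> \<ominus>\<^bsub>HH\<^esub> ?u \<oplus>\<^bsub>HH\<^esub> \<ominus>\<^bsub>HH\<^esub> ?u)"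
      using c module_hom_smult[OF W_hom c(2) H.one_closed] by simp
    also have "\<dots> \<in> module_span K HH ?G"
      by (intro submodule.smult_closed[OF S] HH.submoduleE(5)[OF S] HH.submoduleE(3)[OF S] u c)
    finally show "x \<in> Filt (Suc 0)" using c by simp
  qed
next
  case (Suc k)
  have "{pt a b | a b. a \<in> Filt k \<and> b \<in> Filt k}
      \<subseteq> {pt a b | a b. a \<in> Filt (Suc k) \<and> b \<in> Filt (Suc k)}"
    using Suc by blast
  from module_span_mono[OF this] show ?case
    unfolding conn_filtration.simps(2)[of K H "Suc k"] by (subst conn_filtration.simps(2)) blast
qed

lemma Filt_mono: "k \<le> m \<Longrightarrow> Filt k \<subseteq> Filt m"
  by (rule lift_Suc_mono_le[of Filt]) (rule Filt_Suc)

lemma one_Filt: "\<one>\<^bsub>H\<^esub> \<in> Filt k"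
proof -
  have "\<one>\<^bsub>H\<^esub> \<in> Filt 0"
    using smult_one[OF H.one_closed] R.one_closed by (auto intro!: exI[of _ "\<one>\<^bsub>K\<^esub>"])
  then show ?thesis using Filt_mono[of 0 k] by blast
qed

lemma proj_eq: "\<lbrakk>x \<in> Filt k; k \<le> m\<rbrakk> \<Longrightarrow> proj m x = proj k x"
proof (induction m)
  case (Suc m)
  show ?case
  proof (cases "k = Suc m")
    case False
    then have "k \<le> m" using Suc.prems by simp
    moreover have "x \<in> Filt m" using Filt_mono[OF \<open>k \<le> m\<close>] Suc.prems by blast
    ultimately show ?thesis using proj_stationary[of x m] Suc by simp
  qed simp
qed simp

section \<open>Products with a primitive right factor\<close>

lemma J_mult_prim:
  assumes "x \<in> carrier H" "p \<in> Prim"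
  shows "J (x \<otimes>\<^bsub>H\<^esub> p) = x \<otimes>\<^bsub>H\<^esub> p"
    and "J x \<otimes>\<^bsub>H\<^esub> p = x \<otimes>\<^bsub>H\<^esub> p \<ominus>\<^bsub>H\<^esub> eps x \<odot>\<^bsub>H\<^esub> p"
proof -
  have p: "p \<in> carrier H" using Prim_closed[OF assms(2)] .
  show "J (x \<otimes>\<^bsub>H\<^esub> p) = x \<otimes>\<^bsub>H\<^esub> p"
    using assms p by (simp add: J_def eps_mult_prim M.minus_eq)
  show "J x \<otimes>\<^bsub>H\<^esub> p = x \<otimes>\<^bsub>H\<^esub> p \<ominus>\<^bsub>H\<^esub> eps x \<odot>\<^bsub>H\<^esub> p"
    using module_hom_minus[OF bilinear_left[OF mult_bilinear p] H_module H_module] assms p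
    by (simp add: J_def smult_mult_left)
qed

text \<open>The induction follows the level of x, not that of x p. By \<open>Delta_mult_prim\<close>
  the convolution of J with \<open>proj (Suc k)\<close> at x p is \<Sum> J(x1) \<epsilon>(x2) p =
  J(x) p = x p - \<epsilon>(x) p, while J(x p) = x p. The index starts at 1 because
  \<open>proj 0\<close> is zero, whereas \<open>proj 1\<close> already fixes multiples of p.\<close>

lemma proj_mult_prim:
  "\<lbrakk>x \<in> Filt k; p \<in> Prim\<rbrakk> \<Longrightarrow> proj (Suc k) (x \<otimes>\<^bsub>H\<^esub> p) = eps x \<odot>\<^bsub>H\<^esub> p"
proof (induction k arbitrary: x)
  case 0
  then obtain c where c: "x = c \<odot>\<^bsub>H\<^esub> \<one>\<^bsub>H\<^esub>" "c \<in> carrier K" by auto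
  have p: "p \<in> carrier H" using Prim_closed[OF 0(2)] .
  have z: "conv J (\<lambda>x. \<zero>\<^bsub>H\<^esub>) y = \<zero>\<^bsub>H\<^esub>" if "y \<in> carrier H" for y
    unfolding conv_def
    by (rule HH_hom_eqI[OF H_module mult_lift_hom[OF J_hom module_hom_const_zero[OF H_module]]
          module_hom_const_zero[OF H_module]])
      (use that in \<open>auto simp: mult_lift_pt[OF J_hom module_hom_const_zero[OF H_module]]\<close>)
  have "proj (Suc 0) (x \<otimes>\<^bsub>H\<^esub> p) = x \<otimes>\<^bsub>H\<^esub> p"
    using c p J_mult_prim(1)[of x p] 0(2) by (simp add: z M.minus_eq)
  also have "\<dots> = eps x \<odot>\<^bsub>H\<^esub> p" using c p by (simp add: smult_mult_left counit_smult eps_one)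
  finally show ?case .
next
  case (Suc k)
  have xc: "x \<in> carrier H" using Filt_closed[OF Suc.prems(1)] .
  have p: "p \<in> carrier H" using Prim_closed[OF Suc.prems(2)] .
  let ?m = "proj (Suc k)" and ?E' = "tensor_lift K H (\<lambda>a b. eps b \<odot>\<^bsub>H\<^esub> a)"
  note E' = lift_hom[OF H_module bilinear_swap[OF eps_smult_bilinear]]
  note E'_pt = lift_pt[OF H_module bilinear_swap[OF eps_smult_bilinear]]
  have g: "(\<lambda>b. eps b \<odot>\<^bsub>H\<^esub> p) \<in> module_hom K H H"
    by (rule bilinear_left[OF eps_smult_bilinear p])
  note L = mult_lift_hom[OF J_hom proj_hom[of "Suc k"]]
  have tp: "(\<lambda>t. tm t (pt \<one>\<^bsub>H\<^esub> p)) \<in> module_hom K HH HH"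
    by (rule tm_hom_left) (simp add: p)
  \<comment> \<open>Handles the outer term x \<otimes> 1, which multiplication by 1 \<otimes> p
    turns into x \<otimes> p; it is the induction hypothesis at the unit.\<close>
  have proj_p: "?m p = p"
    using Suc.IH[OF one_Filt Suc.prems(2)] p by (simp add: eps_one del: proj.simps)
  have "mult_lift J ?m (tm (Delta x) (pt \<one>\<^bsub>H\<^esub> p)) = mult_lift J (\<lambda>b. eps b \<odot>\<^bsub>H\<^esub> p) (Delta x)"
    by (rule Delta_hom_eq[OF H_module module_hom_comp[OF L tp] mult_lift_hom[OF J_hom g] Suc.prems(1)])
      (use xc p Filt_closed[of _ k] Suc.IH[OF _ Suc.prems(2)] in
        \<open>simp_all add: tm_pt mult_lift_pt[OF J_hom g] mult_lift_pt[OF J_hom proj_hom] proj_p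
          eps_one del: proj.simps\<close>)
  also have "\<dots> = J (?E' (Delta x)) \<otimes>\<^bsub>H\<^esub> p"
    by (rule HH_hom_eqI[OF H_module mult_lift_hom[OF J_hom g]
        module_hom_comp[OF bilinear_left[OF mult_bilinear p] module_hom_comp[OF J_hom E']]])
      (use xc p in \<open>auto simp: mult_lift_pt[OF J_hom g] E'_pt module_hom_smult[OF J_hom]
        smult_mult_left smult_mult_right\<close>)
  also have "\<dots> = x \<otimes>\<^bsub>H\<^esub> p \<ominus>\<^bsub>H\<^esub> eps x \<odot>\<^bsub>H\<^esub> p"
    using xc Suc.prems(2) by (simp add: counit_right J_mult_prim)
  finally have "conv J ?m (x \<otimes>\<^bsub>H\<^esub> p) = x \<otimes>\<^bsub>H\<^esub> p \<ominus>\<^bsub>H\<^esub> eps x \<odot>\<^bsub>H\<^esub> p"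
    using xc p
    by (simp add: conv_def Delta_mult_prim[OF xc Suc.prems(2)] module_hom_add[OF L]
        mult_lift_pt[OF J_hom proj_hom] del: proj.simps)
  then show ?case
    using xc p Suc.prems(2)
    by (subst proj.simps(2)) (simp add: J_mult_prim M.minus_eq M.minus_add M.a_assoc[symmetric] M.r_neg
        del: proj.simps)
qed

lemma eps_prodl:
  assumes "w \<in> lists Prim"
  shows "eps (prodl w) = (if w = [] then \<one>\<^bsub>K\<^esub> else \<zero>\<^bsub>K\<^esub>)"
proof (cases w rule: rev_cases)
  case (snoc u p)
  then show ?thesis using assms by (simp add: prodl_snoc eps_mult_prim prodl_closed)
qed (simp add: eps_one)

text \<open>Induction on the last letter, since \<open>Delta_mult_prim\<close> has its primitive
  factor on the right: multiplying by 1 \<otimes> p appends p to the right part of each old cut, and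
  the remaining term is the new cut at the very end.\<close>

lemma Delta_prodl:
  "w \<in> lists Prim \<Longrightarrow>
    Delta (prodl w) = (\<Oplus>\<^bsub>HH\<^esub>i\<in>{0..length w}. pt (prodl (take i w)) (prodl (drop i w)))"
proof (induction w rule: rev_induct)
  case Nil
  show ?case by (simp add: Delta_one)
next
  case (snoc p w)
  then have w: "w \<in> lists Prim" and p: "p \<in> Prim" by auto
  have pc: "p \<in> carrier H" using Prim_closed[OF p] .
  have take_drop: "take i v \<in> lists Prim" "drop i v \<in> lists Prim" if "v \<in> lists Prim" for i v
    using that by (auto dest: in_set_takeD in_set_dropD)
  let ?f = "\<lambda>w i. pt (prodl (take i w)) (prodl (drop i w))"
  have fc: "?f v i \<in> carrier HH" if "v \<in> lists Prim" for i v
    by (intro pt_closed prodl_closed take_drop that)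
  have tp: "(\<lambda>t. tm t (pt \<one>\<^bsub>H\<^esub> p)) \<in> module_hom K HH HH"
    by (rule tm_hom_left) (simp add: pc)
  have eq: "tm (?f w i) (pt \<one>\<^bsub>H\<^esub> p) = ?f (w @ [p]) i" if "i \<le> length w" for i
    using that pc p take_drop[OF w, of i] by (simp add: tm_pt prodl_closed prodl_snoc)
  have "tm (Delta (prodl w)) (pt \<one>\<^bsub>H\<^esub> p) = (\<Oplus>\<^bsub>HH\<^esub>i\<in>{0..length w}. tm (?f w i) (pt \<one>\<^bsub>H\<^esub> p))"
    unfolding snoc.IH[OF w] by (rule module_hom_finsum[OF tp HH_module HH_module]) (use fc[OF w] in auto)
  also have "\<dots> = (\<Oplus>\<^bsub>HH\<^esub>i\<in>{0..length w}. ?f (w @ [p]) i)"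
    by (rule HH.finsum_cong') (use eq fc[OF snoc.prems] in auto)
  finally have *: "tm (Delta (prodl w)) (pt \<one>\<^bsub>H\<^esub> p) = (\<Oplus>\<^bsub>HH\<^esub>i\<in>{0..length w}. ?f (w @ [p]) i)" .
  have "(\<Oplus>\<^bsub>HH\<^esub>i\<in>insert (Suc (length w)) {0..length w}. ?f (w @ [p]) i)
      = ?f (w @ [p]) (Suc (length w)) \<oplus>\<^bsub>HH\<^esub> (\<Oplus>\<^bsub>HH\<^esub>i\<in>{0..length w}. ?f (w @ [p]) i)"
  proof (rule HH.finsum_insert)
    show "?f (w @ [p]) \<in> {0..length w} \<rightarrow> carrier HH"
      using fc[OF snoc.prems] by blast
    show "?f (w @ [p]) (Suc (length w)) \<in> carrier HH"
      by (rule fc[OF snoc.prems])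
  qed auto
  moreover have "{0..length (w @ [p])} = insert (Suc (length w)) {0..length w}" by auto
  moreover have "?f (w @ [p]) (Suc (length w)) = pt (prodl (w @ [p])) \<one>\<^bsub>H\<^esub>" by simp
  ultimately show ?case
    using Delta_mult_prim[OF prodl_closed[OF w] p] w p by (simp add: prodl_snoc *)
qed

end

section \<open>Injectivity: recovering a word from its product\<close>

locale connected_uib = nontrivial_uib K H
  for K :: "('k, 'r) ring_scheme" and H :: "('k, 'a, 'm) bialg_scheme" +
  assumes connected: "connected_bialg K H"
begin

lemma ex_Filt: "x \<in> carrier H \<Longrightarrow> \<exists>k. x \<in> Filt k"
  using connected unfolding connected_bialg_def by blast

lemma phi_surj: "phi ` carrier TP = carrier H"
  using Filt_subset_image ex_Filt by fastforce

section \<open>The limit of the iterates\<close>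

definition e where "e x = proj (LEAST k. x \<in> Filt k) x"

lemma e_eq: "x \<in> Filt k \<Longrightarrow> e x = proj k x"
  unfolding e_def using proj_eq[OF LeastI[of "\<lambda>k. x \<in> Filt k" k] Least_le] by simp

lemma e_Prim: "x \<in> carrier H \<Longrightarrow> e x \<in> Prim"
  using ex_Filt e_eq proj_Prim by metis

text \<open>Two elements are compared at a common level, where \<open>e\<close> is one fixed
  iterate. The target is \<open>V\<close> rather than H so that values of \<open>e\<close> can serve
  as letters.\<close>

lemma e_hom: "e \<in> module_hom K H V"
proof (rule module_homI)
  fix x assume x: "x \<in> carrier H"
  then obtain k where k: "x \<in> Filt k" using ex_Filt by blast
  show "e x \<in> carrier V" using e_Prim[OF x] by simp
  show "e (c \<odot>\<^bsub>H\<^esub> x) = c \<odot>\<^bsub>V\<^esub> e x" if c: "c \<in> carrier K" for c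
    using e_eq[OF k] e_eq[OF submodule.smult_closed[OF Filt_submodule c k]]
      module_hom_smult[OF proj_hom c x] by simp
  show "e (x \<oplus>\<^bsub>H\<^esub> y) = e x \<oplus>\<^bsub>V\<^esub> e y" if y: "y \<in> carrier H" for y
  proof -
    obtain l where l: "y \<in> Filt l" using ex_Filt[OF y] by blast
    have xy: "x \<in> Filt (max k l)" "y \<in> Filt (max k l)"
      using Filt_mono[of k "max k l"] Filt_mono[of l "max k l"] k l by auto
    then have "x \<oplus>\<^bsub>H\<^esub> y \<in> Filt (max k l)" using submoduleE(5)[OF Filt_submodule] by blast
    then show ?thesis using e_eq xy module_hom_add[OF proj_hom x y] by simp
  qed
qed

lemma e_one: "e \<one>\<^bsub>H\<^esub> = \<zero>\<^bsub>H\<^esub>"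
  using e_eq[OF one_Filt[of 0]] by simp

lemma e_mult_prim:
  assumes x: "x \<in> carrier H" and p: "p \<in> Prim"
  shows "e (x \<otimes>\<^bsub>H\<^esub> p) = eps x \<odot>\<^bsub>H\<^esub> p"
proof -
  obtain k l where k: "x \<in> Filt k" and l: "x \<otimes>\<^bsub>H\<^esub> p \<in> Filt l"
    using ex_Filt x Prim_closed[OF p] by (metis H.m_closed)
  \<comment> \<open>The level of the product is not computed; a common index large enough for both
    factors and product is taken, shifted by one to fit \<open>proj_mult_prim\<close>.\<close>
  have "x \<in> Filt (max k l)" "x \<otimes>\<^bsub>H\<^esub> p \<in> Filt (Suc (max k l))"
    using subsetD[OF Filt_mono k] subsetD[OF Filt_mono l] by (simp_all del: conn_filtration.simps)
  then show ?thesis using e_eq[of _ "Suc (max k l)"] proj_mult_prim[OF _ p] by metis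
qed

section \<open>Reading a word off its product from the right\<close>

definition snoc where "snoc s v = s \<otimes>\<^bsub>TC\<^esub> word K V [v]"

lemma snoc_word:
  assumes "u \<in> lists Prim" "v \<in> Prim"
  shows "snoc (word K V u) v = word K V (u @ [v])"
proof -
  have u: "u \<in> lists (carrier V)" "[v] \<in> lists (carrier V)" using assms by auto
  show ?thesis
    unfolding snoc_def
    using Tfc_mult_word_left[OF V_module T_word_closed, of "[v]" u]
      word_lift_word[OF V_module T_module multilinear_append_left[OF V_module u(1)] u(2)] assms
    by simp
qed

text \<open>Linearity in the appended letter is multilinearity of \<open>word\<close> when the first
  argument is a word, and is then carried over to general tensors.\<close>

lemma snoc_bilinear: "bilinear K TP V TP snoc"
proof (rule bilinear_from_generators[OF T_module T_module T_word_induct])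
  show "(\<lambda>s. snoc s v) \<in> module_hom K TP TP" if "v \<in> carrier V" for v
    unfolding snoc_def by (rule Tfc_mult_left_hom[OF V_module T_word_closed]) (use that in simp)
  show "snoc t \<in> module_hom K V TP" if t: "t \<in> word K V ` lists Prim" for t
  proof -
    obtain u where u: "t = word K V u" "u \<in> lists Prim" using t by blast
    have "(\<lambda>v. word K V (u @ [v] @ [])) \<in> module_hom K V TP"
      by (rule multilinear_slot[OF word_multilinear[OF V_module]]) (use u in auto)
    then show ?thesis
      by (rule module_hom_cong[OF V_module]) (use u snoc_word in simp)
  qed
qed (use T_word_closed V_module in auto)

text \<open>Iterates of the equation \<open>\<psi>(x) = \<epsilon>(x) 1 + \<Sum> \<psi>(x\<^sub>1) e(x\<^sub>2)\<close>, which the inverse of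
  \<^term>\<open>phi\<close> satisfies since \<open>id = \<epsilon> + id \<star> e\<close>.\<close>

primrec psi :: "nat \<Rightarrow> 'a \<Rightarrow> ('a list \<Rightarrow> 'k) set" where
  "psi 0 = (\<lambda>x. \<zero>\<^bsub>TP\<^esub>)"
| "psi (Suc k) = (\<lambda>x. eps x \<odot>\<^bsub>TP\<^esub> word K V [] \<oplus>\<^bsub>TP\<^esub>
     tensor_lift K TP (\<lambda>a b. snoc (psi k a) (e b)) (Delta x))"

lemma psi_hom: "psi k \<in> module_hom K H TP"
proof (induction k)
  case 0
  show ?case using module_hom_const_zero[OF T_module] by simp
next
  case (Suc k)
  have "(\<lambda>x. eps x \<odot>\<^bsub>TP\<^esub> word K V []) \<in> module_hom K H TP"
    by (rule module_hom_comp[OF bilinear_left[OF smult_bilinear[OF T_module]] eps_hom])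
      (use T_word_closed in simp)
  moreover have "(\<lambda>x. tensor_lift K TP (\<lambda>a b. snoc (psi k a) (e b)) (Delta x)) \<in> module_hom K H TP"
    by (rule module_hom_comp[OF lift_hom[OF T_module bilinear_comp[OF snoc_bilinear Suc e_hom]] coprod_hom])
  ultimately show ?case
    unfolding psi.simps by (rule module_hom_pw_add[OF T_module])
qed

text \<open>Each iteration recovers one letter, the last, by \<open>e_mult_prim\<close>, and hands
  the product of the remaining letters to the previous iterate. The inequality is strict because the
  empty word itself takes one iteration, \<open>psi 0\<close> being zero.\<close>

lemma psi_prodl: "\<lbrakk>w \<in> lists Prim; length w < k\<rbrakk> \<Longrightarrow> psi k (prodl w) = word K V w"
proof (induction k arbitrary: w)
  case (Suc k)
  interpret TM: module K TP by (rule T_module)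
  let ?S = "tensor_lift K TP (\<lambda>a b. snoc (psi k a) (e b))"
  note B = bilinear_comp[OF snoc_bilinear psi_hom[of k] e_hom]
  note S = lift_hom[OF T_module B] and S_pt = lift_pt[OF T_module B]
  note psi_closed = module_hom_closed[OF psi_hom]
  have Nil_closed: "word K V [] \<in> carrier TP" using T_word_closed by simp
  have snoc_zero: "snoc s (e \<one>\<^bsub>H\<^esub>) = \<zero>\<^bsub>TP\<^esub>" if "s \<in> carrier TP" for s
    using module_hom_zero[OF bilinear_right[OF snoc_bilinear that] V_module T_module]
    by (simp add: e_one)
  show ?case
  proof (cases w rule: rev_cases)
    case Nil
    then show ?thesis
      using Nil_closed psi_closed by (simp add: eps_one Delta_one S_pt snoc_zero)
  next
    case (snoc u p)
    then have u: "u \<in> lists Prim" and p: "p \<in> Prim" and len: "length u < k"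
      using Suc.prems by auto
    have pc: "p \<in> carrier H" using Prim_closed[OF p] .
    let ?y = "prodl u" and ?E' = "tensor_lift K H (\<lambda>a b. eps b \<odot>\<^bsub>H\<^esub> a)"
    have y: "?y \<in> carrier H" by (rule prodl_closed[OF u])
    note E' = lift_hom[OF H_module bilinear_swap[OF eps_smult_bilinear]]
    note E'_pt = lift_pt[OF H_module bilinear_swap[OF eps_smult_bilinear]]
    have tp: "(\<lambda>t. tm t (pt \<one>\<^bsub>H\<^esub> p)) \<in> module_hom K HH HH"
      by (rule tm_hom_left) (simp add: pc)
    have pV: "p \<in> carrier V" using p by simp
    \<comment> \<open>After \<open>e_mult_prim\<close> the scalar \<epsilon>(b) sits on the letter
      \<open>p\<close>. Moving it into the argument of \<open>psi k\<close> makes the right counit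
      act on \<Delta>(y), which returns y.\<close>
    have "?S (tm (Delta ?y) (pt \<one>\<^bsub>H\<^esub> p)) = snoc (psi k (?E' (Delta ?y))) p"
    proof (rule HH_hom_eqI[OF T_module module_hom_comp[OF S tp]
          module_hom_comp[OF bilinear_left[OF snoc_bilinear pV] module_hom_comp[OF psi_hom E']]])
      fix a b assume ab: "a \<in> carrier H" "b \<in> carrier H"
      have "snoc (psi k a) (eps b \<odot>\<^bsub>H\<^esub> p) = eps b \<odot>\<^bsub>TP\<^esub> snoc (psi k a) p"
        using module_hom_smult[OF bilinear_right[OF snoc_bilinear psi_closed], of a "eps b" p] ab p by simp
      also have "\<dots> = snoc (psi k (eps b \<odot>\<^bsub>H\<^esub> a)) p"
        using module_hom_smult[OF bilinear_left[OF snoc_bilinear pV], of "eps b" "psi k a"] ab psi_closed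
        by (simp add: module_hom_smult[OF psi_hom])
      finally show "?S (tm (pt a b) (pt \<one>\<^bsub>H\<^esub> p)) = snoc (psi k (?E' (pt a b))) p"
        using ab pc p by (simp add: tm_pt S_pt E'_pt e_mult_prim)
    qed (simp add: y)
    also have "\<dots> = word K V w"
      using y u p len snoc by (simp add: counit_right Suc.IH snoc_word)
    \<comment> \<open>The zero is the contribution of y p \<otimes> 1, whose second factor
      \<open>e\<close> sends to 0.\<close>
    finally have "?S (Delta (?y \<otimes>\<^bsub>H\<^esub> p)) = \<zero>\<^bsub>TP\<^esub> \<oplus>\<^bsub>TP\<^esub> word K V w"
      using y pc psi_closed by (simp add: Delta_mult_prim[OF y p] module_hom_add[OF S] S_pt snoc_zero)
    then show ?thesis
      using u p y Nil_closed T_word_closed[OF Suc.prems(1)] snoc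
      by (simp add: prodl_snoc eps_mult_prim)
  qed
qed simp

text \<open>Word lengths are unbounded, so the left inverse is sought eventually: the tensors
  recovered by all sufficiently late iterates form a submodule, closed under sums by taking the
  larger bound, and it contains every word.\<close>

lemma phi_inj: "inj_on phi (carrier TP)"
proof -
  interpret TM: module K TP by (rule T_module)
  let ?N = "{t \<in> carrier TP. \<exists>k. \<forall>n\<ge>k. psi n (phi t) = t}"
  note ph = module_hom_comp[OF psi_hom phi_hom]
  have "submodule ?N K TP"
  proof (rule TM.submoduleI)
    show "\<zero>\<^bsub>TP\<^esub> \<in> ?N" using module_hom_zero[OF ph T_module T_module] by simp
    show "\<ominus>\<^bsub>TP\<^esub> t \<in> ?N" if t: "t \<in> ?N" for t
    proof -
      obtain k where "\<forall>n\<ge>k. psi n (phi t) = t" using t by blast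
      then have "\<forall>n\<ge>k. psi n (phi (\<ominus>\<^bsub>TP\<^esub> t)) = \<ominus>\<^bsub>TP\<^esub> t"
        using module_hom_a_inv[OF ph T_module T_module] t by simp
      then show ?thesis using t by blast
    qed
    show "c \<odot>\<^bsub>TP\<^esub> t \<in> ?N" if c: "c \<in> carrier K" and t: "t \<in> ?N" for c t
    proof -
      obtain k where "\<forall>n\<ge>k. psi n (phi t) = t" using t by blast
      then have "\<forall>n\<ge>k. psi n (phi (c \<odot>\<^bsub>TP\<^esub> t)) = c \<odot>\<^bsub>TP\<^esub> t"
        using module_hom_smult[OF ph c] t by simp
      then show ?thesis using t c by blast
    qed
    show "s \<oplus>\<^bsub>TP\<^esub> t \<in> ?N" if st: "s \<in> ?N" "t \<in> ?N" for s t
    proof -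
      obtain k l where "\<forall>n\<ge>k. psi n (phi s) = s" "\<forall>n\<ge>l. psi n (phi t) = t" using st by blast
      then have "\<forall>n\<ge>max k l. psi n (phi (s \<oplus>\<^bsub>TP\<^esub> t)) = s \<oplus>\<^bsub>TP\<^esub> t"
        using module_hom_add[OF ph] st by simp
      then show ?thesis using st by blast
    qed
  qed blast
  then have "carrier TP \<subseteq> ?N"
  proof (rule T_word_induct)
    show "word K V ` lists Prim \<subseteq> ?N"
    proof
      fix t assume "t \<in> word K V ` lists Prim"
      then obtain w where w: "t = word K V w" "w \<in> lists Prim" by blast
      then have "\<forall>n\<ge>Suc (length w). psi n (phi t) = t"
        by (simp add: phi_word psi_prodl del: psi.simps)
      then show "t \<in> ?N" using w T_word_closed by blast
    qed
  qed
  then have N: "\<exists>k. \<forall>n\<ge>k. psi n (phi t) = t" if "t \<in> carrier TP" for t using that by blast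
  show ?thesis
  proof (rule inj_onI)
    fix s t assume st: "s \<in> carrier TP" "t \<in> carrier TP" "phi s = phi t"
    obtain k l where "\<forall>n\<ge>k. psi n (phi s) = s" "\<forall>n\<ge>l. psi n (phi t) = t" using N st by metis
    then have "psi (max k l) (phi s) = s" "psi (max k l) (phi t) = t"
      by (meson max.cobounded1 max.cobounded2)+
    then show "s = t" using st(3) by metis
  qed
qed

section \<open>The inverse respects the whole bialgebra structure\<close>

lemma inverse_in_bialg_iso: "inv_into (carrier TP) phi \<in> bialg_iso K H TC"
proof -
  interpret TM: module K TP by (rule T_module)
  let ?f = "inv_into (carrier TP) phi"
  have f_phi: "?f (phi t) = t" if "t \<in> carrier TP" for t
    by (rule inv_into_f_f[OF phi_inj that])
  have f_closed: "?f x \<in> carrier TP" and phi_f: "phi (?f x) = x" if "x \<in> carrier H" for x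
    using that phi_surj by (auto intro: inv_into_into f_inv_into_f)
  have f_eqI: "?f x = t" if "t \<in> carrier TP" "phi t = x" for x t
    using f_phi that by blast
  have f: "?f \<in> module_hom K H TP"
    by (rule module_homI)
      (auto intro!: f_eqI simp: f_closed phi_f module_hom_add[OF phi_hom] module_hom_smult[OF phi_hom])
  have f_prodl: "?f (prodl w) = word K V w" if "w \<in> lists Prim" for w
    by (rule f_eqI[OF T_word_closed[OF that] phi_word[OF that]])
  have "bij_betw phi (carrier TP) (carrier H)"
    using phi_inj phi_surj by (simp add: bij_betw_def)
  then have bij: "bij_betw ?f (carrier H) (carrier TC)"
    using bij_betw_inv_into Tfc_sel(1)[OF V_module] by metis
  have ring: "?f \<in> ring_iso H TC"
  proof (rule ring_iso_memI)
    show "?f (x \<otimes>\<^bsub>H\<^esub> y) = ?f x \<otimes>\<^bsub>TC\<^esub> ?f y" if "x \<in> carrier H" "y \<in> carrier H" for x y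
      by (rule f_eqI) (use that in \<open>auto simp: f_closed phi_f phi_mult TC_mult_closed\<close>)
    show "?f \<one>\<^bsub>H\<^esub> = \<one>\<^bsub>TC\<^esub>"
      using f_prodl[of "[]"] by (simp add: Tfc_sel[OF V_module])
  qed (use bij f_closed module_hom_add[OF f] in \<open>auto simp: Tfc_sel[OF V_module]\<close>)
  have TT: "module K (tensor K TP TP)" by (rule tensor_module_module[OF T_module T_module])
  have ff_bil: "bilinear K H H (tensor K TP TP) (\<lambda>a b. pure_tensor K TP TP (?f a) (?f b))"
    by (rule bilinear_comp[OF pure_tensor_bilinear[OF T_module T_module] f f])
  have ff_eq: "tensor_map K TC TC ?f ?f
      = tensor_lift K (tensor K TP TP) (\<lambda>a b. pure_tensor K TP TP (?f a) (?f b))"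
    unfolding tensor_map_def tensor_Tfc[OF V_module] by (simp add: tensor_lift_def)
  note ff = lift_hom[OF TT ff_bil, folded ff_eq] and ff_pt = lift_pt[OF TT ff_bil, folded ff_eq]
  have coprod: "coprod TC (?f x) = tensor_map K TC TC ?f ?f (Delta x)" if x: "x \<in> carrier H" for x
  proof -
    \<comment> \<open>Writing x as \<open>phi t\<close> moves the identity to the tensor module,
      where it only has to hold on words; there \<open>Delta_prodl\<close> matches deconcatenation
      cut by cut.\<close>
    have "coprod TC t = tensor_map K TC TC ?f ?f (Delta (phi t))" if t: "t \<in> carrier TP" for t
    proof (rule T_word_hom_eqI[OF TT Tfc_coprod_hom[OF V_module]
          module_hom_comp[OF ff module_hom_comp[OF coprod_hom phi_hom]] _ t])
      fix w assume w: "w \<in> lists Prim"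
      have td: "take i w \<in> lists Prim" "drop i w \<in> lists Prim" for i
        using w by (auto dest: in_set_takeD in_set_dropD)
      have "tensor_map K TC TC ?f ?f (Delta (phi (word K V w)))
          = (\<Oplus>\<^bsub>tensor K TP TP\<^esub>i\<in>{0..length w}.
              tensor_map K TC TC ?f ?f (pt (prodl (take i w)) (prodl (drop i w))))"
        unfolding phi_word[OF w] Delta_prodl[OF w]
        by (rule module_hom_finsum[OF ff HH_module TT]) (use td prodl_closed in auto)
      also have "\<dots> = (\<Oplus>\<^bsub>tensor K TP TP\<^esub>i\<in>{0..length w}.
          pure_tensor K TP TP (word K V (take i w)) (word K V (drop i w)))"
        using td by (simp add: ff_pt prodl_closed f_prodl)
      finally show "coprod TC (word K V w) = tensor_map K TC TC ?f ?f (Delta (phi (word K V w)))"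
        using Tfc_coprod_word[OF V_module, of w] w by simp
    qed
    from this[OF f_closed[OF x]] show ?thesis by (simp add: phi_f[OF x])
  qed
  have counit: "counit TC (?f x) = eps x" if x: "x \<in> carrier H" for x
  proof -
    have "counit TC t = eps (phi t)" if t: "t \<in> carrier TP" for t
      by (rule T_word_hom_eqI[OF scalar_module_module[OF K_cring] Tfc_counit_hom[OF V_module]
            module_hom_comp[OF eps_hom phi_hom] _ t])
        (simp add: Tfc_counit_word[OF V_module] phi_word eps_prodl)
    from this[OF f_closed[OF x]] show ?thesis by (simp add: phi_f[OF x])
  qed
  have "?f \<in> module_hom K H TC" using f by (simp add: module_hom_Tfc[OF V_module])
  then show ?thesis using ring coprod counit by (simp add: bialg_iso_def)
qed

end

theorem theorem2p6:
  fixes K :: "('k, 'r) ring_scheme" and H :: "('k, 'a, 'm) bialg_scheme"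
  assumes "field K"
    and "unital_infinitesimal_bialgebra K H"
    and "\<one>\<^bsub>H\<^esub> \<noteq> \<zero>\<^bsub>H\<^esub>"
    and "connected_bialg K H"
  shows "\<exists>f. f \<in> bialg_iso K H (Tfc K (primitive_module K H))"
proof -
  interpret connected_uib K H
    using assms by (intro connected_uib.intro nontrivial_uib.intro nontrivial_uib_axioms.intro
        connected_uib_axioms.intro)
  show ?thesis using inverse_in_bialg_iso by blast
qed

end
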